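(* Consider the analytic family of foliations $\mathcal{F}_\lambda$, the Dulac map $\mathcal{D}_\lambda$ and the holonomy map $h_\sigma^\lambda$ described in the context. For a suitable choice of $\varepsilon_0>0$ and of a continuous function $\varphi\mapsto\rho(\varphi)>0$ for which $\mathcal{D}_\lambda$ is analytic in the domain $\{|\lambda|<\varepsilon_0,\ 0<\rho<\rho(\varphi)\}$, the following holds for every $\lambda\in\mathbb{R}^N$ with $|\lambda|<\varepsilon_0$. The zero locus $$\mathcal{H}_\lambda=\{z=(\rho,\varphi)\in\mathbb{C}_\bullet:\ \operatorname{Im}\mathcal{D}_\lambda(z)=0,\ 0<\rho<\rho(\varphi),\ \varphi\in\mathbb{R}\}$$ of the imaginary part of the Dulac map is a union of connected components $\mathcal{H}_{\lambda,k}$ indexed by $k\in\mathbb{Z}$. For $k\in\mathbb{Z}$ let $$C_{\lambda,k}=\{z\in\mathbb{C}=\mathbb{R}^2:\ (h_\sigma^\lambda)^k(z)=\bar z\}$$ (a germ of a real analytic set at the origin of $\mathbb{R}^2$). Then: (1) Each $C_{\lambda,k}$ is a germ of a real analytic curve in $\mathbb{R}^2$, which is smooth at the origin and tangent there to the line $\{z=s\,e^{ik\pi/\alpha(\lambda)}: s\in(\mathbb{R},0)\}$. (2) Each connected component $\mathcal{H}_{\lambda,k}$ is projected by $\pi:\mathbb{C}_\bullet\to\mathbb{C}\setminus\{0\}$ to the connected component of $C_{\lambda,k}\setminus\{0\}$ which is tangent at the origin to the half-line $\{s\,e^{ik\pi/\alpha(\lambda)}: s>0\}$.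
   Context: Setting: $\mathcal{F}_\lambda$, $\lambda\in\mathbb{R}^N$ near $0$, is a family of real analytic plane foliations, analytic in $(x,y,\lambda)$ in a neighborhood of the origin of $\mathbb{R}^2\times\mathbb{R}^N$, of the form $$\mathcal{F}_\lambda:\quad x(1+\cdots)\,dy+\alpha(\lambda)\,y(1+\cdots)\,dx=0,\qquad \alpha(0)>0,$$ where the dots are higher order terms in $x,y$ with coefficients depending analytically on $\lambda$. Thus the origin is a saddle with hyperbolic ratio $\alpha(\lambda)>0$ and separatrices $\{x=0\}$ and $\{y=0\}$. Cross-sections: for sufficiently small real $c_1,c_2>0$, $\sigma\subset\{y=c_1\}$ and $\tau\subset\{x=c_2\}$ are open complex discs centered at $(0,c_1)$ and $(c_2,0)$, parameterized by $x$ and $y$ respectively. Dulac map: for $x\in\sigma$, $x>0$ small, $\mathcal{D}_\lambda(x)\in\tau\cap\mathbb{R}^+$ is the intersection point with $\tau$ of the real orbit (leaf) of $\mathcal{F}_\lambda$ through $x$ contained in the first quadrant; $\mathcal{D}_\lambda(0)=0$. Universal covering: $\pi:\mathbb{C}_\bullet\to\mathbb{C}\setminus\{0\}$ is the universal covering, with polar coordinates $(\rho,\varphi)$, $\rho>0$, $\varphi\in\mathbb{R}$, $\pi(\rho,\varphi)=\rho e^{i\varphi}$; $\sigma_\bullet\subset\mathbb{C}_\bullet$ is the universal covering of $\sigma\setminus\{0\}$. It is known that there exist $\varepsilon_0>0$ and a continuous function $\rho:\mathbb{R}\to\mathbb{R}^+_*$ such that $\mathcal{D}_\lambda$ extends analytically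 from $\{\varphi=0\}$ to the domain $\{(\lambda,\rho,\varphi)\in\mathbb{C}^N\times\sigma_\bullet:\ |\lambda|<\varepsilon_0,\ 0<\rho<\rho(\varphi)\}$; this extension is still denoted $\mathcal{D}_\lambda$. Holonomy: $h_\sigma^\lambda:\sigma\to\sigma$ is the germ at $0$ of the holonomy map of the separatrix $\{x=0\}$ along a closed path contained in $\{x=0\}$, based at $(0,c_1)$, making one turn around the origin in the positive direction (with respect to the coordinate $y$). It is analytic in $x,\lambda$ and $h_\sigma^\lambda(x)=x\,e^{-2\pi i/\alpha(\lambda)}+\cdots$. For $k\in\mathbb{Z}$, $(h_\sigma^\lambda)^k$ denotes the $k$-th iterate (of the inverse if $k<0$). *)

theory Defs
  imports "HOL-Analysis.Analysis"
begin

text \<open>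
  Throughout, \<open>\<mu>\<close> is the parameter of the family of foliations
  \<open>x A(x,y,\<mu>) dy + \<alpha>(\<mu>) y B(x,y,\<mu>) dx = 0\<close>, with \<open>A = 1 + \<dots>\<close> and \<open>B = 1 + \<dots>\<close>.
\<close>

definition monomial :: "('a::comm_semiring_1)^'n \<Rightarrow> ('n::finite \<Rightarrow> nat) \<Rightarrow> 'a" where
  "monomial v \<nu> = (\<Prod>m\<in>UNIV. (v $ m) ^ \<nu> m)"

text \<open>
  A real analytic germ at the origin of \<open>\<real>\<^sup>2 \<times> \<real>\<^sup>N\<close> is a convergent power series with real
  coefficients in \<open>(x, y, \<mu>)\<close>. The same series is used for complex \<open>x\<close> and \<open>y\<close>, so that it also
  describes the complexified foliation, whose leaves define the holonomy.
\<close>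

definition real_analytic_germ :: "(complex \<Rightarrow> complex \<Rightarrow> real^'n::finite \<Rightarrow> complex) \<Rightarrow> bool" where
  "real_analytic_germ F \<longleftrightarrow>
     (\<exists>r>0. \<exists>a :: nat \<Rightarrow> nat \<Rightarrow> ('n \<Rightarrow> nat) \<Rightarrow> real.
        \<forall>x y \<mu>. norm x < r \<and> norm y < r \<and> norm \<mu> < r \<longrightarrow>
          ((\<lambda>(i, j, \<nu>). of_real (a i j \<nu>) * x ^ i * y ^ j * of_real (monomial \<mu> \<nu>))
             has_sum F x y \<mu>) UNIV)"

definition saddle_family ::
  "(real^'n::finite \<Rightarrow> real) \<Rightarrow> (complex \<Rightarrow> complex \<Rightarrow> real^'n \<Rightarrow> complex) \<Rightarrow>
   (complex \<Rightarrow> complex \<Rightarrow> real^'n \<Rightarrow> complex) \<Rightarrow> bool" where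
  "saddle_family \<alpha> A B \<longleftrightarrow>
     real_analytic_germ (\<lambda>x y \<mu>. of_real (\<alpha> \<mu>)) \<and> real_analytic_germ A \<and> real_analytic_germ B \<and>
     (\<forall>\<^sub>F \<mu> in nhds 0. A 0 0 \<mu> = 1 \<and> B 0 0 \<mu> = 1) \<and> \<alpha> 0 > 0"

text \<open>
  A path \<open>(X, Y)\<close>, parametrised by \<open>[0,1]\<close>, in a leaf of the foliation (at the parameter \<open>\<mu>\<close>)
  restricted to the bidisc of radius \<open>s\<close>.
\<close>

definition leaf_path ::
  "real \<Rightarrow> (real^'n::finite \<Rightarrow> real) \<Rightarrow> (complex \<Rightarrow> complex \<Rightarrow> real^'n \<Rightarrow> complex) \<Rightarrow>
   (complex \<Rightarrow> complex \<Rightarrow> real^'n \<Rightarrow> complex) \<Rightarrow> real^'n \<Rightarrow>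
   (real \<Rightarrow> complex) \<Rightarrow> (real \<Rightarrow> complex) \<Rightarrow> bool" where
  "leaf_path s \<alpha> A B \<mu> X Y \<longleftrightarrow>
     (\<forall>t\<in>{0..1}. norm (X t) < s \<and> norm (Y t) < s \<and>
        (\<exists>X' Y'. (X has_vector_derivative X') (at t within {0..1}) \<and>
                 (Y has_vector_derivative Y') (at t within {0..1}) \<and>
                 X t * A (X t) (Y t) \<mu> * Y' + of_real (\<alpha> \<mu>) * Y t * B (X t) (Y t) \<mu> * X' = 0))"

text \<open>
  The real Dulac map as a relation: the real leaf through \<open>(x, c\<^sub>1)\<close>, inside the open first
  quadrant, meets \<open>{x = c\<^sub>2}\<close> in the point \<open>(c\<^sub>2, y)\<close>.
  For small \<open>s\<close> such leaves are graphs of decreasing functions, so \<open>y\<close> is unique.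
\<close>

definition dulac_rel ::
  "real \<Rightarrow> (real^'n::finite \<Rightarrow> real) \<Rightarrow> (complex \<Rightarrow> complex \<Rightarrow> real^'n \<Rightarrow> complex) \<Rightarrow>
   (complex \<Rightarrow> complex \<Rightarrow> real^'n \<Rightarrow> complex) \<Rightarrow> real \<Rightarrow> real \<Rightarrow> real^'n \<Rightarrow>
   real \<Rightarrow> real \<Rightarrow> bool" where
  "dulac_rel s \<alpha> A B c1 c2 \<mu> x y \<longleftrightarrow>
     (\<exists>u v. leaf_path s \<alpha> A B \<mu> (\<lambda>t. of_real (u t)) (\<lambda>t. of_real (v t)) \<and>
            (\<forall>t\<in>{0..1}. 0 < u t \<and> 0 < v t) \<and>
            u 0 = x \<and> v 0 = c1 \<and> u 1 = c2 \<and> v 1 = y)"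

text \<open>
  Graph of the holonomy map of the separatrix \<open>{x = 0}\<close> on the cross-section \<open>{y = c\<^sub>1}\<close>: lift the
  positively oriented circle of radius \<open>c\<^sub>1\<close> in the \<open>y\<close>-axis to the leaves. As a relation it is
  single-valued and injective for small \<open>s\<close>, and relational powers and converse are composition
  and inversion of the germ.
\<close>

definition holonomy ::
  "real \<Rightarrow> (real^'n::finite \<Rightarrow> real) \<Rightarrow> (complex \<Rightarrow> complex \<Rightarrow> real^'n \<Rightarrow> complex) \<Rightarrow>
   (complex \<Rightarrow> complex \<Rightarrow> real^'n \<Rightarrow> complex) \<Rightarrow> real \<Rightarrow> real^'n \<Rightarrow> (complex \<times> complex) set" where
  "holonomy s \<alpha> A B c1 \<mu> =
     {(X 0, X 1) | X. leaf_path s \<alpha> A B \<mu> X (\<lambda>t. of_real c1 * cis (2 * pi * t))}"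

definition int_relpow :: "('a \<times> 'a) set \<Rightarrow> int \<Rightarrow> ('a \<times> 'a) set" where
  "int_relpow R k = (if k \<ge> 0 then R ^^ nat k else (R\<inverse>) ^^ nat (- k))"

definition curve_C ::
  "real \<Rightarrow> (real^'n::finite \<Rightarrow> real) \<Rightarrow> (complex \<Rightarrow> complex \<Rightarrow> real^'n \<Rightarrow> complex) \<Rightarrow>
   (complex \<Rightarrow> complex \<Rightarrow> real^'n \<Rightarrow> complex) \<Rightarrow> real \<Rightarrow> real^'n \<Rightarrow> int \<Rightarrow> complex set" where
  "curve_C s \<alpha> A B c1 \<mu> k = {z. (z, cnj z) \<in> int_relpow (holonomy s \<alpha> A B c1 \<mu>) k}"

text \<open>
  Points of the universal covering of the punctured plane are pairs \<open>(\<rho>, \<phi>)\<close> with \<open>\<rho> > 0\<close>.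
  The global holomorphic coordinate on it is \<open>\<zeta> = ln \<rho> + \<i>\<phi>\<close>.
\<close>

definition cover_proj :: "real \<times> real \<Rightarrow> complex" where
  "cover_proj z = rcis (fst z) (snd z)"

definition cover_point :: "complex \<Rightarrow> real \<times> real" where
  "cover_point \<zeta> = (exp (Re \<zeta>), Im \<zeta>)"

definition cover_domain :: "(real \<Rightarrow> real) \<Rightarrow> (real \<times> real) set" where
  "cover_domain \<rho> = {z. 0 < fst z \<and> fst z < \<rho> (snd z)}"

definition complex_vec :: "real^'n::finite \<Rightarrow> complex^'n" where
  "complex_vec \<mu> = (\<chi> m. of_real (\<mu> $ m))"

definition analytic_on_cover ::
  "real \<Rightarrow> (real \<Rightarrow> real) \<Rightarrow> (complex^'n::finite \<Rightarrow> real \<times> real \<Rightarrow> complex) \<Rightarrow> bool" where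
  "analytic_on_cover \<epsilon> \<rho> D \<longleftrightarrow>
     (\<forall>\<mu>0 \<zeta>0. norm \<mu>0 < \<epsilon> \<and> cover_point \<zeta>0 \<in> cover_domain \<rho> \<longrightarrow>
        (\<exists>e>0. \<exists>a :: nat \<Rightarrow> ('n \<Rightarrow> nat) \<Rightarrow> complex.
           \<forall>\<mu> \<zeta>. norm (\<mu> - \<mu>0) < e \<and> norm (\<zeta> - \<zeta>0) < e \<longrightarrow>
             ((\<lambda>(i, \<nu>). a i \<nu> * (\<zeta> - \<zeta>0) ^ i * monomial (\<mu> - \<mu>0) \<nu>)
                has_sum D \<mu> (cover_point \<zeta>)) UNIV))"

text \<open>
  \<open>D\<close> is the analytic continuation of the Dulac map to \<open>{|\<mu>| < \<epsilon>, 0 < \<rho> < \<rho>(\<phi>)}\<close>. That domain is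
  connected, so \<open>D\<close> is determined there by its values at real \<open>\<mu>\<close> and \<open>\<phi> = 0\<close>. The bound
  \<open>\<rho> \<phi> \<le> s\<close> keeps the points over the cross-section inside the bidisc.
\<close>

definition dulac_extension ::
  "real \<Rightarrow> (real^'n::finite \<Rightarrow> real) \<Rightarrow> (complex \<Rightarrow> complex \<Rightarrow> real^'n \<Rightarrow> complex) \<Rightarrow>
   (complex \<Rightarrow> complex \<Rightarrow> real^'n \<Rightarrow> complex) \<Rightarrow> real \<Rightarrow> real \<Rightarrow> real \<Rightarrow> (real \<Rightarrow> real) \<Rightarrow>
   (complex^'n \<Rightarrow> real \<times> real \<Rightarrow> complex) \<Rightarrow> bool" where
  "dulac_extension s \<alpha> A B c1 c2 \<epsilon> \<rho> D \<longleftrightarrow>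
     0 < \<epsilon> \<and> continuous_on UNIV \<rho> \<and> (\<forall>\<phi>. 0 < \<rho> \<phi> \<and> \<rho> \<phi> \<le> s) \<and>
     analytic_on_cover \<epsilon> \<rho> D \<and>
     (\<forall>\<mu> x. norm \<mu> < \<epsilon> \<and> 0 < x \<and> x < \<rho> 0 \<longrightarrow>
        (\<exists>y. dulac_rel s \<alpha> A B c1 c2 \<mu> x y \<and> D (complex_vec \<mu>) (x, 0) = of_real y))"

definition zero_locus ::
  "(real \<Rightarrow> real) \<Rightarrow> (complex^'n::finite \<Rightarrow> real \<times> real \<Rightarrow> complex) \<Rightarrow> real^'n \<Rightarrow>
   (real \<times> real) set" where
  "zero_locus \<rho> D \<mu> = {z \<in> cover_domain \<rho>. Im (D (complex_vec \<mu>) z) = 0}"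

text \<open>
  \<open>\<Gamma>\<close> is an embedded real analytic arc through \<open>0\<close>, smooth at \<open>0\<close> and tangent there to the line
  \<open>{s e\<^sup>i\<^sup>\<theta> | s \<in> \<real>}\<close>. Real analytic maps from an interval around \<open>0\<close> to \<open>\<real>\<^sup>2 = \<complex>\<close> are, after
  shrinking the interval, the restrictions of holomorphic functions on a disc.
\<close>

definition smooth_analytic_arc :: "complex set \<Rightarrow> real \<Rightarrow> bool" where
  "smooth_analytic_arc \<Gamma> \<theta> \<longleftrightarrow>
     (\<exists>\<delta>>0. \<exists>g f. g holomorphic_on ball 0 \<delta> \<and> g 0 = 0 \<and>
        homeomorphism {-\<delta><..<\<delta>} \<Gamma> (\<lambda>t. g (of_real t)) f \<and>
        (\<exists>s::real. s \<noteq> 0 \<and> deriv g 0 = of_real s * cis \<theta>))"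

definition tangent_to_half_line :: "complex set \<Rightarrow> real \<Rightarrow> bool" where
  "tangent_to_half_line K \<theta> \<longleftrightarrow> 0 \<in> closure K \<and> 0 \<notin> K \<and> (sgn \<longlongrightarrow> cis \<theta>) (at 0 within K)"

end

theory Submission
  imports Defs "HOL-Complex_Analysis.Complex_Analysis"
begin

text \<open>
  In logarithmic coordinates \<open>x = e\<^sup>w\<close>, \<open>y = e\<^sup>v\<close> the foliation becomes \<open>dv = - G(e\<^sup>w, e\<^sup>v, \<mu>) dw\<close>
  with \<open>G = \<alpha> B / A\<close>. On a small enough polydisc \<open>G\<close> is uniformly close to \<open>\<alpha>0 = \<alpha> 0\<close>, so that every
  leaf is close to an affine one, \<open>v + \<alpha>0 w = const\<close>, and everything below is a perturbation
  argument whose constants depend neither on \<open>\<mu>\<close> nor on \<open>k\<close>.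

  Integrate the equation from \<open>(\<zeta>, v0)\<close> along the straight segment from \<open>\<zeta>\<close> to \<open>ln c2\<close>. If
  \<open>\<bar>Im \<zeta>\<bar> < ln c2 - Re \<zeta>\<close>, then \<open>Re v\<close> decreases along the way, so the solution stays in the
  polydisc. Its final value \<open>E \<zeta> v0 \<mu>\<close> is holomorphic in all variables and is a first integral of the
  foliation. With \<open>L \<zeta> = E \<zeta> (ln c1) \<mu>\<close> the Dulac map is \<open>D = exp \<circ> L\<close>, and therefore
  \<open>Im D = 0\<close> splits into the level sets \<open>Im L = k \<pi>\<close>. These are the pieces \<open>H k\<close>.

  The holonomy \<open>h\<close> enters through the constancy of \<open>E\<close> on leaves. If \<open>h(e\<^sup>\<zeta>) = exp(\<zeta> + expo(e\<^sup>\<zeta>))\<close> is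
  its lift to the covering, one turn around the origin in the \<open>y\<close>-axis yields
  \<open>L(\<zeta> + expo(e\<^sup>\<zeta>)) = L \<zeta> - 2\<pi>\<i>\<close>. After \<open>k\<close> turns the left side is \<open>L\<close> at the \<open>k\<close>-th lifted iterate
  \<open>\<zeta>\<^sub>k\<close> of \<open>\<zeta>\<close>, and the equation \<open>Im (L \<zeta>) = k \<pi>\<close> says that the right side is \<open>cnj (L \<zeta>)\<close>. As the
  family is real, \<open>cnj (L \<zeta>) = L (cnj \<zeta>)\<close>. Finally \<open>L\<close> is injective, being nearly affine.
  Hence \<open>Im (L \<zeta>) = k \<pi>\<close> if and only if \<open>\<zeta>\<^sub>k = cnj \<zeta>\<close>, which under \<open>z = e\<^sup>\<zeta>\<close> projects to the equation
  \<open>h\<^sup>k z = cnj z\<close> of the curve \<open>C\<^sub>k\<close>. For negative \<open>k\<close> one conjugates.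

  Conversely, reality of the family gives \<open>cnj \<circ> h \<circ> cnj = h\<inverse>\<close>, so \<open>cnj \<circ> h\<^sup>k\<close> is an antiholomorphic
  involution and \<open>C\<^sub>k\<close> is its set of fixed points. Put \<open>\<omega> = e\<^sup>i\<^sup>\<theta>\<close> with \<open>\<theta> = k \<pi> / \<alpha> \<mu>\<close>. The average
  \<open>\<Psi> z = (z / \<omega> + \<omega> h\<^sup>k z) / 2\<close> conjugates this involution to complex conjugation, so \<open>C\<^sub>k\<close> is the
  preimage of the real axis under the local diffeomorphism \<open>\<Psi>\<close>: a smooth analytic arc tangent to
  \<open>\<omega>\<close>. The half of the arc on the side of \<open>\<omega>\<close> lifts to the sheet \<open>Im \<zeta> \<approx> \<theta>\<close>, and there it is the
  level set \<open>Im L = k \<pi>\<close>.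

  All of this takes place in the region \<open>\<Omega> = {\<zeta>. Re \<zeta> + K \<bar>Im \<zeta>\<bar> < ln c2 - M}\<close>, that is,
  \<open>\<rho>(\<phi>) = c2 exp (- M - K \<bar>\<phi>\<bar>)\<close>. The level \<open>k\<close> occurs at \<open>\<bar>Im \<zeta>\<bar>\<close> of size \<open>\<bar>k\<bar> \<pi> / \<alpha>\<close>, where \<open>\<Omega>\<close> only
  contains points with \<open>\<bar>e\<^sup>\<zeta>\<bar>\<close> exponentially small in \<open>\<bar>k\<bar>\<close>. This is what the \<open>\<bar>k\<bar>\<close>-th iterate of the
  holonomy needs in order to be defined and close to its linear part.

  The lemmas that carry the argument are \<open>E_constant_on_leaf\<close>, \<open>E_nearly_affine\<close>, \<open>L_lift\<close>,
  \<open>dulac_level_of_nat_iff\<close>, \<open>C_iff\<close> and \<open>arc\<close>. The analytic dependence on parameters rests on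
  \<open>picard_holomorphic\<close> and \<open>separately_holomorphic_power_series\<close>.
\<close>

section \<open>Holomorphic dependence on parameters\<close>

lemma norm_deriv_le_of_bounded:
  assumes f: "f holomorphic_on ball a R" and R: "0 < R"
    and M: "\<And>z. z \<in> ball a R \<Longrightarrow> norm (f z) \<le> M"
  shows "norm (deriv f a) \<le> 2 * M / R"
proof -
  have sub: "cball a (R/2) \<subseteq> ball a R" using R by auto
  have "norm ((deriv ^^ 1) f a) \<le> fact 1 * M / (R/2) ^ 1"
  proof (rule Cauchy_inequality)
    show "f holomorphic_on ball a (R/2)"
      using f by (rule holomorphic_on_subset) (use R in auto)
    show "continuous_on (cball a (R/2)) f"
      using f sub holomorphic_on_imp_continuous_on holomorphic_on_subset by blast
    show "norm (f x) \<le> M" if "norm (a - x) = R/2" for x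
      using that R by (intro M) (auto simp: dist_norm)
  qed (use R in auto)
  then show ?thesis by (simp add: field_simps)
qed

lemma holomorphic_bounded_imp_lipschitz:
  assumes f: "f holomorphic_on ball z0 R" and R: "0 < R"
    and M: "\<And>z. z \<in> ball z0 R \<Longrightarrow> norm (f z) \<le> M"
    and a: "a \<in> ball z0 (R/2)" and b: "b \<in> ball z0 (R/2)"
  shows "norm (f a - f b) \<le> 4 * M / R * norm (a - b)"
proof (rule field_differentiable_bound[of "ball z0 (R/2)" f "deriv f"])
  fix z assume z: "z \<in> ball z0 (R/2)"
  then have "z \<in> ball z0 R" using R by auto
  then show "(f has_field_derivative deriv f z) (at z within ball z0 (R/2))"
    using f holomorphic_derivI[OF f] has_field_derivative_at_within open_ball by blast
  have sub: "ball z (R/2) \<subseteq> ball z0 R"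
  proof
    fix w assume "w \<in> ball z (R/2)"
    then show "w \<in> ball z0 R" using z dist_triangle[of z0 w z] by (simp add: dist_commute)
  qed
  have "norm (deriv f z) \<le> 2 * M / (R/2)"
    by (rule norm_deriv_le_of_bounded) (use f sub M R in \<open>auto intro: holomorphic_on_subset\<close>)
  then show "norm (deriv f z) \<le> 4 * M / R" by simp
qed (use a b in auto)

text \<open>
  Joint continuity from separate continuity. Equicontinuity in one variable is what Cauchy's
  estimates provide for functions that are holomorphic and bounded in that variable.
\<close>

lemma continuous_on_Times_equicontinuous:
  fixes f :: "'a::metric_space \<Rightarrow> 'b::metric_space \<Rightarrow> 'c::metric_space"
  assumes c: "\<And>t. t \<in> T \<Longrightarrow> continuous_on U (\<lambda>z. f z t)"
    and e: "\<And>e. 0 < e \<Longrightarrow> \<exists>d>0. \<forall>z\<in>U. \<forall>t\<in>T. \<forall>t'\<in>T. dist t t' < d \<longrightarrow> dist (f z t) (f z t') < e"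
  shows "continuous_on (U \<times> T) (\<lambda>(z, t). f z t)"
  unfolding continuous_on_iff
proof (intro ballI allI impI)
  fix p :: "'a \<times> 'b" and e :: real assume p: "p \<in> U \<times> T" and "0 < e"
  obtain z t where zt: "p = (z, t)" "z \<in> U" "t \<in> T" using p by auto
  obtain d where d: "d > 0" "\<And>z t t'. z \<in> U \<Longrightarrow> t \<in> T \<Longrightarrow> t' \<in> T \<Longrightarrow> dist t t' < d \<Longrightarrow> dist (f z t) (f z t') < e/2"
    using e[of "e/2"] \<open>0 < e\<close> by auto
  obtain d' where d': "d' > 0" "\<And>z'. z' \<in> U \<Longrightarrow> dist z' z < d' \<Longrightarrow> dist (f z' t) (f z t) < e/2"
    using c[OF zt(3)] zt(2) \<open>0 < e\<close> unfolding continuous_on_iff by (meson half_gt_zero)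
  show "\<exists>d>0. \<forall>x'\<in>U \<times> T. dist x' p < d \<longrightarrow> dist (case x' of (z, t) \<Rightarrow> f z t) (case p of (z, t) \<Rightarrow> f z t) < e"
  proof (intro exI[of _ "min d d'"] conjI ballI impI)
    fix q assume q: "q \<in> U \<times> T" "dist q p < min d d'"
    obtain z' t' where q': "q = (z', t')" "z' \<in> U" "t' \<in> T" using q by auto
    have "dist z' z < d'" "dist t' t < d"
      using q(2) dist_fst_le[of q p] dist_snd_le[of q p] by (auto simp: q' zt)
    then have "dist (f z' t') (f z' t) < e/2" "dist (f z' t) (f z t) < e/2"
      using d d' q' zt by auto
    then show "dist (case q of (z, t) \<Rightarrow> f z t) (case p of (z, t) \<Rightarrow> f z t) < e"
      using dist_triangle_half_r[of "f z' t" "f z' t'" e "f z t"] by (auto simp: q' zt dist_commute)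
  qed (use d d' in auto)
qed

lemma continuous_on_Times_lipschitz:
  fixes f :: "'a::metric_space \<Rightarrow> 'b::metric_space \<Rightarrow> 'c::real_normed_vector"
  assumes c: "\<And>t. t \<in> T \<Longrightarrow> continuous_on U (\<lambda>z. f z t)"
    and B: "\<And>z t t'. z \<in> U \<Longrightarrow> t \<in> T \<Longrightarrow> t' \<in> T \<Longrightarrow> norm (f z t - f z t') \<le> B * dist t t'"
  shows "continuous_on (U \<times> T) (\<lambda>(z, t). f z t)"
proof (rule continuous_on_Times_equicontinuous[OF c])
  fix e :: real assume "0 < e"
  show "\<exists>d>0. \<forall>z\<in>U. \<forall>t\<in>T. \<forall>t'\<in>T. dist t t' < d \<longrightarrow> dist (f z t) (f z t') < e"
  proof (intro exI[of _ "e / (\<bar>B\<bar> + 1)"] conjI ballI impI)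
    fix z t t' assume h: "z \<in> U" "t \<in> T" "t' \<in> T" "dist t t' < e / (\<bar>B\<bar> + 1)"
    have "norm (f z t - f z t') \<le> B * dist t t'" using B h by auto
    also have "\<dots> \<le> (\<bar>B\<bar> + 1) * dist t t'" by (intro mult_right_mono) auto
    also have "\<dots> < e" using h(4) by (simp add: field_simps)
    finally show "dist (f z t) (f z t') < e" by (simp add: dist_norm)
  qed (use \<open>0 < e\<close> in auto)
qed

text \<open>
  Differentiation under the integral sign needs the derivative to be jointly continuous. Here
  this follows from the joint continuity of \<open>f\<close> alone: Cauchy's estimate turns the modulus of continuity
  in \<open>t\<close> of \<open>f\<close> into one of its derivative, uniformly in \<open>z\<close>.
\<close>

lemma holomorphic_on_integral:
  fixes f :: "complex \<Rightarrow> real \<Rightarrow> complex"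
  assumes U: "open U"
    and cont: "continuous_on (U \<times> {a..b}) (\<lambda>(z, t). f z t)"
    and hol: "\<And>t. t \<in> {a..b} \<Longrightarrow> (\<lambda>z. f z t) holomorphic_on U"
  shows "(\<lambda>z. integral {a..b} (f z)) holomorphic_on U"
proof -
  have "(\<lambda>z. integral {a..b} (f z)) field_differentiable (at z0)" if z0: "z0 \<in> U" for z0
  proof -
    obtain R where R: "R > 0" "cball z0 R \<subseteq> U" using U z0 open_contains_cball by blast
    define V where "V = ball z0 (R/2)"
    define fx where "fx = (\<lambda>z t. deriv (\<lambda>z. f z t) z)"
    have VR: "V \<subseteq> ball z0 R" "V \<subseteq> U" "ball z0 R \<subseteq> U" using R by (auto simp: V_def)
    have "uniformly_continuous_on (cball z0 R \<times> {a..b}) (\<lambda>(z, t). f z t)"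
      by (intro compact_uniformly_continuous compact_Times continuous_on_subset[OF cont]) (use R in auto)
    then have uc: "\<exists>d>0. \<forall>z\<in>cball z0 R. \<forall>t\<in>{a..b}. \<forall>t'\<in>{a..b}. dist t t' < d \<longrightarrow> dist (f z t) (f z t') < e"
      if "e > 0" for e
      using that unfolding uniformly_continuous_on_def
      by (elim allE[of _ e]) (fastforce simp: dist_Pair_Pair)
    have cfx: "continuous_on (V \<times> {a..b}) (\<lambda>(z, t). fx z t)"
    proof (rule continuous_on_Times_equicontinuous)
      fix t assume "t \<in> {a..b}"
      then show "continuous_on V (\<lambda>z. fx z t)" unfolding fx_def
        by (intro holomorphic_on_imp_continuous_on holomorphic_deriv holomorphic_on_subset[OF hol])
           (use VR in \<open>auto simp: V_def\<close>)
    next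
      fix e :: real assume e: "e > 0"
      obtain d where d: "d > 0" "\<And>z t t'. z \<in> cball z0 R \<Longrightarrow> t \<in> {a..b} \<Longrightarrow> t' \<in> {a..b} \<Longrightarrow> dist t t' < d \<Longrightarrow> dist (f z t) (f z t') < e * R / 8"
        using uc[of "e * R / 8"] e R by auto
      have "dist (fx z t) (fx z t') < e" if h: "z \<in> V" "t \<in> {a..b}" "t' \<in> {a..b}" "dist t t' < d" for z t t'
      proof -
        have sub: "ball z (R/2) \<subseteq> ball z0 R"
        proof
          fix w assume "w \<in> ball z (R/2)"
          then show "w \<in> ball z0 R" using h(1) dist_triangle[of z0 w z] by (simp add: dist_commute V_def)
        qed
        have hz: "(\<lambda>w. f w t) holomorphic_on ball z (R/2)" "(\<lambda>w. f w t') holomorphic_on ball z (R/2)"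
          using hol h sub VR by (meson holomorphic_on_subset order_trans)+
        have "norm (deriv (\<lambda>w. f w t - f w t') z) \<le> 2 * (e * R / 8) / (R/2)"
        proof (rule norm_deriv_le_of_bounded)
          show "(\<lambda>w. f w t - f w t') holomorphic_on ball z (R/2)" using hz by (intro holomorphic_intros)
          fix w assume "w \<in> ball z (R/2)"
          then show "norm (f w t - f w t') \<le> e * R / 8"
            using d(2)[of w t t'] h sub ball_subset_cball by (fastforce simp: dist_norm less_imp_le)
        qed (use R in auto)
        also have "deriv (\<lambda>w. f w t - f w t') z = fx z t - fx z t'" unfolding fx_def
          by (rule deriv_diff) (use hz R in \<open>auto intro: holomorphic_on_imp_differentiable_at\<close>)
        finally show ?thesis using e R by (simp add: dist_norm field_simps)
      qed
      then show "\<exists>d>0. \<forall>z\<in>V. \<forall>t\<in>{a..b}. \<forall>t'\<in>{a..b}. dist t t' < d \<longrightarrow> dist (fx z t) (fx z t') < e"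
        using d(1) by blast
    qed
    have "(\<lambda>z. integral (cbox a b) (f z)) holomorphic_on V"
    proof (rule leibniz_rule_holomorphic)
      fix z t assume h: "z \<in> V" "t \<in> cbox a b"
      then show "((\<lambda>z. f z t) has_field_derivative fx z t) (at z within V)" unfolding fx_def
        using hol[of t] holomorphic_derivI[OF _ U, of "\<lambda>z. f z t" z] VR has_field_derivative_at_within by auto
    next
      fix z assume "z \<in> V"
      then have z: "z \<in> U" using VR by auto
      have "continuous_on {a..b} (\<lambda>t. (\<lambda>(z, t). f z t) (z, t))"
        by (rule continuous_on_compose2[OF cont]) (use z in \<open>auto intro!: continuous_intros\<close>)
      then show "f z integrable_on cbox a b" by (simp add: integrable_continuous_real)
    qed (use cfx in \<open>auto simp: V_def\<close>)
    then show ?thesis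
      using holomorphic_on_imp_differentiable_at[of _ V z0] R by (auto simp: V_def)
  qed
  then show ?thesis
    by (auto simp: holomorphic_on_def intro: field_differentiable_at_within)
qed

text \<open>
  Gronwall's argument: if \<open>d\<close> is the difference of two solutions, \<open>e\<^sup>-\<^sup>2\<^sup>K\<^sup>t \<bar>d\<bar>\<^sup>2\<close> is nonincreasing, nonnegative
  and zero at \<open>0\<close>.
\<close>

lemma ode_unique:
  fixes u w :: "real \<Rightarrow> complex"
  assumes u: "\<And>t. t \<in> {0..1} \<Longrightarrow> (u has_vector_derivative u' t) (at t within {0..1})"
    and w: "\<And>t. t \<in> {0..1} \<Longrightarrow> (w has_vector_derivative w' t) (at t within {0..1})"
    and lip: "\<And>t. t \<in> {0..1} \<Longrightarrow> norm (u' t - w' t) \<le> K * norm (u t - w t)"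
    and init: "u 0 = w 0" and t: "t \<in> {0..1}"
  shows "u t = w t"
proof -
  define d where "d = (\<lambda>t. u t - w t)"
  define d' where "d' = (\<lambda>t. u' t - w' t)"
  have d: "(d has_vector_derivative d' t) (at t within {0..1})" if "t \<in> {0..1}" for t
    unfolding d_def d'_def using u w that by (auto intro: has_vector_derivative_diff)
  define \<phi> where "\<phi> = (\<lambda>t. exp (- 2 * K * t) * (d t \<bullet> d t))"
  define \<phi>' where "\<phi>' = (\<lambda>t. exp (- 2 * K * t) * (2 * (d t \<bullet> d' t) - 2 * K * (d t \<bullet> d t)))"
  have "(\<phi> has_real_derivative \<phi>' t) (at t within {0..1})" if "t \<in> {0..1}" for t
  proof -
    have "((\<lambda>t. d t \<bullet> d t) has_vector_derivative (d t \<bullet> d' t + d' t \<bullet> d t)) (at t within {0..1})"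
      by (rule bounded_bilinear.has_vector_derivative[OF bounded_bilinear_inner d d]) (use that in auto)
    then have "((\<lambda>t. d t \<bullet> d t) has_real_derivative 2 * (d t \<bullet> d' t)) (at t within {0..1})"
      by (simp add: has_real_derivative_iff_has_vector_derivative inner_commute)
    then show ?thesis unfolding \<phi>_def \<phi>'_def
      by (auto intro!: derivative_eq_intros simp: algebra_simps)
  qed
  note der = this
  have le0: "\<phi>' t \<le> 0" if "t \<in> {0..1}" for t
  proof -
    have "d t \<bullet> d' t \<le> norm (d t) * norm (d' t)" by (rule norm_cauchy_schwarz)
    also have "\<dots> \<le> norm (d t) * (K * norm (d t))"
      using lip[OF that] by (intro mult_left_mono) (auto simp: d_def d'_def)
    also have "\<dots> = K * (d t \<bullet> d t)" by (simp add: dot_square_norm power2_eq_square)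
    finally show ?thesis unfolding \<phi>'_def by (intro mult_nonneg_nonpos) auto
  qed
  have "\<phi> t \<le> \<phi> 0"
  proof (rule DERIV_nonpos_imp_decreasing_open[of 0 t \<phi>])
    show "continuous_on {0..t} \<phi>"
    proof (rule continuous_on_subset)
      show "continuous_on {0..1} \<phi>" by (rule DERIV_continuous_on[OF der])
    qed (use t in auto)
    fix x assume "0 < x" "x < t"
    then have x: "x \<in> {0<..<1}" using t by auto
    then have "(\<phi> has_real_derivative \<phi>' x) (at x)"
      using der[of x] at_within_interior[of x "{0..1}"] by (simp add: interior_atLeastAtMost_real)
    then show "\<exists>y. (\<phi> has_real_derivative y) (at x) \<and> y \<le> 0" using le0[of x] x by auto
  qed (use t in auto)
  also have "\<phi> 0 = 0" using init by (simp add: \<phi>_def d_def)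
  finally have "d t \<bullet> d t \<le> 0" unfolding \<phi>_def by (simp add: mult_le_0_iff)
  then show ?thesis by (simp add: d_def inner_commute dot_square_norm)
qed

text \<open>
  Solutions of a holomorphic differential equation in real time that depend holomorphically on a
  parameter \<open>z\<close>, existing over all of \<open>[0,1]\<close>. The sets \<open>S z t\<close> confine the solution: they replace a
  smallness condition on the time interval, because \<open>inv\<close> makes every Picard iterate stay in them.
  The Lipschitz constant may be large, but in the norm with weight \<open>e\<^sup>2\<^sup>k\<^sup>t\<close> the Picard operator is a
  contraction with factor \<open>1/2\<close>. The iterates are holomorphic in \<open>z\<close> and converge uniformly, so the
  limit is holomorphic too.
\<close>

lemma picard_holomorphic:
  fixes F :: "complex \<Rightarrow> real \<Rightarrow> complex \<Rightarrow> complex" and a :: "complex \<Rightarrow> complex"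
    and S :: "complex \<Rightarrow> real \<Rightarrow> complex set" and B K :: real
  assumes U: "open U"
    and a: "a holomorphic_on U" "\<And>z t. z \<in> U \<Longrightarrow> t \<in> {0..1} \<Longrightarrow> a z \<in> S z t"
    and S: "\<And>z t. z \<in> U \<Longrightarrow> t \<in> {0..1} \<Longrightarrow> closed (S z t)"
    and B: "\<And>z t v. z \<in> U \<Longrightarrow> t \<in> {0..1} \<Longrightarrow> v \<in> S z t \<Longrightarrow> norm (F z t v) \<le> B"
    and K: "\<And>z t v w. z \<in> U \<Longrightarrow> t \<in> {0..1} \<Longrightarrow> v \<in> S z t \<Longrightarrow> w \<in> S z t \<Longrightarrow>
              norm (F z t v - F z t w) \<le> K * norm (v - w)"
    and cont: "continuous_on {(z, t, v). z \<in> U \<and> t \<in> {0..1} \<and> v \<in> S z t} (\<lambda>(z, t, v). F z t v)"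
    and hol: "\<And>t u. t \<in> {0..1} \<Longrightarrow> u holomorphic_on U \<Longrightarrow> (\<And>z. z \<in> U \<Longrightarrow> u z \<in> S z t) \<Longrightarrow>
                (\<lambda>z. F z t (u z)) holomorphic_on U"
    and inv: "\<And>z u t. z \<in> U \<Longrightarrow> continuous_on {0..1} u \<Longrightarrow> (\<And>t. t \<in> {0..1} \<Longrightarrow> u t \<in> S z t) \<Longrightarrow>
                t \<in> {0..1} \<Longrightarrow> a z + integral {0..t} (\<lambda>\<tau>. F z \<tau> (u \<tau>)) \<in> S z t"
  obtains u where
    "continuous_on (U \<times> {0..1}) (\<lambda>(z, t). u z t)"
    "\<And>t. t \<in> {0..1} \<Longrightarrow> (\<lambda>z. u z t) holomorphic_on U"
    "\<And>z t. z \<in> U \<Longrightarrow> t \<in> {0..1} \<Longrightarrow> u z t \<in> S z t"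
    "\<And>z. z \<in> U \<Longrightarrow> u z 0 = a z"
    "\<And>z t. z \<in> U \<Longrightarrow> t \<in> {0..1} \<Longrightarrow> u z t = a z + integral {0..t} (\<lambda>\<tau>. F z \<tau> (u z \<tau>))"
    "\<And>z t. z \<in> U \<Longrightarrow> t \<in> {0..1} \<Longrightarrow> (u z has_vector_derivative F z t (u z t)) (at t within {0..1})"
proof -
  define T where "T = (\<lambda>u z t. a z + integral {0..t} (\<lambda>\<tau>. F z \<tau> (u z \<tau>)))"
  define C where "C = {u. continuous_on (U \<times> {0..1}) (\<lambda>(z, t). u z t) \<and>
     (\<forall>t\<in>{0..1::real}. (\<lambda>z. u z t) holomorphic_on U) \<and> (\<forall>z\<in>U. \<forall>t\<in>{0..1}. u z t \<in> S z t)}"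
  have Fc: "continuous_on (U \<times> {0..1}) (\<lambda>(z, t). F z t (u z t))"
    if "continuous_on (U \<times> {0..1}) (\<lambda>(z, t). u z t)" "\<forall>z\<in>U. \<forall>t\<in>{0..1}. u z t \<in> S z t" for u
  proof -
    have "continuous_on (U \<times> {0..1}) (\<lambda>p. (\<lambda>(z, t, v). F z t v) (fst p, snd p, u (fst p) (snd p)))"
      by (rule continuous_on_compose2[OF cont])
         (use that in \<open>auto intro!: continuous_intros simp: split_def\<close>)
    then show ?thesis by (simp add: split_def)
  qed
  have slice: "continuous_on {0..1} (\<lambda>t. f z t)"
    if "continuous_on (U \<times> {0..1}) (\<lambda>(z, t). f z t)" "z \<in> U" for f :: "complex \<Rightarrow> real \<Rightarrow> complex" and z
  proof -
    have "continuous_on {0..1} (\<lambda>t. (\<lambda>(z, t). f z t) (z, t))"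
      by (rule continuous_on_compose2[OF that(1)]) (use that in \<open>auto intro!: continuous_intros\<close>)
    then show ?thesis by simp
  qed
  have int: "(\<lambda>\<tau>. F z \<tau> (u z \<tau>)) integrable_on {c..d}"
    if "u \<in> C" "z \<in> U" "0 \<le> c" "d \<le> 1" for u z c d
  proof -
    have "continuous_on {0..1} (\<lambda>\<tau>. F z \<tau> (u z \<tau>))"
      by (rule slice[of "\<lambda>z t. F z t (u z t)"]) (use Fc[of u] that in \<open>auto simp: C_def\<close>)
    then show ?thesis
      by (intro integrable_continuous_real) (rule continuous_on_subset, use that in auto)
  qed
  have TC: "T u \<in> C" if u: "u \<in> C" for u
  proof -
    have h: "(\<lambda>z. T u z t) holomorphic_on U" if t: "t \<in> {0..1}" for t
    proof -
      have "(\<lambda>z. integral {0..t} (\<lambda>\<tau>. F z \<tau> (u z \<tau>))) holomorphic_on U"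
      proof (rule holomorphic_on_integral[OF U])
        show "continuous_on (U \<times> {0..t}) (\<lambda>(z, \<tau>). F z \<tau> (u z \<tau>))"
          by (rule continuous_on_subset[OF Fc]) (use u t in \<open>auto simp: C_def\<close>)
        show "(\<lambda>z. F z \<tau> (u z \<tau>)) holomorphic_on U" if "\<tau> \<in> {0..t}" for \<tau>
          using u t that by (intro hol) (auto simp: C_def)
      qed
      then show ?thesis unfolding T_def using a(1) by (intro holomorphic_intros)
    qed
    moreover have "continuous_on (U \<times> {0..1}) (\<lambda>(z, t). T u z t)"
    proof (rule continuous_on_Times_lipschitz)
      show "continuous_on U (\<lambda>z. T u z t)" if "t \<in> {0..1}" for t
        using h[OF that] by (rule holomorphic_on_imp_continuous_on)
      have *: "norm (T u z t - T u z t') \<le> B * \<bar>t - t'\<bar>"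
        if h: "z \<in> U" "t \<in> {0..1}" "t' \<in> {0..1}" "t' \<le> t" for z t t'
      proof -
        have "integral {0..t'} (\<lambda>\<tau>. F z \<tau> (u z \<tau>)) + integral {t'..t} (\<lambda>\<tau>. F z \<tau> (u z \<tau>))
           = integral {0..t} (\<lambda>\<tau>. F z \<tau> (u z \<tau>))"
          by (rule Henstock_Kurzweil_Integration.integral_combine) (use h int[OF u] in auto)
        then have "T u z t - T u z t' = integral {t'..t} (\<lambda>\<tau>. F z \<tau> (u z \<tau>))"
          by (simp add: T_def algebra_simps)
        also have "norm \<dots> \<le> B * (t - t')"
        proof (rule integral_bound)
          show "continuous_on {t'..t} (\<lambda>\<tau>. F z \<tau> (u z \<tau>))"
            by (rule continuous_on_subset[OF slice[of "\<lambda>z t. F z t (u z t)" z]])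
               (use Fc[of u] u h in \<open>auto simp: C_def\<close>)
        qed (use h u B in \<open>auto simp: C_def\<close>)
        finally show ?thesis using h by simp
      qed
      show "norm (T u z t - T u z t') \<le> B * dist t t'" if "z \<in> U" "t \<in> {0..1}" "t' \<in> {0..1}" for z t t'
        unfolding dist_real_def using *[of z t t'] *[of z t' t] that by (cases "t' \<le> t") (auto simp: norm_minus_commute abs_minus_commute)
    qed
    moreover have "T u z t \<in> S z t" if "z \<in> U" "t \<in> {0..1}" for z t
      unfolding T_def by (rule inv) (use u that slice in \<open>auto simp: C_def\<close>)
    ultimately show ?thesis by (auto simp: C_def)
  qed
  define v where "v = (\<lambda>n. (T ^^ n) (\<lambda>z t. a z))"
  have "(\<lambda>z t. a z) \<in> C"
    unfolding C_def using a holomorphic_on_imp_continuous_on[OF a(1)]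
    by (auto simp: split_def intro!: continuous_on_compose2[of U a] continuous_intros)
  then have vC: "v n \<in> C" for n by (induction n) (auto simp: v_def TC)
  define k where "k = \<bar>K\<bar> + 1"
  have k: "k > 0" "K \<le> k" by (auto simp: k_def)
  have B0: "0 \<le> B" if "z \<in> U" for z
    using order_trans[OF norm_ge_zero B[of z 0 "a z"]] a(2)[of z 0] that by simp
  have contraction: "norm (T u z t - T w z t) \<le> M / 2 * exp (2 * k * t)"
    if uw: "u \<in> C" "w \<in> C" and z: "z \<in> U" and t: "t \<in> {0..1}" and M: "0 \<le> M"
      and le: "\<And>t. t \<in> {0..1} \<Longrightarrow> norm (u z t - w z t) \<le> M * exp (2 * k * t)" for u w z t M
  proof -
    have ex: "((\<lambda>\<tau>. k * (M * exp (2 * k * \<tau>))) has_integral (M/2 * exp (2 * k * t) - M/2 * exp (2 * k * 0))) {0..t}"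
      by (rule fundamental_theorem_of_calculus)
         (use t k in \<open>auto intro!: derivative_eq_intros simp: has_real_derivative_iff_has_vector_derivative[symmetric]\<close>)
    have "T u z t - T w z t = integral {0..t} (\<lambda>\<tau>. F z \<tau> (u z \<tau>) - F z \<tau> (w z \<tau>))"
      unfolding T_def using int[of u z 0 t] int[of w z 0 t] uw z t by (simp add: integral_diff)
    also have "norm \<dots> \<le> integral {0..t} (\<lambda>\<tau>. k * (M * exp (2 * k * \<tau>)))"
    proof (rule integral_norm_bound_integral)
      show "(\<lambda>\<tau>. F z \<tau> (u z \<tau>) - F z \<tau> (w z \<tau>)) integrable_on {0..t}"
        using int[of u z 0 t] int[of w z 0 t] uw z t by (simp add: integrable_diff)
      show "(\<lambda>\<tau>. k * (M * exp (2 * k * \<tau>))) integrable_on {0..t}" using ex by blast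
      fix \<tau> assume \<tau>: "\<tau> \<in> {0..t}"
      have "norm (F z \<tau> (u z \<tau>) - F z \<tau> (w z \<tau>)) \<le> K * norm (u z \<tau> - w z \<tau>)"
        using uw z t \<tau> by (intro K) (auto simp: C_def)
      also have "\<dots> \<le> k * norm (u z \<tau> - w z \<tau>)" using k by (intro mult_right_mono) auto
      also have "\<dots> \<le> k * (M * exp (2 * k * \<tau>))" using le[of \<tau>] \<tau> t k by (intro mult_left_mono) auto
      finally show "norm (F z \<tau> (u z \<tau>) - F z \<tau> (w z \<tau>)) \<le> k * (M * exp (2 * k * \<tau>))" .
    qed
    also have "\<dots> \<le> M/2 * exp (2 * k * t)" using ex M by (simp add: has_integral_iff)
    finally show ?thesis .
  qed
  have step: "norm (v (Suc n) z t - v n z t) \<le> B / 2^n * exp (2 * k * t)"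
    if z: "z \<in> U" and t: "t \<in> {0..1}" for n z t
    using t
  proof (induction n arbitrary: t)
    case 0
    have c: "continuous_on {0..t} (\<lambda>\<tau>. F z \<tau> (a z))"
      by (rule continuous_on_subset[OF slice[of "\<lambda>z t. F z t (v 0 z t)" z, unfolded v_def, simplified]])
         (use Fc[of "v 0"] vC[of 0] z 0 in \<open>auto simp: C_def v_def\<close>)
    have "norm (v 1 z t - v 0 z t) \<le> B * (t - 0)"
      unfolding v_def T_def by (simp, rule integral_bound[of 0 t _ B, simplified])
         (use 0 z B a c in auto)
    also have "\<dots> \<le> B * exp (2 * k * t)"
    proof -
      have "1 \<le> exp (2 * k * t)" using 0 k by simp
      moreover have "t \<le> 1" using 0 by simp
      ultimately have "t - 0 \<le> exp (2 * k * t)" by linarith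
      then show ?thesis using B0[OF z] by (rule mult_left_mono)
    qed
    finally show ?case by simp
  next
    case (Suc n)
    have "norm (T (v (Suc n)) z t - T (v n) z t) \<le> (B / 2^n) / 2 * exp (2 * k * t)"
      by (rule contraction[OF vC vC z Suc.prems]) (use Suc.IH B0[OF z] in auto)
    then show ?case by (simp add: v_def)
  qed
  define u where "u = (\<lambda>z t. a z + (\<Sum>n. v (Suc n) z t - v n z t))"
  have ul: "uniform_limit (U \<times> {0..1}) (\<lambda>n (z, t). v n z t) (\<lambda>(z, t). u z t) sequentially"
  proof -
    have "uniform_limit (U \<times> {0..1}) (\<lambda>n p. \<Sum>i<n. v (Suc i) (fst p) (snd p) - v i (fst p) (snd p))
            (\<lambda>p. suminf (\<lambda>i. v (Suc i) (fst p) (snd p) - v i (fst p) (snd p))) sequentially"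
    proof (rule Weierstrass_m_test)
      fix n and p :: "complex \<times> real" assume p: "p \<in> U \<times> {0..1}"
      have "norm (v (Suc n) (fst p) (snd p) - v n (fst p) (snd p)) \<le> B / 2^n * exp (2 * k * snd p)"
        using step p by auto
      also have "\<dots> \<le> B / 2^n * exp (2 * k * 1)"
        using p k B0[of "fst p"] by (intro mult_left_mono) auto
      finally show "norm (v (Suc n) (fst p) (snd p) - v n (fst p) (snd p)) \<le> B * exp (2 * k) * (1/2)^n"
        by (simp add: power_divide)
    qed (intro summable_mult summable_geometric, simp)
    then have "uniform_limit (U \<times> {0..1}) (\<lambda>n p. a (fst p) + (\<Sum>i<n. v (Suc i) (fst p) (snd p) - v i (fst p) (snd p)))
            (\<lambda>p. a (fst p) + suminf (\<lambda>i. v (Suc i) (fst p) (snd p) - v i (fst p) (snd p))) sequentially"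
      by (intro uniform_limit_intros)
    moreover have "(\<Sum>i<n. v (Suc i) z t - v i z t) = v n z t - a z" for n z t
      by (subst sum_lessThan_telescope) (simp add: v_def)
    ultimately show ?thesis by (simp add: u_def split_def)
  qed
  have lim: "(\<lambda>n. v n z t) \<longlonglongrightarrow> u z t" if "z \<in> U" "t \<in> {0..1}" for z t
    using tendsto_uniform_limitI[OF ul, of "(z, t)"] that by auto
  have cu: "continuous_on (U \<times> {0..1}) (\<lambda>(z, t). u z t)"
    by (rule uniform_limit_theorem[OF _ ul]) (use vC in \<open>auto simp: C_def\<close>)
  have hu: "(\<lambda>z. u z t) holomorphic_on U" if t: "t \<in> {0..1}" for t
  proof (rule holomorphic_uniform_sequence[OF U])
    show "(\<lambda>z. v n z t) holomorphic_on U" for n using vC[of n] t by (auto simp: C_def)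
    fix z assume "z \<in> U"
    then obtain d where d: "d > 0" "cball z d \<subseteq> U" using U open_contains_cball by blast
    have "uniform_limit (cball z d) (\<lambda>n z. v n z t) (\<lambda>z. u z t) sequentially"
      unfolding uniform_limit_iff
    proof (intro allI impI)
      fix e :: real assume "e > 0"
      then have "\<forall>\<^sub>F n in sequentially. \<forall>p\<in>U \<times> {0..1}. dist ((\<lambda>(z, t). v n z t) p) ((\<lambda>(z, t). u z t) p) < e"
        using ul unfolding uniform_limit_iff by blast
      then show "\<forall>\<^sub>F n in sequentially. \<forall>x\<in>cball z d. dist (v n x t) (u x t) < e"
        by eventually_elim (use d t in fastforce)
    qed
    then show "\<exists>d>0. cball z d \<subseteq> U \<and> uniform_limit (cball z d) (\<lambda>n z. v n z t) (\<lambda>z. u z t) sequentially"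
      using d by blast
  qed
  have uS: "u z t \<in> S z t" if "z \<in> U" "t \<in> {0..1}" for z t
    by (rule closed_sequentially[OF S[OF that] _ lim[OF that]]) (use vC that in \<open>auto simp: C_def\<close>)
  have uC: "u \<in> C" using cu hu uS by (auto simp: C_def)
  have fix_point: "u z t = T u z t" if z: "z \<in> U" and t: "t \<in> {0..1}" for z t
  proof -
    have "(\<lambda>n. T (v n) z t) \<longlonglongrightarrow> T u z t"
    proof (rule LIMSEQ_I)
      fix e :: real assume e: "e > 0"
      define e' where "e' = e / exp (2 * k)"
      have "e' > 0" using e by (simp add: e'_def)
      then have "\<forall>\<^sub>F n in sequentially. \<forall>p\<in>U \<times> {0..1}. dist ((\<lambda>(z, t). v n z t) p) ((\<lambda>(z, t). u z t) p) < e'"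
        using ul unfolding uniform_limit_iff by blast
      then obtain n0 where n0: "\<And>n t. n \<ge> n0 \<Longrightarrow> t \<in> {0..1} \<Longrightarrow> norm (v n z t - u z t) < e'"
        using z unfolding eventually_sequentially by (fastforce simp: dist_norm)
      have "norm (T (v n) z t - T u z t) < e" if n: "n \<ge> n0" for n
      proof -
        have "norm (T (v n) z t - T u z t) \<le> e' / 2 * exp (2 * k * t)"
        proof (rule contraction[OF vC uC z t])
          fix s :: real assume s: "s \<in> {0..1}"
          have "1 \<le> exp (2 * k * s)" using s k by simp
          then have "e' * 1 \<le> e' * exp (2 * k * s)" using \<open>e' > 0\<close> by (intro mult_left_mono) auto
          then show "norm (v n z s - u z s) \<le> e' * exp (2 * k * s)" using n0[OF n s] by simp
        qed (use \<open>e' > 0\<close> in simp)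
        also have "\<dots> \<le> e' / 2 * exp (2 * k)"
          using \<open>e' > 0\<close> t k by (intro mult_left_mono) auto
        also have "\<dots> < e" using e by (simp add: e'_def)
        finally show ?thesis .
      qed
      then show "\<exists>no. \<forall>n\<ge>no. norm (T (v n) z t - T u z t) < e" by blast
    qed
    moreover have "(\<lambda>n. T (v n) z t) \<longlonglongrightarrow> u z t"
      using LIMSEQ_Suc[OF lim[OF z t]] by (simp add: v_def)
    ultimately show ?thesis using LIMSEQ_unique by blast
  qed
  show ?thesis
  proof (rule that[OF cu hu uS])
    show "u z 0 = a z" if "z \<in> U" for z using fix_point[OF that, of 0] by (simp add: T_def)
    show e: "u z t = a z + integral {0..t} (\<lambda>\<tau>. F z \<tau> (u z \<tau>))" if "z \<in> U" "t \<in> {0..1}" for z t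
      using fix_point[OF that] by (simp add: T_def)
    fix z and t :: real assume z: "z \<in> U" and t: "t \<in> {0..1}"
    have "((\<lambda>t. integral {0..t} (\<lambda>\<tau>. F z \<tau> (u z \<tau>))) has_vector_derivative F z t (u z t)) (at t within {0..1})"
      by (rule integral_has_vector_derivative[OF slice[of "\<lambda>z t. F z t (u z t)"]])
         (use Fc[of u] uC z t in \<open>auto simp: C_def\<close>)
    then have "((\<lambda>t. a z + integral {0..t} (\<lambda>\<tau>. F z \<tau> (u z \<tau>))) has_vector_derivative F z t (u z t)) (at t within {0..1})"
      by (auto intro!: derivative_eq_intros)
    then show "(u z has_vector_derivative F z t (u z t)) (at t within {0..1})"
      by (rule has_vector_derivative_transform[rotated 2]) (use e z t in auto)
  qed auto
qed

section \<open>Power series of separately holomorphic functions\<close>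

text \<open>
  By Cauchy's formula the derivative is an integral over a circle, to which
  \<open>holomorphic_on_integral\<close> applies.
\<close>

lemma higher_deriv_holomorphic_in_parameter:
  fixes g :: "complex \<Rightarrow> complex \<Rightarrow> complex" and U :: "complex set" and R M :: real
  assumes U: "open U" and R: "0 < R"
    and hz: "\<And>w. w \<in> U \<Longrightarrow> (\<lambda>z. g w z) holomorphic_on ball 0 R"
    and hw: "\<And>z::complex. z \<in> ball 0 R \<Longrightarrow> (\<lambda>w. g w z) holomorphic_on U"
    and M: "\<And>w z::complex. w \<in> U \<Longrightarrow> z \<in> ball 0 R \<Longrightarrow> norm (g w z) \<le> M"
  shows "(\<lambda>w. (deriv ^^ n) (g w) 0) holomorphic_on U"
proof -
  define \<rho> where "\<rho> = R / 3"
  have \<rho>: "0 < \<rho>" "\<rho> < R/2" "\<rho> < R" using R by (auto simp: \<rho>_def)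
  define c where "c = circlepath 0 \<rho>"
  have nc: "norm (c t) = \<rho>" for t using \<rho> by (simp add: c_def circlepath norm_mult)
  define k where "k = (\<lambda>t. c t ^ Suc n)"
  have contg: "continuous_on (U \<times> ball 0 (R/2)) (\<lambda>(w, z). g w z)"
  proof (rule continuous_on_Times_lipschitz)
    show "continuous_on U (\<lambda>w. g w z)" if "z \<in> ball 0 (R/2)" for z
      using that R by (intro holomorphic_on_imp_continuous_on hw) auto
    show "norm (g w z - g w z') \<le> 4 * M / R * dist z z'"
      if "w \<in> U" "z \<in> ball 0 (R/2)" "z' \<in> ball 0 (R/2)" for w and z z' :: complex
      unfolding dist_norm by (rule holomorphic_bounded_imp_lipschitz[OF hz R M]) (use that in auto)
  qed
  have "(\<lambda>w. integral {0..1} (\<lambda>t. g w (c t) / k t * (2 * pi * \<i> * \<rho> * exp (2 * of_real pi * \<i> * t)))) holomorphic_on U"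
  proof (rule holomorphic_on_integral[OF U])
    have "continuous_on (U \<times> {0..1}) (\<lambda>p. (\<lambda>(w, z). g w z) (fst p, c (snd p)))"
      by (rule continuous_on_compose2[OF contg])
         (use nc \<rho> in \<open>auto simp: c_def circlepath intro!: continuous_intros\<close>)
    then have "continuous_on (U \<times> {0..1}) (\<lambda>p. g (fst p) (c (snd p)))" by simp
    moreover have "continuous_on (U \<times> {0..1}) (\<lambda>p. k (snd p))"
      unfolding k_def c_def circlepath by (intro continuous_intros)
    moreover have "k t \<noteq> 0" for t using nc[of t] \<rho> by (auto simp: k_def)
    ultimately show "continuous_on (U \<times> {0..1}) (\<lambda>(w, t). g w (c t) / k t * (2 * pi * \<i> * \<rho> * exp (2 * of_real pi * \<i> * t)))"
      unfolding split_def by (intro continuous_intros) auto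
    show "(\<lambda>w. g w (c t) / k t * (2 * pi * \<i> * \<rho> * exp (2 * of_real pi * \<i> * t))) holomorphic_on U"
      if "t \<in> {0..1}" for t
      unfolding divide_inverse by (intro holomorphic_intros hw) (use nc \<rho> in auto)
  qed
  then have "(\<lambda>w. fact n / (2 * pi * \<i>) * integral {0..1} (\<lambda>t. g w (c t) / k t * (2 * pi * \<i> * \<rho> * exp (2 * of_real pi * \<i> * t)))) holomorphic_on U"
    by (intro holomorphic_intros)
  moreover have "fact n / (2 * pi * \<i>) * integral {0..1} (\<lambda>t. g w (c t) / k t * (2 * pi * \<i> * \<rho> * exp (2 * of_real pi * \<i> * t)))
     = (deriv ^^ n) (g w) 0" if w: "w \<in> U" for w
  proof -
    have "((\<lambda>u. g w u / (u-0) ^ (Suc n)) has_contour_integral ((2 * pi * \<i>) / (fact n) * (deriv ^^ n) (g w) 0)) (circlepath 0 \<rho>)"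
    proof (rule Cauchy_has_contour_integral_higher_derivative_circlepath)
      show "g w holomorphic_on ball 0 \<rho>" using hz[OF w] by (rule holomorphic_on_subset) (use \<rho> in auto)
      show "continuous_on (cball 0 \<rho>) (g w)"
        by (rule continuous_on_subset[OF holomorphic_on_imp_continuous_on[OF hz[OF w]]]) (use \<rho> in auto)
    qed (use \<rho> in auto)
    then have "((\<lambda>t. g w (c t) / k t * (2 * pi * \<i> * \<rho> * exp (2 * of_real pi * \<i> * t))) has_integral
        ((2 * pi * \<i>) / (fact n) * (deriv ^^ n) (g w) 0)) {0..1}"
      unfolding has_contour_integral_def c_def k_def
      by (rule has_integral_eq[rotated]) (simp add: vector_derivative_circlepath01)
    then show ?thesis by (simp add: integral_unique)
  qed
  ultimately show ?thesis by (rule holomorphic_transform)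
qed

text \<open>
  Expansion in several variables, one variable at a time. The coefficients of the expansion in one
  variable are again separately holomorphic and bounded, by \<open>M (3/R)\<^sup>n\<close>, so the induction over the
  set \<open>I\<close> of variables used so far applies to them. Those bounds also make the multiple series absolutely
  summable for \<open>\<bar>c j\<bar> < R/3\<close>, which permits its rearrangement.
\<close>

lemma separately_holomorphic_power_series:
  fixes f :: "('i::finite \<Rightarrow> complex) \<Rightarrow> complex"
  assumes R: "0 < R"
    and hol: "\<And>c i. \<forall>j. norm (c j) < R \<Longrightarrow> (\<lambda>z. f (c(i := z))) holomorphic_on ball 0 R"
    and bd: "\<And>c. \<forall>j. norm (c j) < R \<Longrightarrow> norm (f c) \<le> M"
  shows "\<exists>a. (\<forall>\<nu>. norm (a \<nu>) \<le> M * (\<Prod>i\<in>I. (3/R) ^ \<nu> i)) \<and>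
    (\<forall>c. (\<forall>j. norm (c j) < R/3) \<and> (\<forall>j. j \<notin> I \<longrightarrow> c j = 0) \<longrightarrow>
       ((\<lambda>\<nu>. a \<nu> * (\<Prod>i\<in>I. c i ^ \<nu> i)) has_sum f c) {\<nu>. \<forall>j. j \<notin> I \<longrightarrow> \<nu> j = 0})"
proof -
  have "finite I" by simp
  then show ?thesis using hol bd
  proof (induction I arbitrary: f M rule: finite_induct)
    case empty
    have "{\<nu>::'i \<Rightarrow> nat. \<forall>j. \<nu> j = 0} = {\<lambda>_. 0}" by auto
    then have "((\<lambda>\<nu>. f (\<lambda>_. 0) * (\<Prod>i\<in>{}. c i ^ \<nu> i)) has_sum f c) {\<nu>. \<forall>j. j \<notin> {} \<longrightarrow> \<nu> j = 0}"
      if "\<forall>j. j \<notin> {} \<longrightarrow> c j = 0" for c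
    proof -
      have "c = (\<lambda>_. 0)" using that by auto
      then show ?thesis using \<open>{\<nu>::'i \<Rightarrow> nat. \<forall>j. \<nu> j = 0} = {\<lambda>_. 0}\<close> by (simp add: has_sum_finiteI)
    qed
    moreover have "norm (f (\<lambda>_. 0)) \<le> M * (\<Prod>i\<in>{}. (3/R) ^ \<nu> i)" for \<nu> :: "'i \<Rightarrow> nat"
      using empty(2)[of "\<lambda>_. 0"] R by simp
    ultimately show ?case by (intro exI[of _ "\<lambda>_. f (\<lambda>_. 0)"]) blast
  next
    case (insert i I)
    note hol = insert.prems(1) and bd = insert.prems(2)
    have M0: "0 \<le> M" using order_trans[OF norm_ge_zero bd[of "\<lambda>_. 0"]] R by simp
    define b where "b = (\<lambda>n c. (deriv ^^ n) (\<lambda>z. f (c(i := z))) 0 / fact n)"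
    have bhol: "(\<lambda>w. b n (c(j := w))) holomorphic_on ball 0 R" if c: "\<forall>j. norm (c j) < R" for n c j
    proof (cases "j = i")
      case True then show ?thesis by (simp add: b_def)
    next
      case False
      have "(\<lambda>w. (deriv ^^ n) (\<lambda>z. f ((c(j := w))(i := z))) 0) holomorphic_on ball 0 R"
      proof (rule higher_deriv_holomorphic_in_parameter[OF open_ball R])
        show "(\<lambda>z. f (c(j := w, i := z))) holomorphic_on ball 0 R" if "w \<in> ball 0 R" for w
          by (rule hol) (use c that in auto)
        show "(\<lambda>w. f (c(j := w, i := z))) holomorphic_on ball 0 R" if "z \<in> ball 0 R" for z
        proof -
          have "(\<lambda>w. f ((c(i := z))(j := w))) holomorphic_on ball 0 R"
            by (rule hol) (use c that in auto)
          then show ?thesis by (simp only: fun_upd_twist[OF False])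
        qed
        show "norm (f (c(j := w, i := z))) \<le> M" if "w \<in> ball 0 R" "z \<in> ball 0 R" for w z
          by (rule bd) (use c that in auto)
      qed
      then show ?thesis unfolding b_def by (intro holomorphic_intros) auto
    qed
    have bbd: "norm (b n c) \<le> M * (3/R)^n" if c: "\<forall>j. norm (c j) < R" for n c
    proof -
      have "norm ((deriv ^^ n) (\<lambda>z. f (c(i := z))) 0) \<le> fact n * M / (R/3)^n"
      proof (rule Cauchy_inequality)
        have h: "(\<lambda>z. f (c(i := z))) holomorphic_on ball 0 R" by (rule hol) (use c in auto)
        show "(\<lambda>z. f (c(i := z))) holomorphic_on ball 0 (R/3)"
          using h by (rule holomorphic_on_subset) (use R in auto)
        show "continuous_on (cball 0 (R/3)) (\<lambda>z. f (c(i := z)))"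
          by (rule continuous_on_subset[OF holomorphic_on_imp_continuous_on[OF h]]) (use R in auto)
        show "norm (f (c(i := x))) \<le> M" if "norm (0 - x) = R/3" for x
          by (rule bd) (use c that R in auto)
      qed (use R in auto)
      then show ?thesis by (simp add: b_def norm_divide field_simps power_divide)
    qed
    have "\<forall>n. \<exists>a. (\<forall>\<nu>. norm (a \<nu>) \<le> (M * (3/R)^n) * (\<Prod>i\<in>I. (3/R) ^ \<nu> i)) \<and>
      (\<forall>c. (\<forall>j. norm (c j) < R/3) \<and> (\<forall>j. j \<notin> I \<longrightarrow> c j = 0) \<longrightarrow>
       ((\<lambda>\<nu>. a \<nu> * (\<Prod>i\<in>I. c i ^ \<nu> i)) has_sum b n c) {\<nu>. \<forall>j. j \<notin> I \<longrightarrow> \<nu> j = 0})"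
      by (intro allI insert.IH bhol bbd) auto
    from choice[OF this] obtain a where A: "\<forall>n. (\<forall>\<nu>. norm (a n \<nu>) \<le> (M * (3/R)^n) * (\<Prod>i\<in>I. (3/R) ^ \<nu> i)) \<and>
      (\<forall>c. (\<forall>j. norm (c j) < R/3) \<and> (\<forall>j. j \<notin> I \<longrightarrow> c j = 0) \<longrightarrow>
       ((\<lambda>\<nu>. a n \<nu> * (\<Prod>i\<in>I. c i ^ \<nu> i)) has_sum b n c) {\<nu>. \<forall>j. j \<notin> I \<longrightarrow> \<nu> j = 0})" ..
    have a: "norm (a n \<nu>) \<le> (M * (3/R)^n) * (\<Prod>i\<in>I. (3/R) ^ \<nu> i)" for n \<nu>
      using A by blast
    have as: "((\<lambda>\<nu>. a n \<nu> * (\<Prod>i\<in>I. c i ^ \<nu> i)) has_sum b n c) {\<nu>. \<forall>j. j \<notin> I \<longrightarrow> \<nu> j = 0}"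
      if "\<forall>j. norm (c j) < R/3" "\<forall>j. j \<notin> I \<longrightarrow> c j = 0" for n c
      using A[rule_format, of n] that by blast
    define a' where "a' = (\<lambda>\<nu>. a (\<nu> i) (\<nu>(i := 0)))"
    define S where "S = {\<nu>::'i \<Rightarrow> nat. \<forall>j. j \<notin> I \<longrightarrow> \<nu> j = 0}"
    define S' where "S' = {\<nu>::'i \<Rightarrow> nat. \<forall>j. j \<notin> insert i I \<longrightarrow> \<nu> j = 0}"
    have prodI: "(\<Prod>j\<in>I. h j ((\<nu>(i := n)) j)) = (\<Prod>j\<in>I. h j (\<nu> j))" for h :: "'i \<Rightarrow> nat \<Rightarrow> 'b::comm_monoid_mult" and \<nu> n
      by (rule prod.cong) (use insert.hyps in auto)
    have a'bd: "norm (a' \<nu>) \<le> M * (\<Prod>i\<in>insert i I. (3/R) ^ \<nu> i)" for \<nu>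
      using a[of "\<nu> i" "\<nu>(i := 0)"] insert.hyps prodI[of "\<lambda>j n. (3/R)^n" \<nu> 0] by (simp add: a'_def mult.assoc)
    have bij: "bij_betw (\<lambda>(n, \<nu>). \<nu>(i := n)) (UNIV \<times> S) S'"
      by (rule bij_betwI[where g = "\<lambda>\<nu>. (\<nu> i, \<nu>(i := 0))"])
         (use insert.hyps in \<open>auto simp: S_def S'_def fun_upd_idem\<close>)
    have "((\<lambda>\<nu>. a' \<nu> * (\<Prod>j\<in>insert i I. c j ^ \<nu> j)) has_sum f c) S'"
      if c: "\<forall>j. norm (c j) < R/3" "\<forall>j. j \<notin> insert i I \<longrightarrow> c j = 0" for c
    proof -
      have cR: "norm (c j) < R" for j using c(1)[rule_format, of j] R by linarith
      define c0 where "c0 = c(i := 0)"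
      have c0: "\<forall>j. norm (c0 j) < R/3" "\<forall>j. j \<notin> I \<longrightarrow> c0 j = 0" using c R by (auto simp: c0_def)
      define T where "T = (\<lambda>(n, \<nu>). (a n \<nu> * (\<Prod>j\<in>I. c0 j ^ \<nu> j)) * c i ^ n)"
      have summ: "(\<lambda>\<nu>. a' \<nu> * (\<Prod>j\<in>insert i I. c j ^ \<nu> j)) summable_on S'"
      proof (rule abs_summable_summable)
        \<comment> \<open>The terms are dominated by those of a product of geometric series.\<close>
        define q where "q = (\<lambda>j. norm (c j) * (3/R))"
        have q: "0 \<le> q j" "q j < 1" for j
          using c(1)[rule_format, of j] R by (auto simp: q_def field_simps)
        have geo: "(\<lambda>n. norm (q j ^ n)) summable_on UNIV" for j
          using q[of j] by (intro summable_nonneg_imp_summable_on) (auto simp: norm_power intro!: summable_geometric)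
        have "Infinite_Set_Sum.abs_summable_on (\<lambda>\<nu>. \<Prod>j\<in>UNIV. q j ^ \<nu> j) (PiE UNIV (\<lambda>_. UNIV))"
          by (rule Infinite_Set_Sum.abs_summable_on_prod_PiE)
             (use geo in \<open>simp_all add: abs_summable_equivalent[symmetric]\<close>)
        then have "(\<lambda>\<nu>. norm (\<Prod>j\<in>UNIV. q j ^ \<nu> j)) summable_on UNIV"
          unfolding abs_summable_equivalent[symmetric] by (simp add: PiE_UNIV_domain)
        then have "(\<lambda>\<nu>. norm (\<Prod>j\<in>UNIV. q j ^ \<nu> j)) summable_on S'"
          by (rule summable_on_subset_banach) auto
        then have "(\<lambda>\<nu>. M * norm (\<Prod>j\<in>UNIV. q j ^ \<nu> j)) summable_on S'"
          by (rule summable_on_cmult_right)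
        then show "(\<lambda>\<nu>. norm (a' \<nu> * (\<Prod>j\<in>insert i I. c j ^ \<nu> j))) summable_on S'"
        proof (rule Infinite_Sum.abs_summable_on_comparison_test')
          fix \<nu> assume "\<nu> \<in> S'"
          then have "(\<Prod>j\<in>UNIV. q j ^ \<nu> j) = (\<Prod>j\<in>insert i I. q j ^ \<nu> j)"
            by (intro prod.mono_neutral_right) (auto simp: S'_def)
          also have "\<dots> = (\<Prod>j\<in>insert i I. (3/R) ^ \<nu> j) * (\<Prod>j\<in>insert i I. norm (c j) ^ \<nu> j)"
            unfolding q_def power_mult_distrib prod.distrib by (rule mult.commute)
          finally have e: "norm (\<Prod>j\<in>UNIV. q j ^ \<nu> j) = (\<Prod>j\<in>insert i I. (3/R) ^ \<nu> j) * (\<Prod>j\<in>insert i I. norm (c j) ^ \<nu> j)"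
            using R by (simp add: abs_mult abs_prod)
          have "norm (a' \<nu> * (\<Prod>j\<in>insert i I. c j ^ \<nu> j)) = norm (a' \<nu>) * (\<Prod>j\<in>insert i I. norm (c j) ^ \<nu> j)"
            by (simp only: norm_mult prod_norm[symmetric] norm_power)
          also have "\<dots> \<le> (M * (\<Prod>j\<in>insert i I. (3/R) ^ \<nu> j)) * (\<Prod>j\<in>insert i I. norm (c j) ^ \<nu> j)"
            by (intro mult_right_mono a'bd prod_nonneg) auto
          finally show "norm (a' \<nu> * (\<Prod>j\<in>insert i I. c j ^ \<nu> j)) \<le> M * norm (\<Prod>j\<in>UNIV. q j ^ \<nu> j)"
            by (simp only: e mult.assoc)
        qed
      qed
      have T: "(\<lambda>(n, \<nu>). a' (\<nu>(i := n)) * (\<Prod>j\<in>insert i I. c j ^ (\<nu>(i := n)) j)) (n, \<nu>) = T (n, \<nu>)" if "\<nu> \<in> S" for n \<nu>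
      proof -
        have "\<nu>(i := 0) = \<nu>" using that insert.hyps by (auto simp: S_def fun_upd_idem)
        moreover have "(\<Prod>j\<in>I. c j ^ (\<nu>(i := n)) j) = (\<Prod>j\<in>I. c0 j ^ \<nu> j)"
          by (rule prod.cong) (use insert.hyps in \<open>auto simp: c0_def\<close>)
        ultimately show ?thesis using insert.hyps by (simp add: T_def a'_def del: fun_upd_apply) (simp add: mult_ac)
      qed
      have "(T has_sum f c) (Sigma UNIV (\<lambda>_. S))"
      proof (rule has_sum_SigmaI)
        show "((\<lambda>\<nu>. T (n, \<nu>)) has_sum (b n c0 * c i ^ n)) S" for n
          using as[OF c0, of n] by (auto simp: T_def S_def intro!: has_sum_cmult_left)
        have h: "(\<lambda>z. f (c0(i := z))) holomorphic_on ball 0 R"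
          by (rule hol) (use cR R in \<open>auto simp: c0_def\<close>)
        have "(\<lambda>n. (deriv ^^ n) (\<lambda>z. f (c0(i := z))) 0 / (fact n) * (c i - 0)^n) sums f (c0(i := c i))"
          by (rule holomorphic_power_series[OF h]) (use cR in auto)
        then have s: "(\<lambda>n. b n c0 * c i ^ n) sums f c" by (simp add: b_def c0_def)
        show "((\<lambda>n. b n c0 * c i ^ n) has_sum f c) UNIV"
        proof (rule norm_summable_imp_has_sum[OF _ s])
          have "summable (\<lambda>n. M * (norm (c i) * (3/R))^n)"
            using c(1)[rule_format, of i] R by (intro summable_mult summable_geometric) (auto simp: abs_mult field_simps)
          then show "summable (\<lambda>n. norm (b n c0 * c i ^ n))"
          proof (rule summable_comparison_test[rotated], intro exI allI impI)
            fix n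
            have "norm (b n c0) \<le> M * (3/R)^n" by (rule bbd) (use cR R in \<open>auto simp: c0_def\<close>)
            then have "norm (b n c0) * norm (c i)^n \<le> (M * (3/R)^n) * norm (c i)^n" by (rule mult_right_mono) auto
            then show "norm (norm (b n c0 * c i ^ n)) \<le> M * (norm (c i) * (3/R))^n"
              by (simp only: norm_mult norm_power power_mult_distrib mult_ac real_norm_def abs_mult abs_norm_cancel power_abs)
          qed
        qed
        have "(\<lambda>p. a' ((\<lambda>(n, \<nu>). \<nu>(i := n)) p) * (\<Prod>j\<in>insert i I. c j ^ ((\<lambda>(n, \<nu>). \<nu>(i := n)) p) j)) summable_on (UNIV \<times> S)"
          using summable_on_reindex_bij_betw[OF bij, of "\<lambda>\<nu>. a' \<nu> * (\<Prod>j\<in>insert i I. c j ^ \<nu> j)"] summ by blast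
        then show "T summable_on (Sigma UNIV (\<lambda>_. S))"
          by (rule summable_on_cong[THEN iffD1, rotated]) (use T in \<open>auto simp: split_def\<close>)
      qed
      then have "((\<lambda>p. a' ((\<lambda>(n, \<nu>). \<nu>(i := n)) p) * (\<Prod>j\<in>insert i I. c j ^ ((\<lambda>(n, \<nu>). \<nu>(i := n)) p) j)) has_sum f c) (UNIV \<times> S)"
        by (rule has_sum_cong[THEN iffD1, rotated]) (use T in \<open>auto simp: split_def\<close>)
      then show ?thesis
        using has_sum_reindex_bij_betw[OF bij, of "\<lambda>\<nu>. a' \<nu> * (\<Prod>j\<in>insert i I. c j ^ \<nu> j)"] by blast
    qed
    then show ?case using a'bd unfolding S'_def by blast
  qed
qed


text \<open>
  The expansion in the form required of the Dulac map. The index type \<open>'n option\<close> adds the variable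
  \<open>\<zeta>\<close>, at \<open>None\<close>, to the \<open>N\<close> parameters. Holomorphy of \<open>f\<close> is stated along holomorphic curves, in the
  form in which \<open>holomorphic_E\<close> supplies it.
\<close>

lemma analytic_expansion:
  fixes f :: "complex^'n::finite \<Rightarrow> complex \<Rightarrow> complex"
  assumes R: "0 < R"
    and hol: "\<And>U m \<zeta>. open U \<Longrightarrow> (\<And>i. (\<lambda>z. m z $ i) holomorphic_on U) \<Longrightarrow> \<zeta> holomorphic_on U \<Longrightarrow>
        (\<And>z. z \<in> U \<Longrightarrow> (\<forall>i. norm (m z $ i - \<mu>0 $ i) < R) \<and> norm (\<zeta> z - \<zeta>0) < R) \<Longrightarrow>
        (\<lambda>z. f (m z) (\<zeta> z)) holomorphic_on U"
    and bd: "\<And>m \<zeta>. (\<forall>i. norm (m $ i - \<mu>0 $ i) < R) \<Longrightarrow> norm (\<zeta> - \<zeta>0) < R \<Longrightarrow> norm (f m \<zeta>) \<le> M"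
  shows "\<exists>e>0. \<exists>a :: nat \<Rightarrow> ('n \<Rightarrow> nat) \<Rightarrow> complex. \<forall>\<mu> \<zeta>. norm (\<mu> - \<mu>0) < e \<and> norm (\<zeta> - \<zeta>0) < e \<longrightarrow>
       ((\<lambda>(i, \<nu>). a i \<nu> * (\<zeta> - \<zeta>0) ^ i * monomial (\<mu> - \<mu>0) \<nu>) has_sum f \<mu> \<zeta>) UNIV"
proof -
  define m where "m = (\<lambda>c::'n option \<Rightarrow> complex. \<chi> j. \<mu>0 $ j + c (Some j))"
  define F where "F = (\<lambda>c::'n option \<Rightarrow> complex. f (m c) (\<zeta>0 + c None))"
  have "\<exists>a. (\<forall>\<nu>. norm (a \<nu>) \<le> M * (\<Prod>i\<in>UNIV. (3/R) ^ \<nu> i)) \<and>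
    (\<forall>c. (\<forall>j. norm (c j) < R/3) \<and> (\<forall>j. j \<notin> UNIV \<longrightarrow> c j = 0) \<longrightarrow>
       ((\<lambda>\<nu>. a \<nu> * (\<Prod>i\<in>UNIV. c i ^ \<nu> i)) has_sum F c) {\<nu>. \<forall>j. j \<notin> UNIV \<longrightarrow> \<nu> j = 0})"
  proof (rule separately_holomorphic_power_series[OF R])
    show "(\<lambda>z. F (c(i := z))) holomorphic_on ball 0 R" if c: "\<forall>j. norm (c j) < R" for c i
      unfolding F_def
    proof (rule hol)
      show "(\<lambda>z. m (c(i := z)) $ k) holomorphic_on ball 0 R" for k
        by (cases "Some k = i") (auto simp: m_def intro!: holomorphic_intros)
      show "(\<lambda>z. \<zeta>0 + (c(i := z)) None) holomorphic_on ball 0 R"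
        by (cases "None = i") (auto intro!: holomorphic_intros)
    qed (use c in \<open>auto simp: m_def\<close>)
    show "norm (F c) \<le> M" if c: "\<forall>j. norm (c j) < R" for c
      unfolding F_def by (rule bd) (use c in \<open>auto simp: m_def\<close>)
  qed
  then obtain a where a: "\<And>c. (\<forall>j. norm (c j) < R/3) \<Longrightarrow> ((\<lambda>\<nu>. a \<nu> * (\<Prod>i\<in>UNIV. c i ^ \<nu> i)) has_sum F c) UNIV"
    by auto
  define g where "g = (\<lambda>(i, \<nu>). \<lambda>k::'n option. (case k of None \<Rightarrow> i :: nat | Some j \<Rightarrow> \<nu> j))"
  have bij: "bij_betw g UNIV UNIV"
    by (rule bij_betwI[where g = "\<lambda>\<nu>. (\<nu> None, \<lambda>j. \<nu> (Some j))"]) (auto simp: g_def fun_eq_iff split: option.splits)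
  have prod: "(\<Prod>k\<in>UNIV. h k) = h None * (\<Prod>j\<in>UNIV. h (Some j))" for h :: "'n option \<Rightarrow> complex"
    by (simp add: UNIV_option_conv prod.reindex)
  have "((\<lambda>(i, \<nu>). a (g (i, \<nu>)) * (\<zeta> - \<zeta>0) ^ i * monomial (\<mu> - \<mu>0) \<nu>) has_sum f \<mu> \<zeta>) UNIV"
    if h: "norm (\<mu> - \<mu>0) < R/3" "norm (\<zeta> - \<zeta>0) < R/3" for \<mu> \<zeta>
  proof -
    define c where "c = (\<lambda>k. case k of None \<Rightarrow> \<zeta> - \<zeta>0 | Some j \<Rightarrow> \<mu> $ j - \<mu>0 $ j)"
    have "norm (\<mu> $ j - \<mu>0 $ j) < R/3" for j
      using h(1) Finite_Cartesian_Product.norm_nth_le[of "\<mu> - \<mu>0" j] by simp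
    then have "\<forall>j. norm (c j) < R/3" using h(2) by (auto simp: c_def split: option.splits)
    from a[OF this] have "((\<lambda>p. a (g p) * (\<Prod>k\<in>UNIV. c k ^ g p k)) has_sum F c) UNIV"
      using has_sum_reindex_bij_betw[OF bij, of "\<lambda>\<nu>. a \<nu> * (\<Prod>i\<in>UNIV. c i ^ \<nu> i)"] by simp
    moreover have "F c = f \<mu> \<zeta>" by (simp add: F_def m_def c_def)
    moreover have "(\<Prod>k\<in>UNIV. c k ^ g p k) = (\<zeta> - \<zeta>0) ^ fst p * monomial (\<mu> - \<mu>0) (snd p)" for p
      by (simp add: prod c_def g_def monomial_def split_def)
    ultimately show ?thesis by (simp add: split_def mult.assoc)
  qed
  then show ?thesis using R by (intro exI[of _ "R/3"] conjI exI[of _ "\<lambda>i \<nu>. a (g (i, \<nu>))"]) auto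
qed

section \<open>Complexified germs\<close>

text \<open>
  Holomorphy in several variables is encoded as continuity together with holomorphy along every
  holomorphic curve \<open>z \<mapsto> (x z, y z, m z)\<close>. In this form it can be
  combined directly with Cauchy's estimates and the Picard iteration, which concern one complex variable.
\<close>

definition holomorphic_on_polydisc :: "real \<Rightarrow> (complex \<Rightarrow> complex \<Rightarrow> complex^'n::finite \<Rightarrow> complex) \<Rightarrow> bool" where
  "holomorphic_on_polydisc r F \<longleftrightarrow>
     continuous_on {(x, y, m). norm x < r \<and> norm y < r \<and> norm m < r} (\<lambda>(x, y, m). F x y m) \<and>
     (\<forall>U x y m. open U \<longrightarrow> x holomorphic_on U \<longrightarrow> y holomorphic_on U \<longrightarrow>
        (\<forall>i. (\<lambda>z. m z $ i) holomorphic_on U) \<longrightarrow>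
        (\<forall>z\<in>U. norm (x z) < r \<and> norm (y z) < r \<and> norm (m z) < r) \<longrightarrow>
        (\<lambda>z. F (x z) (y z) (m z)) holomorphic_on U)"

text \<open>
  A real germ is evaluated at complex parameters by its power series. The series converges at a
  real point with all coordinates equal to some \<open>\<rho> > 0\<close>, and its terms there dominate those at any point
  of the complex polydisc of radius \<open>\<rho>\<close>, so the \<open>M\<close>-test applies. The coefficients being real, the sum
  commutes with conjugation.
\<close>

lemma real_analytic_germ_complexification:
  fixes F :: "complex \<Rightarrow> complex \<Rightarrow> real^'n::finite \<Rightarrow> complex"
  assumes "real_analytic_germ F"
  obtains r Fc where "0 < r" "holomorphic_on_polydisc r Fc"
    "\<And>x y \<mu>. norm x < r \<Longrightarrow> norm y < r \<Longrightarrow> norm \<mu> < r \<Longrightarrow> Fc x y (complex_vec \<mu>) = F x y \<mu>"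
    "\<And>x y \<mu>. norm x < r \<Longrightarrow> norm y < r \<Longrightarrow> norm \<mu> < r \<Longrightarrow> F (cnj x) (cnj y) \<mu> = cnj (F x y \<mu>)"
proof -
  obtain r a where r: "r > 0" and sum: "\<And>x y \<mu>. norm x < r \<Longrightarrow> norm y < r \<Longrightarrow> norm \<mu> < r \<Longrightarrow>
      ((\<lambda>(i, j, \<nu>). of_real (a i j \<nu>) * x ^ i * y ^ j * of_real (monomial \<mu> \<nu>)) has_sum F x y \<mu>) UNIV"
    using assms unfolding real_analytic_germ_def by blast
  \<comment> \<open>With this radius the parameter \<open>(\<rho>, \<dots>, \<rho>)\<close> has norm below \<open>r\<close>.\<close>
  define \<rho> where "\<rho> = r / (CARD('n) + 1)"
  have \<rho>: "0 < \<rho>" "\<rho> < r" "CARD('n) * \<rho> < r"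
    using r by (auto simp: \<rho>_def field_simps)
  define T where "T = (\<lambda>(i, j, \<nu>) x y m. complex_of_real (a i j \<nu>) * x ^ i * y ^ j * monomial m \<nu>)"
  define B where "B = (\<lambda>(i, j, \<nu>). \<bar>a i j \<nu>\<bar> * \<rho> ^ i * \<rho> ^ j * (\<Prod>k::'n\<in>UNIV. \<rho> ^ \<nu> k))"
  define Fc where "Fc = (\<lambda>x y m. \<Sum>\<^sub>\<infinity>p. T p x y m)"
  define P where "P = {(x::complex, y::complex, m::complex^'n). norm x < \<rho> \<and> norm y < \<rho> \<and> norm m < \<rho>}"
  have Bs: "B summable_on UNIV"
  proof -
    define \<mu> :: "real^'n" where "\<mu> = (\<chi> k. \<rho>)"
    have "norm \<mu> \<le> (\<Sum>k\<in>UNIV. \<bar>\<mu> $ k\<bar>)" by (rule norm_le_l1_cart)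
    then have "norm \<mu> < r" using \<rho> by (simp add: \<mu>_def)
    then have "((\<lambda>(i, j, \<nu>). of_real (a i j \<nu>) * complex_of_real \<rho> ^ i * complex_of_real \<rho> ^ j * of_real (monomial \<mu> \<nu>)) has_sum F \<rho> \<rho> \<mu>) UNIV"
      using \<rho> by (intro sum) auto
    then have "(\<lambda>(i, j, \<nu>). of_real (a i j \<nu>) * complex_of_real \<rho> ^ i * complex_of_real \<rho> ^ j * of_real (monomial \<mu> \<nu>)) summable_on UNIV"
      by (rule has_sum_imp_summable)
    then have "(\<lambda>p. norm ((\<lambda>(i, j, \<nu>). of_real (a i j \<nu>) * complex_of_real \<rho> ^ i * complex_of_real \<rho> ^ j * of_real (monomial \<mu> \<nu>)) p)) summable_on UNIV"
      using summable_on_iff_abs_summable_on_complex by blast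
    moreover have "norm ((\<lambda>(i, j, \<nu>). of_real (a i j \<nu>) * complex_of_real \<rho> ^ i * complex_of_real \<rho> ^ j * of_real (monomial \<mu> \<nu>)) p) = B p" for p
      using \<rho> by (cases p) (simp add: B_def norm_mult norm_power monomial_def \<mu>_def prod_norm[symmetric])
    ultimately show ?thesis by simp
  qed
  have TB: "norm (T p x y m) \<le> B p" if "norm x < \<rho>" "norm y < \<rho>" "norm m < \<rho>" for p x y and m :: "complex^'n"
  proof -
    obtain i j \<nu> where p: "p = (i, j, \<nu>)" by (cases p)
    have "norm (m $ k) \<le> \<rho>" for k using Finite_Cartesian_Product.norm_nth_le[of m k] that by simp
    then have "(\<Prod>k\<in>UNIV. norm (m $ k) ^ \<nu> k) \<le> (\<Prod>k\<in>UNIV. \<rho> ^ \<nu> k)"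
      by (intro prod_mono) (auto intro: power_mono)
    then have "\<bar>a i j \<nu>\<bar> * norm x ^ i * norm y ^ j * (\<Prod>k\<in>UNIV. norm (m $ k) ^ \<nu> k) \<le> B p"
      unfolding B_def p using that \<rho>
      by (auto intro!: mult_mono power_mono prod_nonneg mult_nonneg_nonneg)
    then show ?thesis by (simp add: T_def p monomial_def norm_mult norm_power prod_norm[symmetric])
  qed
  have ul: "uniform_limit P (\<lambda>X (x, y, m). \<Sum>p\<in>X. T p x y m) (\<lambda>(x, y, m). Fc x y m) (finite_subsets_at_top UNIV)"
  proof -
    have "uniform_limit P (\<lambda>X q. \<Sum>p\<in>X. T p (fst q) (fst (snd q)) (snd (snd q)))
        (\<lambda>q. \<Sum>\<^sub>\<infinity>p. T p (fst q) (fst (snd q)) (snd (snd q))) (finite_subsets_at_top UNIV)"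
      by (rule Weierstrass_m_test_general[where M = B]) (use TB Bs in \<open>auto simp: P_def\<close>)
    then show ?thesis by (simp add: split_def Fc_def)
  qed
  have "continuous_on P (\<lambda>(x, y, m). Fc x y m)"
  proof (rule uniform_limit_theorem[OF _ ul])
    show "\<forall>\<^sub>F X in finite_subsets_at_top UNIV. continuous_on P (\<lambda>(x, y, m). \<Sum>p\<in>X. T p x y m)"
      by (rule always_eventually) (auto simp: T_def split_def monomial_def intro!: continuous_intros)
  qed simp
  moreover have "(\<lambda>z. Fc (x z) (y z) (m z)) holomorphic_on U"
    if U: "open U" and h: "x holomorphic_on U" "y holomorphic_on U" "\<forall>i. (\<lambda>z. m z $ i) holomorphic_on U"
      and le: "\<forall>z\<in>U. norm (x z) < \<rho> \<and> norm (y z) < \<rho> \<and> norm (m z) < \<rho>" for U x y and m :: "complex \<Rightarrow> complex^'n"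
  proof -
    have "(\<lambda>z. Fc (x z) (y z) (m z)) field_differentiable (at z0)" if z0: "z0 \<in> U" for z0
    proof -
      obtain d where d: "d > 0" "cball z0 d \<subseteq> U" using U z0 open_contains_cball by blast
      have ul': "uniform_limit (cball z0 d) (\<lambda>X z. \<Sum>p\<in>X. T p (x z) (y z) (m z)) (\<lambda>z. Fc (x z) (y z) (m z)) (finite_subsets_at_top UNIV)"
        unfolding Fc_def by (rule Weierstrass_m_test_general[where M = B]) (use TB Bs le d in auto)
      have hol: "(\<lambda>z. \<Sum>p\<in>X. T p (x z) (y z) (m z)) holomorphic_on U" for X
        unfolding T_def split_def monomial_def using h by (intro holomorphic_intros) auto
      obtain "(\<lambda>z. Fc (x z) (y z) (m z)) holomorphic_on ball z0 d"
      proof (rule holomorphic_uniform_limit[OF _ ul'])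
        show "\<forall>\<^sub>F X in finite_subsets_at_top UNIV. continuous_on (cball z0 d) (\<lambda>z. \<Sum>p\<in>X. T p (x z) (y z) (m z)) \<and>
            (\<lambda>z. \<Sum>p\<in>X. T p (x z) (y z) (m z)) holomorphic_on ball z0 d"
        proof (intro always_eventually allI conjI)
          fix X
          show "continuous_on (cball z0 d) (\<lambda>z. \<Sum>p\<in>X. T p (x z) (y z) (m z))"
            by (rule continuous_on_subset[OF holomorphic_on_imp_continuous_on[OF hol] d(2)])
          show "(\<lambda>z. \<Sum>p\<in>X. T p (x z) (y z) (m z)) holomorphic_on ball z0 d"
            by (rule holomorphic_on_subset[OF hol]) (use d ball_subset_cball in blast)
        qed
      qed auto
      then show ?thesis using d(1) by (auto intro: holomorphic_on_imp_differentiable_at)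
    qed
    then show ?thesis by (auto simp: holomorphic_on_def intro: field_differentiable_at_within)
  qed
  ultimately have hp: "holomorphic_on_polydisc \<rho> Fc" unfolding holomorphic_on_polydisc_def P_def by blast
  show ?thesis
  proof (rule that[OF \<rho>(1) hp])
    fix x y :: complex and \<mu> :: "real^'n" assume h: "norm x < \<rho>" "norm y < \<rho>" "norm \<mu> < \<rho>"
    then have hr: "norm x < r" "norm y < r" "norm \<mu> < r" using \<rho> by auto
    have "(\<lambda>(i, j, \<nu>). of_real (a i j \<nu>) * x ^ i * y ^ j * of_real (monomial \<mu> \<nu>)) = (\<lambda>p. T p x y (complex_vec \<mu>))"
      by (auto simp: T_def monomial_def complex_vec_def fun_eq_iff)
    then show "Fc x y (complex_vec \<mu>) = F x y \<mu>"
      using sum[OF hr] infsumI unfolding Fc_def by metis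
    have "((\<lambda>p. cnj ((\<lambda>(i, j, \<nu>). of_real (a i j \<nu>) * x ^ i * y ^ j * of_real (monomial \<mu> \<nu>)) p)) has_sum cnj (F x y \<mu>)) UNIV"
      using sum[OF hr] by (simp only: has_sum_cnj_iff)
    moreover have "(\<lambda>p. cnj ((\<lambda>(i, j, \<nu>). of_real (a i j \<nu>) * x ^ i * y ^ j * of_real (monomial \<mu> \<nu>)) p))
       = (\<lambda>(i, j, \<nu>). of_real (a i j \<nu>) * cnj x ^ i * cnj y ^ j * of_real (monomial \<mu> \<nu>))"
      by (auto simp: fun_eq_iff)
    ultimately show "F (cnj x) (cnj y) \<mu> = cnj (F x y \<mu>)"
      using sum[of "cnj x" "cnj y" \<mu>] hr by (metis (no_types, lifting) complex_mod_cnj has_sum_unique)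
  qed
qed

section \<open>The saddle in logarithmic coordinates\<close>

text \<open>
  \<open>G\<close> stands for \<open>\<alpha> B / A\<close>, extended to complex parameters. Its closeness \<open>\<eta>\<close> to the constant \<open>\<alpha>0\<close> is
  the only quantitative information about the family that is used; \<open>cnj_G\<close> is the reality of the family.
\<close>

locale saddle =
  fixes G :: "complex \<Rightarrow> complex \<Rightarrow> complex^'n::finite \<Rightarrow> complex" and \<alpha>0 r \<eta> :: real
  assumes \<alpha>0: "0 < \<alpha>0" and r: "0 < r" and \<eta>: "0 < \<eta>" "\<eta> \<le> \<alpha>0 / 200"
    and polydisc: "holomorphic_on_polydisc r G"
    and near: "\<And>x y m. norm x < r \<Longrightarrow> norm y < r \<Longrightarrow> norm m < r \<Longrightarrow> norm (G x y m - of_real \<alpha>0) \<le> \<eta>"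
    and cnj_G: "\<And>x y \<mu>. norm x < r \<Longrightarrow> norm y < r \<Longrightarrow> norm \<mu> < r \<Longrightarrow>
        G (cnj x) (cnj y) (complex_vec \<mu>) = cnj (G x y (complex_vec \<mu>))"
begin

lemma continuous_on_G:
  "continuous_on {(x, y, m). norm x < r \<and> norm y < r \<and> norm m < r} (\<lambda>(x, y, m). G x y m)"
  using polydisc by (simp add: holomorphic_on_polydisc_def)

lemma holomorphic_G:
  fixes m :: "complex \<Rightarrow> complex^'n"
  assumes "open U" "x holomorphic_on U" "y holomorphic_on U" "\<And>i. (\<lambda>z. m z $ i) holomorphic_on U"
    "\<And>z. z \<in> U \<Longrightarrow> norm (x z) < r" "\<And>z. z \<in> U \<Longrightarrow> norm (y z) < r" "\<And>z. z \<in> U \<Longrightarrow> norm (m z) < r"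
  shows "(\<lambda>z. G (x z) (y z) (m z)) holomorphic_on U"
  by (rule polydisc[unfolded holomorphic_on_polydisc_def, THEN conjunct2, rule_format])
     (use assms in auto)

lemma norm_G_le:
  assumes "norm x < r" "norm y < r" "norm m < r"
  shows "norm (G x y m) \<le> 2 * \<alpha>0"
proof -
  have "norm (G x y m) \<le> norm (G x y m - of_real \<alpha>0) + norm (complex_of_real \<alpha>0)"
    using norm_triangle_ineq[of "G x y m - of_real \<alpha>0" "of_real \<alpha>0"] by simp
  then show ?thesis using near[OF assms] \<alpha>0 \<eta> by simp
qed

lemma norm_G_ge:
  assumes "norm x < r" "norm y < r" "norm m < r"
  shows "\<alpha>0 / 2 \<le> norm (G x y m)"
proof -
  have "norm (complex_of_real \<alpha>0) \<le> norm (G x y m - of_real \<alpha>0) + norm (G x y m)"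
    using norm_triangle_ineq4[of "G x y m" "G x y m - of_real \<alpha>0"] by simp
  then show ?thesis using near[OF assms] \<alpha>0 \<eta> by simp
qed

text \<open>
  The Lipschitz constant in the logarithmic coordinate is small with \<open>\<eta>\<close>, as \<open>G\<close> differs from a constant
  by at most \<open>\<eta>\<close> and \<open>\<bar>e\<^sup>v - e\<^sup>w\<bar> \<le> s \<bar>v - w\<bar>\<close>.
\<close>

lemma lipschitz_G_exp:
  assumes s: "0 < s" "3 * s \<le> r" and x: "norm x < r" and m: "norm m < r"
    and v: "Re v < ln s" and w: "Re w < ln s"
  shows "norm (G x (exp v) m - G x (exp w) m) \<le> 2 * \<eta> * norm (v - w)"
proof (rule field_differentiable_bound[of "{v. Re v < ln s}" "\<lambda>v. G x (exp v) m" "deriv (\<lambda>v. G x (exp v) m)"])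
  define H where "H = {v. Re v < ln s + 1}"
  have oH: "open H" unfolding H_def by (rule open_halfspace_Re_lt)
  have eH: "norm (exp v) < r" if "v \<in> H" for v
  proof -
    have "norm (exp v) < exp (ln s + 1)" using that by (simp add: H_def)
    also have "\<dots> = s * exp 1" using s by (simp add: exp_add)
    also have "\<dots> \<le> s * 3" using s exp_le by (intro mult_left_mono) auto
    finally show ?thesis using s by simp
  qed
  have hol: "(\<lambda>v. G x (exp v) m) holomorphic_on H"
    by (rule holomorphic_G[OF oH]) (use eH x m in \<open>auto intro!: holomorphic_intros\<close>)
  fix z assume z: "z \<in> {v. Re v < ln s}"
  then have zH: "z \<in> H" by (simp add: H_def)
  show "((\<lambda>v. G x (exp v) m) has_field_derivative deriv (\<lambda>v. G x (exp v) m) z) (at z within {v. Re v < ln s})"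
    using holomorphic_derivI[OF hol oH zH] has_field_derivative_at_within by blast
  have sub: "ball z 1 \<subseteq> H"
  proof
    fix w assume "w \<in> ball z 1"
    then have "Re w < Re z + 1" using abs_Re_le_cmod[of "w - z"] by (simp add: dist_norm norm_minus_commute)
    then show "w \<in> H" using z by (simp add: H_def)
  qed
  have "norm (deriv (\<lambda>v. G x (exp v) m - of_real \<alpha>0) z) \<le> 2 * \<eta> / 1"
  proof (rule norm_deriv_le_of_bounded)
    show "(\<lambda>v. G x (exp v) m - of_real \<alpha>0) holomorphic_on ball z 1"
      using hol sub by (intro holomorphic_intros) (auto intro: holomorphic_on_subset)
  qed (use near eH sub x m in auto)
  moreover have "deriv (\<lambda>v. G x (exp v) m - of_real \<alpha>0) z = deriv (\<lambda>v. G x (exp v) m) z"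
    using holomorphic_on_imp_differentiable_at[OF hol oH zH] by (subst deriv_diff) auto
  ultimately show "norm (deriv (\<lambda>v. G x (exp v) m) z) \<le> 2 * \<eta>" by simp
qed (use v w in \<open>auto simp: convex_halfspace_Re_lt\<close>)

end

locale saddle_sections = saddle +
  fixes s c1 c2 :: real
  assumes s: "0 < s" "3 * s \<le> r" and c1: "0 < c1" "c1 < s" and c2: "0 < c2" "c2 < s"
begin

text \<open>
  \<open>cone 1\<close> is the region in which leaves can be followed to \<open>\<tau>\<close> along straight segments. The smaller
  \<open>cone 2\<close> leaves room for Cauchy estimates on discs of radius proportional to \<open>ln c2 - Re \<zeta>\<close>.
\<close>

definition cone :: "real \<Rightarrow> complex set" where
  "cone a = {\<zeta>. a * \<bar>Im \<zeta>\<bar> < ln c2 - Re \<zeta>}"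

text \<open>
  The equation \<open>dv/dw = - G(e\<^sup>w, e\<^sup>v)\<close> over the segment \<open>w = \<zeta> + t (ln c2 - \<zeta>)\<close>, \<open>0 \<le> t \<le> 1\<close>.
\<close>

definition field :: "complex \<Rightarrow> complex^'a \<Rightarrow> real \<Rightarrow> complex \<Rightarrow> complex" where
  "field \<zeta> m t v = - (of_real (ln c2) - \<zeta>) * G (exp (\<zeta> + of_real t * (of_real (ln c2) - \<zeta>))) (exp v) m"

definition is_sol :: "complex \<Rightarrow> complex \<Rightarrow> complex^'a \<Rightarrow> (real \<Rightarrow> complex) \<Rightarrow> bool" where
  "is_sol \<zeta> v0 m u \<longleftrightarrow> u 0 = v0 \<and> (\<forall>t\<in>{0..1}. Re (u t) < ln s \<and>
      (u has_vector_derivative field \<zeta> m t (u t)) (at t within {0..1}))"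

lemma open_cone: "open (cone a)"
  unfolding cone_def by (intro open_Collect_less continuous_intros)

lemma convex_cone:
  assumes "0 \<le> a" shows "convex (cone a)"
proof (rule convexI)
  fix x y :: complex and u v :: real
  assume h: "x \<in> cone a" "y \<in> cone a" "0 \<le> u" "0 \<le> v" "u + v = 1"
  have "a * \<bar>u * Im x + v * Im y\<bar> \<le> a * (u * \<bar>Im x\<bar> + v * \<bar>Im y\<bar>)"
    using h assms by (intro mult_left_mono order_trans[OF abs_triangle_ineq]) (auto simp: abs_mult)
  also have "\<dots> = u * (a * \<bar>Im x\<bar>) + v * (a * \<bar>Im y\<bar>)" by (simp add: algebra_simps)
  also have "\<dots> < u * (ln c2 - Re x) + v * (ln c2 - Re y)"
  proof (cases "u = 0")
    case True then show ?thesis using h by (simp add: cone_def)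
  next
    case False
    then show ?thesis using h
      by (intro add_less_le_mono mult_strict_left_mono mult_left_mono) (auto simp: cone_def)
  qed
  also have "\<dots> = ln c2 * (u + v) - (u * Re x + v * Re y)" by (simp add: algebra_simps)
  finally show "u *\<^sub>R x + v *\<^sub>R y \<in> cone a" using h by (simp add: cone_def)
qed

lemma cone_antimono: "a \<le> b \<Longrightarrow> cone b \<subseteq> cone a"
  unfolding cone_def by (auto intro: le_less_trans[OF mult_right_mono])

lemma cnj_cone [simp]: "cnj \<zeta> \<in> cone a \<longleftrightarrow> \<zeta> \<in> cone a"
  by (simp add: cone_def)

lemma cone1D:
  assumes "\<zeta> \<in> cone 1"
  shows "Re \<zeta> < ln c2" "\<bar>Im \<zeta>\<bar> < ln c2 - Re \<zeta>"
  using assms by (auto simp: cone_def)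

lemma norm_exp_path_less:
  assumes "\<zeta> \<in> cone 1" "t \<in> {0..1}"
  shows "norm (exp (\<zeta> + of_real t * (of_real (ln c2) - \<zeta>))) < s"
proof -
  have "Re \<zeta> + t * (ln c2 - Re \<zeta>) \<le> Re \<zeta> + 1 * (ln c2 - Re \<zeta>)"
    using assms cone1D(1)[OF assms(1)] by (intro add_left_mono mult_right_mono) auto
  then have "Re (\<zeta> + of_real t * (of_real (ln c2) - \<zeta>)) \<le> ln c2" by simp
  then have "norm (exp (\<zeta> + of_real t * (of_real (ln c2) - \<zeta>))) \<le> exp (ln c2)"
    unfolding norm_exp_eq_Re by (simp only: exp_le_cancel_iff)
  then show ?thesis using c2 by simp
qed

lemma norm_exp_less: "Re v < ln s \<Longrightarrow> norm (exp v) < s"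
  using s by (simp add: norm_exp_eq_Re) (metis exp_less_cancel_iff exp_ln)

lemma in_range:
  assumes "\<zeta> \<in> cone 1" "t \<in> {0..1}" "Re v < ln s"
  shows "norm (exp (\<zeta> + of_real t * (of_real (ln c2) - \<zeta>))) < r" "norm (exp v) < r"
  using norm_exp_path_less[OF assms(1,2)] norm_exp_less[OF assms(3)] s by auto

lemma lipschitz_field:
  assumes "\<zeta> \<in> cone 1" "norm m < r" "t \<in> {0..1}" "Re v < ln s" "Re w < ln s"
  shows "norm (field \<zeta> m t v - field \<zeta> m t w) \<le> norm (of_real (ln c2) - \<zeta>) * (2 * \<eta>) * norm (v - w)"
proof -
  define x where "x = exp (\<zeta> + of_real t * (of_real (ln c2) - \<zeta>))"
  have "norm (G x (exp v) m - G x (exp w) m) \<le> 2 * \<eta> * norm (v - w)"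
    by (rule lipschitz_G_exp[OF s]) (use assms in_range in \<open>auto simp: x_def\<close>)
  moreover have "field \<zeta> m t v - field \<zeta> m t w = - (of_real (ln c2) - \<zeta>) * (G x (exp v) m - G x (exp w) m)"
    by (simp add: field_def x_def algebra_simps)
  ultimately show ?thesis
    by (simp only: norm_mult norm_minus_cancel mult.assoc mult_left_mono norm_ge_zero)
qed

lemma is_sol_unique:
  assumes "\<zeta> \<in> cone 1" "norm m < r" "is_sol \<zeta> v0 m u" "is_sol \<zeta> v0 m w" "t \<in> {0..1}"
  shows "u t = w t"
  by (rule ode_unique[of u "\<lambda>t. field \<zeta> m t (u t)" w "\<lambda>t. field \<zeta> m t (w t)" "norm (of_real (ln c2) - \<zeta>) * (2 * \<eta>)"])
     (use assms lipschitz_field in \<open>auto simp: is_sol_def\<close>)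

lemma norm_lc2_le:
  assumes "\<zeta> \<in> cone 1" shows "norm (of_real (ln c2) - \<zeta>) \<le> 2 * (ln c2 - Re \<zeta>)"
  using cmod_le[of "of_real (ln c2) - \<zeta>"] cone1D[OF assms] by simp

lemma norm_field_le:
  assumes "\<zeta> \<in> cone 1" "norm m < r" "t \<in> {0..1}" "Re v < ln s"
  shows "norm (field \<zeta> m t v) \<le> norm (of_real (ln c2) - \<zeta>) * (2 * \<alpha>0)"
  unfolding field_def norm_mult norm_minus_cancel
  by (intro mult_left_mono norm_G_le in_range) (use assms in auto)

lemma norm_field_near:
  assumes "\<zeta> \<in> cone 1" "norm m < r" "t \<in> {0..1}" "Re v < ln s"
  shows "norm (field \<zeta> m t v + of_real \<alpha>0 * (of_real (ln c2) - \<zeta>)) \<le> \<eta> * norm (of_real (ln c2) - \<zeta>)"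
proof -
  define x where "x = exp (\<zeta> + of_real t * (of_real (ln c2) - \<zeta>))"
  have "norm (G x (exp v) m - of_real \<alpha>0) \<le> \<eta>"
    by (intro near) (use assms in_range in \<open>auto simp: x_def\<close>)
  moreover have "field \<zeta> m t v + of_real \<alpha>0 * (of_real (ln c2) - \<zeta>) = - (of_real (ln c2) - \<zeta>) * (G x (exp v) m - of_real \<alpha>0)"
    by (simp add: field_def x_def algebra_simps)
  ultimately show ?thesis
    by (simp only: norm_mult norm_minus_cancel mult.commute[of \<eta>] mult_left_mono norm_ge_zero)
qed

text \<open>
  For \<open>\<zeta> \<in> cone 1\<close> the argument of \<open>ln c2 - \<zeta>\<close> is less than \<open>\<pi>/4\<close> in modulus, and that of \<open>G\<close> is very
  small. Hence \<open>Re v\<close> never increases, and solutions cannot leave \<open>\<bar>y\<bar> < s\<close>.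
\<close>

lemma Re_field_nonpos:
  assumes "\<zeta> \<in> cone 1" "norm m < r" "t \<in> {0..1}" "Re v < ln s"
  shows "Re (field \<zeta> m t v) \<le> 0"
proof -
  define F where "F = field \<zeta> m t v + of_real \<alpha>0 * (of_real (ln c2) - \<zeta>)"
  have "Re F \<le> norm F" by (rule complex_Re_le_cmod)
  also have "\<dots> \<le> \<eta> * norm (of_real (ln c2) - \<zeta>)" unfolding F_def by (rule norm_field_near[OF assms])
  also have "\<dots> \<le> \<eta> * (2 * (ln c2 - Re \<zeta>))" using norm_lc2_le[OF assms(1)] \<eta> by (intro mult_left_mono) auto
  also have "\<dots> \<le> (\<alpha>0 / 2) * (2 * (ln c2 - Re \<zeta>))"
    using \<eta> \<alpha>0 cone1D(1)[OF assms(1)] by (intro mult_right_mono) auto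
  finally show ?thesis by (simp add: F_def algebra_simps)
qed

lemma continuous_on_vec_components:
  fixes m :: "complex \<Rightarrow> complex^'a"
  assumes "\<And>i. (\<lambda>z. m z $ i) holomorphic_on U"
  shows "continuous_on U m"
proof -
  have "continuous_on U (\<lambda>z. \<chi> i. m z $ i)"
    using assms holomorphic_on_imp_continuous_on by (intro continuous_on_vec_lambda) blast
  then show ?thesis by simp
qed

text \<open>
  Picard iteration with the half planes \<open>Re v \<le> Re (v0 z)\<close> as confining sets. The solution follows the
  affine leaf \<open>v = v0 - \<alpha>0 (w - \<zeta>)\<close> up to an error of \<open>\<eta>\<close> times the length of the segment.
\<close>

lemma solutions_along_curve:
  fixes m :: "complex \<Rightarrow> complex^'a"
  assumes U: "open U" and \<zeta>: "\<zeta> holomorphic_on U" and v0: "v0 holomorphic_on U"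
    and m: "\<And>i. (\<lambda>z. m z $ i) holomorphic_on U"
    and dom: "\<And>z. z \<in> U \<Longrightarrow> \<zeta> z \<in> cone 1" "\<And>z. z \<in> U \<Longrightarrow> Re (v0 z) < ln s" "\<And>z. z \<in> U \<Longrightarrow> norm (m z) < r"
    and bd: "\<And>z. z \<in> U \<Longrightarrow> norm (of_real (ln c2) - \<zeta> z) \<le> b"
  obtains u where "\<And>z. z \<in> U \<Longrightarrow> is_sol (\<zeta> z) (v0 z) (m z) (u z)"
    "(\<lambda>z. u z 1) holomorphic_on U"
    "\<And>z t. z \<in> U \<Longrightarrow> t \<in> {0..1} \<Longrightarrow> Re (u z t) \<le> Re (v0 z)"
    "\<And>z. z \<in> U \<Longrightarrow> norm (u z 1 - v0 z + of_real \<alpha>0 * (of_real (ln c2) - \<zeta> z)) \<le> \<eta> * norm (of_real (ln c2) - \<zeta> z)"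
proof -
  define S where "S = (\<lambda>z (t::real). {v. Re v \<le> Re (v0 z)})"
  define F where "F = (\<lambda>z. field (\<zeta> z) (m z))"
  have SD: "Re v < ln s" if "z \<in> U" "v \<in> S z t" for z t v
    using that dom(2)[of z] by (simp add: S_def)
  have cm: "continuous_on U m" by (rule continuous_on_vec_components[OF m])
  define A where "A = {(z, t, v). z \<in> U \<and> t \<in> {0..1} \<and> v \<in> S z t}"
  have cF: "continuous_on A (\<lambda>(z, t, v). F z t v)"
  proof -
    note [continuous_intros] = continuous_on_compose2[OF holomorphic_on_imp_continuous_on[OF \<zeta>]]
      continuous_on_compose2[OF cm]
    have "continuous_on A (\<lambda>p. (\<lambda>(x, y, m). G x y m)
        (exp (\<zeta> (fst p) + of_real (fst (snd p)) * (of_real (ln c2) - \<zeta> (fst p))), exp (snd (snd p)), m (fst p)))"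
    proof (rule continuous_on_compose2[OF continuous_on_G])
      show "(\<lambda>p. (exp (\<zeta> (fst p) + of_real (fst (snd p)) * (of_real (ln c2) - \<zeta> (fst p))), exp (snd (snd p)), m (fst p))) ` A
         \<subseteq> {(x, y, m). norm x < r \<and> norm y < r \<and> norm m < r}"
      proof clarify
        fix z t v assume "(z, t, v) \<in> A"
        then have h: "z \<in> U" "t \<in> {0..1}" "v \<in> S z t" by (auto simp: A_def)
        then show "norm (exp (\<zeta> (fst (z, t, v)) + of_real (fst (snd (z, t, v))) * (of_real (ln c2) - \<zeta> (fst (z, t, v))))) < r \<and>
          norm (exp (snd (snd (z, t, v)))) < r \<and> norm (m (fst (z, t, v))) < r"
          using in_range[OF dom(1) h(2) SD[OF h(1,3)]] dom(3) by simp
      qed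
    qed (auto simp: A_def intro!: continuous_intros)
    then show ?thesis unfolding F_def field_def split_def
      by (auto simp: A_def intro!: continuous_intros)
  qed
  have slice: "continuous_on {0..1} (\<lambda>t. F z t (u t))"
    if "z \<in> U" "continuous_on {0..1} u" "\<And>t. t \<in> {0..1} \<Longrightarrow> u t \<in> S z t" for z u
  proof -
    have "continuous_on {0..1} (\<lambda>t. (\<lambda>(z, t, v). F z t v) (z, t, u t))"
      by (rule continuous_on_compose2[OF cF]) (use that in \<open>auto simp: A_def intro!: continuous_intros\<close>)
    then show ?thesis by simp
  qed
  have pic: "norm (F z t v) \<le> b * (2 * \<alpha>0)" if "z \<in> U" "t \<in> {0..1}" "v \<in> S z t" for z t v
  proof -
    have "norm (F z t v) \<le> norm (of_real (ln c2) - \<zeta> z) * (2 * \<alpha>0)"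
      unfolding F_def by (rule norm_field_le) (use that SD dom in auto)
    also have "\<dots> \<le> b * (2 * \<alpha>0)" using bd[OF that(1)] \<alpha>0 by (intro mult_right_mono) auto
    finally show ?thesis .
  qed
  obtain u where
      cu: "continuous_on (U \<times> {0..1}) (\<lambda>(z, t). u z t)" and
      hu: "\<And>t. t \<in> {0..1} \<Longrightarrow> (\<lambda>z. u z t) holomorphic_on U" and
      uS: "\<And>z t. z \<in> U \<Longrightarrow> t \<in> {0..1} \<Longrightarrow> u z t \<in> S z t" and
      u0: "\<And>z. z \<in> U \<Longrightarrow> u z 0 = v0 z" and
      ui: "\<And>z t. z \<in> U \<Longrightarrow> t \<in> {0..1} \<Longrightarrow> u z t = v0 z + integral {0..t} (\<lambda>\<tau>. F z \<tau> (u z \<tau>))" and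
      ud: "\<And>z t. z \<in> U \<Longrightarrow> t \<in> {0..1} \<Longrightarrow> (u z has_vector_derivative F z t (u z t)) (at t within {0..1})"
  proof (rule picard_holomorphic[OF U v0, of S F "b * (2 * \<alpha>0)" "b * (2 * \<eta>)"])
    show "v0 z \<in> S z t" for z t by (simp add: S_def)
    show "closed (S z t)" for z t by (simp add: S_def closed_halfspace_Re_le)
    show "norm (F z t v - F z t w) \<le> b * (2 * \<eta>) * norm (v - w)"
      if "z \<in> U" "t \<in> {0..1}" "v \<in> S z t" "w \<in> S z t" for z t v w
    proof -
      have "norm (F z t v - F z t w) \<le> norm (of_real (ln c2) - \<zeta> z) * (2 * \<eta>) * norm (v - w)"
        unfolding F_def by (rule lipschitz_field) (use that SD dom in auto)
      also have "\<dots> \<le> b * (2 * \<eta>) * norm (v - w)"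
        using bd[OF that(1)] \<eta> by (intro mult_right_mono) auto
      finally show ?thesis .
    qed
    show "continuous_on {(z, t, v). z \<in> U \<and> t \<in> {0..1} \<and> v \<in> S z t} (\<lambda>(z, t, v). F z t v)"
      using cF by (simp add: A_def)
    show "(\<lambda>z. F z t (u z)) holomorphic_on U"
      if "t \<in> {0..1}" "u holomorphic_on U" "\<And>z. z \<in> U \<Longrightarrow> u z \<in> S z t" for t u
    proof -
      have "Re (u z) < ln s" if "z \<in> U" for z
        using SD[OF that] \<open>\<And>z. z \<in> U \<Longrightarrow> u z \<in> S z t\<close>[OF that] by blast
      then have "(\<lambda>z. G (exp (\<zeta> z + of_real t * (of_real (ln c2) - \<zeta> z))) (exp (u z)) (m z)) holomorphic_on U"
        by (intro holomorphic_G U m holomorphic_intros \<zeta> that(2))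
           (use in_range[OF dom(1) that(1)] dom(3) in auto)
      then show ?thesis unfolding F_def field_def by (intro holomorphic_intros \<zeta>)
    qed
    show "v0 z + integral {0..t} (\<lambda>\<tau>. F z \<tau> (u \<tau>)) \<in> S z t"
      if z: "z \<in> U" and u: "continuous_on {0..1} u" "\<And>t. t \<in> {0..1} \<Longrightarrow> u t \<in> S z t" and t: "t \<in> {0..1}" for z u t
    proof -
      have "continuous_on {0..t} (\<lambda>\<tau>. F z \<tau> (u \<tau>))"
        by (rule continuous_on_subset[OF slice[OF z u]]) (use t in auto)
      then have I: "((\<lambda>\<tau>. F z \<tau> (u \<tau>)) has_integral integral {0..t} (\<lambda>\<tau>. F z \<tau> (u \<tau>))) {0..t}"
        by (intro integrable_integral integrable_continuous_real)
      have "Re (integral {0..t} (\<lambda>\<tau>. F z \<tau> (u \<tau>))) \<le> 0"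
      proof (rule has_integral_le[OF has_integral_Re[OF I] has_integral_0])
        fix \<tau> assume \<tau>: "\<tau> \<in> {0..t}"
        show "Re (F z \<tau> (u \<tau>)) \<le> 0"
          unfolding F_def by (rule Re_field_nonpos) (use z t \<tau> u SD[OF z u(2)] dom in auto)
      qed
      then show ?thesis by (simp add: S_def)
    qed
  qed (use pic in auto)
  show ?thesis
  proof (rule that[of u])
    show "is_sol (\<zeta> z) (v0 z) (m z) (u z)" if "z \<in> U" for z
      using u0 ud SD[OF _ uS] that by (auto simp: is_sol_def F_def)
    show "(\<lambda>z. u z 1) holomorphic_on U" by (rule hu) auto
    show "Re (u z t) \<le> Re (v0 z)" if "z \<in> U" "t \<in> {0..1}" for z t using uS[OF that] by (simp add: S_def)
    fix z assume z: "z \<in> U"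
    have su: "continuous_on {0..1} (\<lambda>t. F z t (u z t))"
    proof (rule slice[OF z _ uS[OF z]])
      show "continuous_on {0..1} (u z)"
        using ud[OF z] has_vector_derivative_continuous continuous_on_eq_continuous_within by blast
    qed
    define k where "k = of_real \<alpha>0 * (of_real (ln c2) - \<zeta> z)"
    have "integral {0..1} (\<lambda>t. F z t (u z t) + k) = integral {0..1} (\<lambda>t. F z t (u z t)) + k"
      using integrable_continuous_real[OF su] by (subst integral_add) auto
    then have "u z 1 - v0 z + k = integral {0..1} (\<lambda>t. F z t (u z t) + k)"
      using ui[OF z, of 1] by simp
    also have "norm \<dots> \<le> \<eta> * norm (of_real (ln c2) - \<zeta> z) * (1 - 0)"
    proof (rule integral_bound)
      show "continuous_on {0..1} (\<lambda>t. F z t (u z t) + k)" using su by (intro continuous_intros)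
      show "norm (F z t (u z t) + k) \<le> \<eta> * norm (of_real (ln c2) - \<zeta> z)" if "t \<in> {0..1}" for t
        unfolding F_def k_def by (rule norm_field_near) (use z that SD[OF z uS] dom in auto)
    qed auto
    finally show "norm (u z 1 - v0 z + of_real \<alpha>0 * (of_real (ln c2) - \<zeta> z)) \<le> \<eta> * norm (of_real (ln c2) - \<zeta> z)"
      by (simp add: k_def)
  qed
qed

end

section \<open>The leaf value as a first integral\<close>

text \<open>
  A function controlled by the distance of two pairs of curves that are tangent to one another has
  derivative zero. It makes it possible to differentiate a merely Lipschitz function of two variables along a curve, by
  replacing the curve by its tangent line.
\<close>

lemma has_vector_derivative_zero_of_lipschitz:
  fixes e :: "real \<Rightarrow> 'a::real_normed_vector"
    and p1 q1 :: "real \<Rightarrow> 'b::real_normed_vector" and p2 q2 :: "real \<Rightarrow> 'c::real_normed_vector"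
  assumes d1: "(p1 has_vector_derivative d1) (at x within S)" "(q1 has_vector_derivative d1) (at x within S)"
    and d2: "(p2 has_vector_derivative d2) (at x within S)" "(q2 has_vector_derivative d2) (at x within S)"
    and x: "p1 x = q1 x" "p2 x = q2 x" "e x = 0"
    and le: "\<forall>\<^sub>F y in at x within S. norm (e y) \<le> C * (norm (p1 y - q1 y) + norm (p2 y - q2 y))"
  shows "(e has_vector_derivative 0) (at x within S)"
proof -
  have "((\<lambda>y. p1 y - q1 y) has_vector_derivative 0) (at x within S)"
    using has_vector_derivative_diff[OF d1] by simp
  then have l1: "((\<lambda>y. norm (p1 y - q1 y) / norm (y - x)) \<longlongrightarrow> 0) (at x within S)"
    using x unfolding has_vector_derivative_def has_derivative_iff_norm by simp
  have "((\<lambda>y. p2 y - q2 y) has_vector_derivative 0) (at x within S)"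
    using has_vector_derivative_diff[OF d2] by simp
  then have l2: "((\<lambda>y. norm (p2 y - q2 y) / norm (y - x)) \<longlongrightarrow> 0) (at x within S)"
    using x unfolding has_vector_derivative_def has_derivative_iff_norm by simp
  have "((\<lambda>y. C * (norm (p1 y - q1 y) / norm (y - x) + norm (p2 y - q2 y) / norm (y - x))) \<longlongrightarrow> C * (0 + 0)) (at x within S)"
    by (rule tendsto_mult_left[OF tendsto_add[OF l1 l2]])
  then have lim: "((\<lambda>y. C * (norm (p1 y - q1 y) / norm (y - x) + norm (p2 y - q2 y) / norm (y - x))) \<longlongrightarrow> 0) (at x within S)"
    by simp
  have "((\<lambda>y. norm (e y) / norm (y - x)) \<longlongrightarrow> 0) (at x within S)"
  proof (rule Lim_null_comparison[OF _ lim])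
    show "\<forall>\<^sub>F y in at x within S. norm (norm (e y) / norm (y - x)) \<le> C * (norm (p1 y - q1 y) / norm (y - x) + norm (p2 y - q2 y) / norm (y - x))"
      using le
    proof eventually_elim
      case (elim y)
      then have "norm (e y) / norm (y - x) \<le> C * (norm (p1 y - q1 y) + norm (p2 y - q2 y)) / norm (y - x)"
        by (intro divide_right_mono) auto
      then show ?case by (simp add: add_divide_distrib distrib_left)
    qed
  qed
  then show ?thesis
    using x unfolding has_vector_derivative_def has_derivative_iff_norm by simp
qed

context saddle_sections
begin

definition sol :: "complex \<Rightarrow> complex \<Rightarrow> complex^'a \<Rightarrow> real \<Rightarrow> complex" where
  "sol \<zeta> v0 m = (SOME u. is_sol \<zeta> v0 m u)"

text \<open>
  The logarithm of the \<open>y\<close>-coordinate at which the leaf through \<open>(e\<^sup>\<zeta>, e\<^sup>v\<^sup>0)\<close> meets \<open>\<tau>\<close>, when it is followed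
  over the segment from \<open>\<zeta>\<close> to \<open>ln c2\<close>.
\<close>

definition E :: "complex \<Rightarrow> complex \<Rightarrow> complex^'a \<Rightarrow> complex" where
  "E \<zeta> v0 m = sol \<zeta> v0 m 1"

lemma sol_exists:
  assumes "\<zeta> \<in> cone 1" "Re v0 < ln s" "norm m < r"
  obtains u where "is_sol \<zeta> v0 m u" "\<And>t. t \<in> {0..1} \<Longrightarrow> Re (u t) \<le> Re v0"
    "norm (u 1 - v0 + of_real \<alpha>0 * (of_real (ln c2) - \<zeta>)) \<le> \<eta> * norm (of_real (ln c2) - \<zeta>)"
proof -
  obtain u where "\<And>z::complex. z \<in> UNIV \<Longrightarrow> is_sol \<zeta> v0 m (u z)"
    "\<And>z t. z \<in> UNIV \<Longrightarrow> t \<in> {0..1} \<Longrightarrow> Re (u z t) \<le> Re v0"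
    "\<And>z. z \<in> UNIV \<Longrightarrow> norm (u z 1 - v0 + of_real \<alpha>0 * (of_real (ln c2) - \<zeta>)) \<le> \<eta> * norm (of_real (ln c2) - \<zeta>)"
    by (rule solutions_along_curve[of UNIV "\<lambda>_. \<zeta>" "\<lambda>_. v0" "\<lambda>_. m" "norm (of_real (ln c2) - \<zeta>)"])
       (use assms in auto)
  then show ?thesis using that[of "u 0"] by auto
qed

lemma is_sol_sol:
  assumes "\<zeta> \<in> cone 1" "Re v0 < ln s" "norm m < r"
  shows "is_sol \<zeta> v0 m (sol \<zeta> v0 m)"
proof -
  obtain u where "is_sol \<zeta> v0 m u" by (rule sol_exists[OF assms]) (rule that)
  then show ?thesis unfolding sol_def by (rule someI[of "is_sol \<zeta> v0 m"])
qed

lemma sol_eq: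
  assumes "\<zeta> \<in> cone 1" "norm m < r" "is_sol \<zeta> v0 m u" "t \<in> {0..1}"
  shows "sol \<zeta> v0 m t = u t"
proof (rule is_sol_unique[OF assms(1,2) _ assms(3,4)])
  show "is_sol \<zeta> v0 m (sol \<zeta> v0 m)"
    unfolding sol_def using assms(3) by (rule someI[of "is_sol \<zeta> v0 m"])
qed

lemma E_eq:
  assumes "\<zeta> \<in> cone 1" "norm m < r" "is_sol \<zeta> v0 m u"
  shows "E \<zeta> v0 m = u 1"
  unfolding E_def by (rule sol_eq[OF assms]) auto

lemma Re_sol_le:
  assumes "\<zeta> \<in> cone 1" "Re v0 < ln s" "norm m < r" "t \<in> {0..1}"
  shows "Re (sol \<zeta> v0 m t) \<le> Re v0"
proof -
  obtain u where u: "is_sol \<zeta> v0 m u" "\<And>t. t \<in> {0..1} \<Longrightarrow> Re (u t) \<le> Re v0"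
    by (rule sol_exists[OF assms(1-3)]) (rule that)
  then show ?thesis using sol_eq[OF assms(1,3) u(1) assms(4)] assms(4) by simp
qed

lemma E_near:
  assumes "\<zeta> \<in> cone 1" "Re v0 < ln s" "norm m < r"
  shows "norm (E \<zeta> v0 m - v0 + of_real \<alpha>0 * (of_real (ln c2) - \<zeta>)) \<le> \<eta> * norm (of_real (ln c2) - \<zeta>)"
proof -
  obtain u where u: "is_sol \<zeta> v0 m u"
    "norm (u 1 - v0 + of_real \<alpha>0 * (of_real (ln c2) - \<zeta>)) \<le> \<eta> * norm (of_real (ln c2) - \<zeta>)"
    by (rule sol_exists[OF assms]) (rule that)
  then show ?thesis using E_eq[OF assms(1,3) u(1)] by simp
qed

text \<open>
  The bound on \<open>\<zeta>\<close> that \<open>solutions_along_curve\<close> needs holds near each point of \<open>U\<close>; uniqueness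
  identifies the local solutions with \<open>sol\<close>.
\<close>

lemma holomorphic_E:
  fixes m :: "complex \<Rightarrow> complex^'a"
  assumes U: "open U" and \<zeta>: "\<zeta> holomorphic_on U" and v0: "v0 holomorphic_on U"
    and m: "\<And>i. (\<lambda>z. m z $ i) holomorphic_on U"
    and dom: "\<And>z. z \<in> U \<Longrightarrow> \<zeta> z \<in> cone 1" "\<And>z. z \<in> U \<Longrightarrow> Re (v0 z) < ln s" "\<And>z. z \<in> U \<Longrightarrow> norm (m z) < r"
  shows "(\<lambda>z. E (\<zeta> z) (v0 z) (m z)) holomorphic_on U"
proof -
  have "(\<lambda>z. E (\<zeta> z) (v0 z) (m z)) field_differentiable (at z0)" if z0: "z0 \<in> U" for z0
  proof -
    obtain d where d: "d > 0" "cball z0 d \<subseteq> U" using U z0 open_contains_cball by blast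
    have "continuous_on (cball z0 d) (\<lambda>z. of_real (ln c2) - \<zeta> z)"
      using holomorphic_on_imp_continuous_on[OF \<zeta>] d by (intro continuous_intros) (rule continuous_on_subset)
    then have "bounded ((\<lambda>z. of_real (ln c2) - \<zeta> z) ` cball z0 d)"
      by (intro compact_imp_bounded compact_continuous_image) auto
    then obtain b where b: "\<And>z. z \<in> cball z0 d \<Longrightarrow> norm (of_real (ln c2) - \<zeta> z) \<le> b"
      unfolding bounded_iff by blast
    have B: "ball z0 d \<subseteq> U" "ball z0 d \<subseteq> cball z0 d" using d by auto
    obtain u where u: "\<And>z. z \<in> ball z0 d \<Longrightarrow> is_sol (\<zeta> z) (v0 z) (m z) (u z)"
      "(\<lambda>z. u z 1) holomorphic_on ball z0 d"
      by (rule solutions_along_curve[of "ball z0 d" \<zeta> v0 m b])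
         (use B dom b holomorphic_on_subset[OF \<zeta> B(1)] holomorphic_on_subset[OF v0 B(1)]
           holomorphic_on_subset[OF m B(1)] in auto)
    have "(\<lambda>z. E (\<zeta> z) (v0 z) (m z)) holomorphic_on ball z0 d"
      using u(2) by (rule holomorphic_transform) (use E_eq[OF dom(1,3) u(1)] B in auto)
    then show ?thesis using d by (auto intro: holomorphic_on_imp_differentiable_at)
  qed
  then show ?thesis by (auto simp: holomorphic_on_def intro: field_differentiable_at_within)
qed

lemma is_sol_cnj:
  fixes \<mu> :: "real^'a"
  assumes "\<zeta> \<in> cone 1" "norm \<mu> < r" and u: "is_sol \<zeta> v0 (complex_vec \<mu>) u"
  shows "is_sol (cnj \<zeta>) (cnj v0) (complex_vec \<mu>) (\<lambda>t. cnj (u t))"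
  unfolding is_sol_def
proof (intro conjI ballI)
  show "cnj (u 0) = cnj v0" using u by (simp add: is_sol_def)
  fix t :: real assume t: "t \<in> {0..1}"
  then have ut: "Re (u t) < ln s" "(u has_vector_derivative field \<zeta> (complex_vec \<mu>) t (u t)) (at t within {0..1})"
    using u by (auto simp: is_sol_def)
  then show "Re (cnj (u t)) < ln s" by simp
  have "field (cnj \<zeta>) (complex_vec \<mu>) t (cnj (u t)) = cnj (field \<zeta> (complex_vec \<mu>) t (u t))"
    using cnj_G[OF in_range[OF assms(1) t ut(1)] assms(2)] by (simp add: field_def exp_cnj)
  then show "((\<lambda>t. cnj (u t)) has_vector_derivative field (cnj \<zeta>) (complex_vec \<mu>) t (cnj (u t))) (at t within {0..1})"
    using has_vector_derivative_cnj[OF ut(2)] by simp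
qed

lemma norm_complex_vec_eq: "norm (complex_vec \<mu>) = norm (\<mu> :: real^'b)"
  by (simp add: complex_vec_def norm_vec_def L2_set_def)

lemma E_cnj:
  fixes \<mu> :: "real^'a"
  assumes "\<zeta> \<in> cone 1" "Re v0 < ln s" "norm \<mu> < r"
  shows "E (cnj \<zeta>) (cnj v0) (complex_vec \<mu>) = cnj (E \<zeta> v0 (complex_vec \<mu>))"
proof -
  have n: "norm (complex_vec \<mu>) < r" using assms by (simp add: norm_complex_vec_eq)
  have u: "is_sol \<zeta> v0 (complex_vec \<mu>) (sol \<zeta> v0 (complex_vec \<mu>))" by (rule is_sol_sol[OF assms(1,2) n])
  have "cnj \<zeta> \<in> cone 1" using assms(1) by simp
  from E_eq[OF this n is_sol_cnj[OF assms(1,3) u]] show ?thesis by (simp add: E_def)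
qed

text \<open>
  For real data the conjugate of the solution is a solution with the same initial value.
\<close>

lemma sol_real:
  fixes \<mu> :: "real^'a"
  assumes "of_real x \<in> cone 1" "y < ln s" "norm \<mu> < r" "t \<in> {0..1}"
  shows "Im (sol (of_real x) (of_real y) (complex_vec \<mu>) t) = 0"
proof -
  have n: "norm (complex_vec \<mu>) < r" using assms by (simp add: norm_complex_vec_eq)
  have u: "is_sol (of_real x) (of_real y) (complex_vec \<mu>) (sol (of_real x) (of_real y) (complex_vec \<mu>))"
    by (rule is_sol_sol) (use assms n in auto)
  have "is_sol (of_real x) (of_real y) (complex_vec \<mu>) (\<lambda>t. cnj (sol (of_real x) (of_real y) (complex_vec \<mu>) t))"
    using is_sol_cnj[OF assms(1,3) u] by simp
  from is_sol_unique[OF assms(1) n this u assms(4)] show ?thesis by (simp add: complex_eq_iff)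
qed

text \<open>
  The equation depends on \<open>v\<close> only through \<open>e\<^sup>v\<close>.
\<close>

lemma E_shift:
  assumes "\<zeta> \<in> cone 1" "Re v0 < ln s" "norm m < r"
  shows "E \<zeta> (v0 + 2 * of_real pi * \<i>) m = E \<zeta> v0 m + 2 * of_real pi * \<i>"
proof -
  have u: "is_sol \<zeta> v0 m (sol \<zeta> v0 m)" by (rule is_sol_sol[OF assms])
  have "exp (v + 2 * of_real pi * \<i>) = exp v" for v using exp_plus_2pin[of v 1] by (simp add: mult_ac)
  then have "is_sol \<zeta> (v0 + 2 * of_real pi * \<i>) m (\<lambda>t. sol \<zeta> v0 m t + 2 * of_real pi * \<i>)"
    using u unfolding is_sol_def by (auto simp: field_def intro!: derivative_eq_intros)
  from E_eq[OF assms(1,3) this] show ?thesis by (simp add: E_def)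
qed

text \<open>
  The remaining part of the segment from \<open>\<zeta>\<close> to \<open>ln c2\<close> is the segment belonging to the intermediate
  point, so the solution started there is the rest of the original one, reparametrised.
\<close>

lemma E_along_sol:
  assumes "\<zeta> \<in> cone 1" "Re v0 < ln s" "norm m < r" and t: "0 \<le> t" "t < 1"
  shows "\<zeta> + of_real t * (of_real (ln c2) - \<zeta>) \<in> cone 1"
    and "E (\<zeta> + of_real t * (of_real (ln c2) - \<zeta>)) (sol \<zeta> v0 m t) m = E \<zeta> v0 m"
proof -
  define \<xi> where "\<xi> = \<zeta> + of_real t * (of_real (ln c2) - \<zeta>)"
  have "(1 - t) * \<bar>Im \<zeta>\<bar> < (1 - t) * (ln c2 - Re \<zeta>)"
    using cone1D[OF assms(1)] t by (intro mult_strict_left_mono) auto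
  moreover have "Im \<xi> = (1 - t) * Im \<zeta>" by (simp add: \<xi>_def algebra_simps)
  moreover have "ln c2 - Re \<xi> = (1 - t) * (ln c2 - Re \<zeta>)" by (simp add: \<xi>_def algebra_simps)
  ultimately show cone: "\<xi> \<in> cone 1" using t by (simp add: cone_def abs_mult)
  define u where "u = sol \<zeta> v0 m"
  have u: "is_sol \<zeta> v0 m u" unfolding u_def by (rule is_sol_sol[OF assms(1-3)])
  define g where "g = (\<lambda>\<tau>::real. t + (1 - t) * \<tau>)"
  have g: "g \<tau> \<in> {0..1}" if "\<tau> \<in> {0..1}" for \<tau>
  proof -
    have "(1 - t) * \<tau> \<le> 1 - t" "0 \<le> (1 - t) * \<tau>" using that t by (auto simp: mult_left_le)
    then show ?thesis using t unfolding g_def atLeastAtMost_iff by linarith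
  qed
  have "is_sol \<xi> (u t) m (u \<circ> g)"
    unfolding is_sol_def
  proof (intro conjI ballI)
    fix \<tau> :: real assume \<tau>: "\<tau> \<in> {0..1}"
    show "Re ((u \<circ> g) \<tau>) < ln s" using u g[OF \<tau>] by (simp add: is_sol_def)
    have "(u has_vector_derivative field \<zeta> m (g \<tau>) (u (g \<tau>))) (at (g \<tau>) within g ` {0..1})"
      by (rule has_vector_derivative_within_subset[of _ _ _ "{0..1}"]) (use u g \<tau> in \<open>auto simp: is_sol_def\<close>)
    moreover have "(g has_vector_derivative (1 - t)) (at \<tau> within {0..1})"
      unfolding g_def by (auto intro!: derivative_eq_intros simp: has_real_derivative_iff_has_vector_derivative[symmetric])
    ultimately have "((u \<circ> g) has_vector_derivative (1 - t) *\<^sub>R field \<zeta> m (g \<tau>) (u (g \<tau>))) (at \<tau> within {0..1})"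
      by (intro vector_diff_chain_within)
    moreover have "(1 - t) *\<^sub>R field \<zeta> m (g \<tau>) (u (g \<tau>)) = field \<xi> m \<tau> ((u \<circ> g) \<tau>)"
    proof -
      have A: "\<zeta> + of_real (g \<tau>) * (of_real (ln c2) - \<zeta>) = \<xi> + of_real \<tau> * (of_real (ln c2) - \<xi>)"
        by (simp add: \<xi>_def g_def algebra_simps)
      have B: "of_real (ln c2) - \<xi> = of_real (1 - t) * (of_real (ln c2) - \<zeta>)"
        by (simp add: \<xi>_def algebra_simps)
      show ?thesis unfolding field_def scaleR_conv_of_real A
        by (simp only: B mult.assoc mult_minus_left mult_minus_right o_def)
    qed
    ultimately show "((u \<circ> g) has_vector_derivative field \<xi> m \<tau> ((u \<circ> g) \<tau>)) (at \<tau> within {0..1})" by simp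
  qed (simp add: g_def)
  from E_eq[OF cone assms(3) this] show "E \<xi> (sol \<zeta> v0 m t) m = E \<zeta> v0 m"
    by (simp add: g_def E_def u_def)
qed

text \<open>
  Joint Lipschitz continuity from separate holomorphy and a common bound.
\<close>

lemma E_locally_lipschitz:
  assumes "\<zeta>0 \<in> cone 1" "Re v0 < ln s" "norm m < r"
  obtains R C where "0 < R" "ball \<zeta>0 R \<subseteq> cone 1" "\<And>v. v \<in> ball v0 R \<Longrightarrow> Re v < ln s"
    "\<And>\<zeta> \<zeta>' v v'. \<zeta> \<in> ball \<zeta>0 R \<Longrightarrow> \<zeta>' \<in> ball \<zeta>0 R \<Longrightarrow> v \<in> ball v0 R \<Longrightarrow> v' \<in> ball v0 R \<Longrightarrow>
      norm (E \<zeta> v m - E \<zeta>' v' m) \<le> C * (norm (\<zeta> - \<zeta>') + norm (v - v'))"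
proof -
  obtain R1 where R1: "R1 > 0" "ball \<zeta>0 R1 \<subseteq> cone 1" using assms(1) open_cone open_contains_ball by blast
  obtain R2 where R2: "R2 > 0" "ball v0 R2 \<subseteq> {v. Re v < ln s}"
    using assms(2) open_halfspace_Re_lt[of "ln s"] open_contains_ball by (metis mem_Collect_eq)
  define R where "R = min R1 R2"
  have R: "R > 0" "ball \<zeta>0 R \<subseteq> cone 1" "ball v0 R \<subseteq> {v. Re v < ln s}"
    using R1 R2 by (auto simp: R_def)
  define M where "M = norm v0 + R + (\<alpha>0 + \<eta>) * (norm (of_real (ln c2) - \<zeta>0) + R)"
  have bd: "norm (E \<zeta> v m) \<le> M" if h: "\<zeta> \<in> ball \<zeta>0 R" "v \<in> ball v0 R" for \<zeta> v
  proof -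
    define D where "D = of_real (ln c2) - \<zeta>"
    have "norm (E \<zeta> v m) \<le> norm (E \<zeta> v m - v + of_real \<alpha>0 * D) + norm v + norm (of_real \<alpha>0 * D)"
      using norm_triangle_ineq4[of "E \<zeta> v m - v + of_real \<alpha>0 * D" "of_real \<alpha>0 * D - v"]
        norm_triangle_ineq4[of "of_real \<alpha>0 * D" v] by simp
    also have "\<dots> \<le> \<eta> * norm D + norm v + \<alpha>0 * norm D"
    proof -
      have "\<zeta> \<in> cone 1" "Re v < ln s" using h R by auto
      then show ?thesis using E_near[of \<zeta> v m] assms(3) \<alpha>0 by (simp add: D_def norm_mult)
    qed
    also have "\<dots> = norm v + (\<alpha>0 + \<eta>) * norm D" by (simp add: algebra_simps)
    also have "norm v \<le> norm v0 + R" using h(2) norm_triangle_sub[of v v0] by (simp add: dist_norm norm_minus_commute)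
    also have "norm D \<le> norm (of_real (ln c2) - \<zeta>0) + R"
      using h(1) norm_triangle_ineq[of "of_real (ln c2) - \<zeta>0" "\<zeta>0 - \<zeta>"] by (simp add: D_def dist_norm)
    finally show ?thesis using \<alpha>0 \<eta> by (simp add: M_def mult_left_mono)
  qed
  show ?thesis
  proof (rule that[of "R/2" "4 * M / R"])
    fix \<zeta> \<zeta>' v v' assume h: "\<zeta> \<in> ball \<zeta>0 (R/2)" "\<zeta>' \<in> ball \<zeta>0 (R/2)" "v \<in> ball v0 (R/2)" "v' \<in> ball v0 (R/2)"
    then have h': "\<zeta> \<in> ball \<zeta>0 R" "\<zeta>' \<in> ball \<zeta>0 R" "v \<in> ball v0 R" "v' \<in> ball v0 R"
      using R(1) by auto
    have h1: "(\<lambda>\<zeta>. E \<zeta> v m) holomorphic_on ball \<zeta>0 R"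
      by (rule holomorphic_E) (use h' R assms in auto)
    have h2: "(\<lambda>v. E \<zeta>' v m) holomorphic_on ball v0 R"
      by (rule holomorphic_E) (use h' R assms in auto)
    have l1: "norm (E \<zeta> v m - E \<zeta>' v m) \<le> 4 * M / R * norm (\<zeta> - \<zeta>')"
      by (rule holomorphic_bounded_imp_lipschitz[OF h1 R(1) bd]) (use h h' in auto)
    have l2: "norm (E \<zeta>' v m - E \<zeta>' v' m) \<le> 4 * M / R * norm (v - v')"
      by (rule holomorphic_bounded_imp_lipschitz[OF h2 R(1) bd]) (use h h' in auto)
    show "norm (E \<zeta> v m - E \<zeta>' v' m) \<le> 4 * M / R * (norm (\<zeta> - \<zeta>') + norm (v - v'))"
      using norm_triangle_ineq[of "E \<zeta> v m - E \<zeta>' v m" "E \<zeta>' v m - E \<zeta>' v' m"] l1 l2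
      by (simp add: distrib_left)
  next
    fix v assume "v \<in> ball v0 (R/2)"
    then have "v \<in> ball v0 R" using R(1) by auto
    then show "Re v < ln s" using R(3) by auto
  qed (use R in auto)
qed

text \<open>
  By \<open>E_along_sol\<close>, \<open>E\<close> is constant along the solution curve in the direction of \<open>ln c2\<close>. Replacing that curve
  by its tangent changes \<open>E\<close> to second order only, so the derivative along real multiples of the tangent vanishes.
  A holomorphic function of one variable with zero derivative in a real direction has complex
  derivative zero; thus \<open>E\<close> is stationary in every complex direction tangent to the leaf.
\<close>

lemma E_along_tangent:
  assumes "\<zeta>0 \<in> cone 1" "Re v0 < ln s" "norm m < r"
  defines "\<Delta> \<equiv> of_real (ln c2) - \<zeta>0"
  shows "((\<lambda>z. E (\<zeta>0 + z * \<Delta>) (v0 + z * field \<zeta>0 m 0 v0) m) has_field_derivative 0) (at 0)"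
proof -
  obtain R C where R: "0 < R" "ball \<zeta>0 R \<subseteq> cone 1" "\<And>v. v \<in> ball v0 R \<Longrightarrow> Re v < ln s"
    and C: "\<And>\<zeta> \<zeta>' v v'. \<zeta> \<in> ball \<zeta>0 R \<Longrightarrow> \<zeta>' \<in> ball \<zeta>0 R \<Longrightarrow> v \<in> ball v0 R \<Longrightarrow> v' \<in> ball v0 R \<Longrightarrow>
      norm (E \<zeta> v m - E \<zeta>' v' m) \<le> C * (norm (\<zeta> - \<zeta>') + norm (v - v'))"
    by (rule E_locally_lipschitz[OF assms(1-3)]) (rule that)
  define k where "k = field \<zeta>0 m 0 v0"
  define f where "f = (\<lambda>z. E (\<zeta>0 + z * \<Delta>) (v0 + z * k) m)"
  define d where "d = R / (norm \<Delta> + norm k + 1)"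
  have d: "d > 0" using R by (simp add: d_def add_nonneg_pos)
  have small: "norm (z * \<Delta>) < R" "norm (z * k) < R" if "norm z < d" for z
  proof -
    have "norm z * (norm \<Delta> + norm k + 1) < R"
      using that pos_less_divide_eq[of "norm \<Delta> + norm k + 1" "norm z" R] by (simp add: d_def add_nonneg_pos)
    moreover have "norm z * norm \<Delta> \<le> norm z * (norm \<Delta> + norm k + 1)" "norm z * norm k \<le> norm z * (norm \<Delta> + norm k + 1)"
      by (intro mult_left_mono; simp)+
    ultimately show "norm (z * \<Delta>) < R" "norm (z * k) < R" by (auto simp: norm_mult)
  qed
  have dom: "\<zeta>0 + z * \<Delta> \<in> ball \<zeta>0 R" "v0 + z * k \<in> ball v0 R" if "norm z < d" for z
    using small[OF that] by (auto simp: dist_norm)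
  have "f holomorphic_on ball 0 d"
    unfolding f_def by (rule holomorphic_E) (use dom R(2) R(3)[OF dom(2)] assms in \<open>auto intro!: holomorphic_intros\<close>)
  then obtain f' where f': "(f has_field_derivative f') (at 0)"
    using d holomorphic_derivI[OF _ open_ball, of f 0 d 0] by auto
  define u where "u = sol \<zeta>0 v0 m"
  have "is_sol \<zeta>0 v0 m u" unfolding u_def by (rule is_sol_sol[OF assms(1-3)])
  then have u: "u 0 = v0" and "\<forall>t\<in>{0..1}. (u has_vector_derivative field \<zeta>0 m t (u t)) (at t within {0..1})"
    unfolding is_sol_def by auto
  from this(2)[THEN bspec, of 0] have u': "(u has_vector_derivative k) (at 0 within {0..1})"
    by (simp add: k_def u)
  have lin: "((\<lambda>t. c + of_real t * e) has_vector_derivative e) (at 0 within {0..1})" for c e :: complex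
    by (auto intro!: derivative_eq_intros)
  define e where "e = (\<lambda>t::real. f (of_real t) - E \<zeta>0 v0 m)"
  have "(e has_vector_derivative 0) (at 0 within {0..1})"
  proof (rule has_vector_derivative_zero_of_lipschitz)
    show "((\<lambda>t. \<zeta>0 + of_real t * \<Delta>) has_vector_derivative \<Delta>) (at 0 within {0..1})" by (rule lin)
    show "((\<lambda>t. \<zeta>0 + of_real t * \<Delta>) has_vector_derivative \<Delta>) (at 0 within {0..1})" by (rule lin)
    show "((\<lambda>t. v0 + of_real t * k) has_vector_derivative k) (at 0 within {0..1})" by (rule lin)
    show "(u has_vector_derivative k) (at 0 within {0..1})" by (rule u')
    show "e 0 = 0" by (simp add: e_def f_def)
    have "(u \<longlongrightarrow> v0) (at 0 within {0..1})"
      using has_vector_derivative_continuous[OF u'] u by (simp add: continuous_within)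
    then have "\<forall>\<^sub>F t in at 0 within {0..1}. dist (u t) v0 < R" using R(1) by (rule tendstoD)
    moreover have "\<forall>\<^sub>F t in at 0 within {0..1}. t \<in> {0..1} \<and> dist t 0 < min d 1"
      unfolding eventually_at using d by (intro exI[of _ "min d 1"]) auto
    ultimately show "\<forall>\<^sub>F t in at 0 within {0..1}. norm (e t) \<le> C * (norm (\<zeta>0 + of_real t * \<Delta> - (\<zeta>0 + of_real t * \<Delta>)) + norm (v0 + of_real t * k - u t))"
    proof eventually_elim
      case (elim t)
      then have t: "0 \<le> t" "t < 1" "norm (complex_of_real t) < d" by auto
      have "e t = f (of_real t) - E (\<zeta>0 + of_real t * \<Delta>) (u t) m"
        using E_along_sol(2)[OF assms(1-3) t(1,2)] by (simp add: e_def u_def \<Delta>_def)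
      then show ?case unfolding f_def
        using C[OF dom(1)[OF t(3)] dom(1)[OF t(3)] dom(2)[OF t(3)], of "u t"] elim by (simp add: dist_commute)
    qed
  qed (use u in auto)
  then have "((\<lambda>t::real. f (of_real t)) has_vector_derivative 0) (at 0 within {0..1})"
    unfolding e_def using has_vector_derivative_add_const[of "\<lambda>t. f (of_real t)" "- E \<zeta>0 v0 m"] by simp
  moreover have "((\<lambda>t::real. f (of_real t)) has_vector_derivative f') (at 0 within {0..1})"
    by (rule has_vector_derivative_real_field) (use f' in simp)
  ultimately have "f' = 0"
    using vector_derivative_within_closed_interval[of 0 1 0 "\<lambda>t::real. f (of_real t)"] by auto
  then show ?thesis using f' unfolding f_def k_def by simp
qed

text \<open>
  At each time the velocity of a path in a leaf is a complex multiple \<open>c\<close> of the tangent vector of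
  \<open>E_along_tangent\<close>, so \<open>E\<close> has derivative zero along the path.
\<close>

lemma E_constant_on_leaf:
  fixes w v w' :: "real \<Rightarrow> complex"
  assumes m: "norm m < r"
    and dom: "\<And>t. t \<in> {0..1} \<Longrightarrow> w t \<in> cone 1" "\<And>t. t \<in> {0..1} \<Longrightarrow> Re (v t) < ln s"
    and w: "\<And>t. t \<in> {0..1} \<Longrightarrow> (w has_vector_derivative w' t) (at t within {0..1})"
    and v: "\<And>t. t \<in> {0..1} \<Longrightarrow> (v has_vector_derivative - G (exp (w t)) (exp (v t)) m * w' t) (at t within {0..1})"
  shows "E (w 1) (v 1) m = E (w 0) (v 0) m"
proof -
  have "((\<lambda>t. E (w t) (v t) m) has_vector_derivative 0) (at x within {0..1})" if x: "x \<in> {0..1}" for x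
  proof -
    obtain R C where R: "0 < R" "ball (w x) R \<subseteq> cone 1" "\<And>y. y \<in> ball (v x) R \<Longrightarrow> Re y < ln s"
      and C: "\<And>\<zeta> \<zeta>' y y'. \<zeta> \<in> ball (w x) R \<Longrightarrow> \<zeta>' \<in> ball (w x) R \<Longrightarrow> y \<in> ball (v x) R \<Longrightarrow> y' \<in> ball (v x) R \<Longrightarrow>
        norm (E \<zeta> y m - E \<zeta>' y' m) \<le> C * (norm (\<zeta> - \<zeta>') + norm (y - y'))"
      by (rule E_locally_lipschitz[OF dom[OF x] m]) (rule that)
    define \<Delta> where "\<Delta> = of_real (ln c2) - w x"
    have \<Delta>0: "\<Delta> \<noteq> 0" using cone1D(1)[OF dom(1)[OF x]] by (auto simp: \<Delta>_def complex_eq_iff)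
    define k where "k = field (w x) m 0 (v x)"
    have k: "k = - G (exp (w x)) (exp (v x)) m * \<Delta>" by (simp add: k_def field_def \<Delta>_def algebra_simps)
    define c where "c = w' x / \<Delta>"
    define f where "f = (\<lambda>z. E (w x + z * \<Delta>) (v x + z * k) m)"
    have f': "(f has_field_derivative 0) (at 0)"
      unfolding f_def k_def \<Delta>_def by (rule E_along_tangent[OF dom[OF x] m])
    define g where "g = (\<lambda>t::real. f (c * of_real (t - x)))"
    have "(g has_vector_derivative c * 0) (at x within {0..1})"
    proof -
      have "((\<lambda>t. c * of_real (t - x)) has_vector_derivative c) (at x within {0..1})"
        by (auto intro!: derivative_eq_intros)
      moreover have "(f has_field_derivative 0) (at (c * of_real (x - x)) within (\<lambda>t. c * of_real (t - x)) ` {0..1})"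
        using f' has_field_derivative_at_within by simp
      ultimately show ?thesis
        unfolding g_def using field_vector_diff_chain_within[of "\<lambda>t. c * of_real (t - x)" c x "{0..1}" f 0] by (simp add: o_def)
    qed
    moreover have "((\<lambda>t. E (w t) (v t) m - g t) has_vector_derivative 0) (at x within {0..1})"
    proof (rule has_vector_derivative_zero_of_lipschitz)
      show "(w has_vector_derivative w' x) (at x within {0..1})" by (rule w[OF x])
      show "(v has_vector_derivative - G (exp (w x)) (exp (v x)) m * w' x) (at x within {0..1})" by (rule v[OF x])
      have a1: "((\<lambda>t. w x + c * of_real (t - x) * \<Delta>) has_vector_derivative c * \<Delta>) (at x within {0..1})"
        by (auto intro!: derivative_eq_intros)
      then show d1: "((\<lambda>t. w x + c * of_real (t - x) * \<Delta>) has_vector_derivative w' x) (at x within {0..1})"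
        using \<Delta>0 by (simp add: c_def)
      have a2: "((\<lambda>t. v x + c * of_real (t - x) * k) has_vector_derivative c * k) (at x within {0..1})"
        by (auto intro!: derivative_eq_intros)
      then show d2: "((\<lambda>t. v x + c * of_real (t - x) * k) has_vector_derivative - G (exp (w x)) (exp (v x)) m * w' x) (at x within {0..1})"
        using \<Delta>0 by (simp add: c_def k mult.commute[of "w' x"])
      have lim: "\<forall>\<^sub>F t in at x within {0..1}. p t \<in> ball (p x) R" if "(p has_vector_derivative p') (at x within {0..1})" for p :: "real \<Rightarrow> complex" and p'
        using tendstoD[of p "p x" "at x within {0..1}" R] has_vector_derivative_continuous[OF that] R(1)
        by (simp add: continuous_within dist_commute)
      show "\<forall>\<^sub>F t in at x within {0..1}. norm (E (w t) (v t) m - g t)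
         \<le> C * (norm (w t - (w x + c * of_real (t - x) * \<Delta>)) + norm (v t - (v x + c * of_real (t - x) * k)))"
        using lim[OF w[OF x]] lim[OF v[OF x]] lim[OF d1] lim[OF d2]
        by eventually_elim (use C in \<open>simp add: g_def f_def\<close>)
      show "E (w x) (v x) m - g x = 0" by (simp add: g_def f_def)
    qed auto
    ultimately show ?thesis using has_vector_derivative_add by fastforce
  qed
  then have "((\<lambda>t. E (w t) (v t) m) has_derivative (\<lambda>h. 0)) (at x within {0..1})" if "x \<in> {0..1}" for x
    using that by (simp add: has_vector_derivative_def)
  from has_derivative_zero_unique[OF convex_real_interval(5) this] show ?thesis by auto
qed

text \<open>
  The deviation of \<open>E\<close> from the affine function is at most \<open>\<eta>\<close> times the distance to \<open>ln c2\<close>. Discs of radius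
  comparable to that distance fit into \<open>cone 1\<close>, so Cauchy's estimate bounds the derivative of the deviation
  by a multiple of \<open>\<eta>\<close>, uniformly on the unbounded region \<open>cone 2\<close>.
\<close>

lemma E_nearly_affine:
  assumes v0: "Re v0 < ln s" and m: "norm m < r" and a: "a \<in> cone 2" and b: "b \<in> cone 2"
  shows "norm (E a v0 m - E b v0 m - of_real \<alpha>0 * (a - b)) \<le> \<alpha>0 / 5 * norm (a - b)"
proof -
  have hol: "(\<lambda>z. E z v0 m) holomorphic_on cone 1"
    by (rule holomorphic_E) (use open_cone v0 m in auto)
  define f where "f = (\<lambda>z. E z v0 m - v0 + of_real \<alpha>0 * (of_real (ln c2) - z))"
  have fhol: "f holomorphic_on cone 1" unfolding f_def using hol by (intro holomorphic_intros)
  have "norm (f a - f b) \<le> \<alpha>0 / 5 * norm (a - b)"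
  proof (rule field_differentiable_bound[of "cone 2" f "deriv f"])
    show "convex (cone 2)" by (rule convex_cone) simp
    fix z assume z: "z \<in> cone 2"
    then have z1: "z \<in> cone 1" using cone_antimono[of 1 2] by auto
    show "(f has_field_derivative deriv f z) (at z within cone 2)"
      using holomorphic_derivI[OF fhol open_cone z1] has_field_derivative_at_within by blast
    define D where "D = ln c2 - Re z"
    have D: "2 * \<bar>Im z\<bar> < D" "D > 0" using z by (auto simp: cone_def D_def)
    have in1: "w \<in> cone 1" and nw: "norm (of_real (ln c2) - w) \<le> 2 * D" if "w \<in> ball z (D/8)" for w
    proof -
      have "\<bar>Re w - Re z\<bar> < D/8" "\<bar>Im w - Im z\<bar> < D/8"
        using that abs_Re_le_cmod[of "w - z"] abs_Im_le_cmod[of "w - z"] by (auto simp: dist_norm norm_minus_commute)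
      then have ri: "\<bar>Re w - Re z\<bar> < D/8" "\<bar>Im w - Im z\<bar> < D/8" .
      from ri(1) have rw: "Re w - Re z < D/8" "- (Re w - Re z) < D/8" by (simp_all only: abs_less_iff)
      have b1: "ln c2 - Re w > D * 7/8" using rw(1) by (simp add: D_def)
      have b2: "ln c2 - Re w < D * 9/8" using rw(2) by (simp add: D_def)
      have b3: "\<bar>Im w\<bar> < D * 5/8" using ri(2) D(1) abs_triangle_ineq[of "Im w - Im z" "Im z"] by simp
      note b = b1 b2 b3
      then show "w \<in> cone 1" using D by (simp add: cone_def)
      show "norm (of_real (ln c2) - w) \<le> 2 * D"
        using cmod_le[of "of_real (ln c2) - w"] b D by simp
    qed
    have "norm (deriv f z) \<le> 2 * (\<eta> * (2 * D)) / (D/8)"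
    proof (rule norm_deriv_le_of_bounded)
      show "f holomorphic_on ball z (D/8)" using fhol in1 by (intro holomorphic_on_subset[OF fhol]) auto
      fix w assume w: "w \<in> ball z (D/8)"
      have "norm (f w) \<le> \<eta> * norm (of_real (ln c2) - w)"
        unfolding f_def by (rule E_near[OF in1[OF w] v0 m])
      also have "\<dots> \<le> \<eta> * (2 * D)" using nw[OF w] \<eta> by (intro mult_left_mono) auto
      finally show "norm (f w) \<le> \<eta> * (2 * D)" .
    qed (use D in auto)
    also have "\<dots> = 32 * \<eta>" using D by (simp add: field_simps)
    also have "\<dots> \<le> \<alpha>0 / 5" using \<eta> \<alpha>0 by simp
    finally show "norm (deriv f z) \<le> \<alpha>0 / 5" .
  qed (use a b in auto)
  moreover have "f a - f b = E a v0 m - E b v0 m - of_real \<alpha>0 * (a - b)"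
    by (simp add: f_def algebra_simps)
  ultimately show ?thesis by simp
qed

end

section \<open>Holonomy\<close>

text \<open>
  The constants of the construction. One turn of the holonomy moves \<open>ln x\<close> by at most \<open>drift\<close>, so points
  with \<open>\<bar>x\<bar> < hol_radius\<close> stay in the disc of radius \<open>s\<close>. The logarithm of the holonomy factor varies by at
  most \<open>\<delta>\<close> there; with the radius \<open>base_radius\<close>, a quarter of \<open>hol_radius\<close>, it varies by at most \<open>\<delta> \<bar>x\<bar> / base_radius\<close>.

  The slope \<open>K\<close> of \<open>\<Omega>\<close> has two tasks. The lifted iterates of a point of \<open>\<Omega>\<close> with imaginary part of modulus \<open>p\<close>
  have imaginary parts up to \<open>4 (p + 1)\<close>, and they stay in \<open>cone 2\<close> because \<open>K \<ge> 9\<close>. The summand \<open>\<alpha>0\<close>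
  makes \<open>e\<^sup>\<zeta>\<close> small compared with \<open>e\<^sup>-\<^sup>k\<close> for the relevant \<open>k\<close>, which are of size \<open>\<alpha>0 p / \<pi>\<close>. On the other hand
  \<open>K \<delta> \<le> 1\<close> is needed for the levels of the Dulac map to be connected in \<open>\<Omega>\<close>. The shift \<open>M\<close> absorbs all additive
  constants.
\<close>

context saddle_sections
begin

definition \<delta> :: real where "\<delta> = 1 / (64 * (1 + \<alpha>0))"
definition drift :: real where "drift = 4 * pi / \<alpha>0"
definition hol_radius :: real where "hol_radius = s * exp (- drift)"
definition base_radius :: real where "base_radius = hol_radius / 4"
definition K :: real where "K = 9 + \<alpha>0"
definition M :: real where
  "M = 4 * drift + 20 + \<alpha>0 + \<bar>ln c2 - ln hol_radius\<bar> + \<bar>ln c2 - ln base_radius\<bar>"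
definition \<Omega> :: "complex set" where "\<Omega> = {\<zeta>. Re \<zeta> + K * \<bar>Im \<zeta>\<bar> < ln c2 - M}"

lemma drift: "0 < drift" using \<alpha>0 by (simp add: drift_def)

lemma \<Omega>_cone: "\<zeta> \<in> \<Omega> \<Longrightarrow> \<zeta> \<in> cone 2"
proof -
  assume z: "\<zeta> \<in> \<Omega>"
  have "2 * \<bar>Im \<zeta>\<bar> \<le> K * \<bar>Im \<zeta>\<bar>" using \<alpha>0 by (intro mult_right_mono) (auto simp: K_def)
  moreover have "0 < M" using drift \<alpha>0 by (simp add: M_def)
  ultimately show ?thesis using z by (simp add: cone_def \<Omega>_def)
qed

lemma cnj_\<Omega> [simp]: "cnj \<zeta> \<in> \<Omega> \<longleftrightarrow> \<zeta> \<in> \<Omega>" by (simp add: \<Omega>_def)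

end

text \<open>
  The family at one real parameter. The condition on \<open>\<eta>\<close> is \<open>4 \<pi> \<eta> / \<alpha>0\<^sup>2 \<le> \<delta>\<close>, with \<open>4 \<pi>\<close> replaced by \<open>13\<close>;
  it bounds the variation of the slope of the holonomy equation by \<open>\<delta>\<close>.
\<close>

locale saddle_at = saddle_sections +
  fixes \<mu> :: "real^'a"
  assumes \<mu>: "norm \<mu> < r" and \<eta>_small: "832 * \<eta> * (1 + \<alpha>0) \<le> \<alpha>0\<^sup>2"
begin

definition \<gamma> :: "real \<Rightarrow> complex" where "\<gamma> t = of_real c1 * cis (2 * pi * t)"
text \<open>
  On leaves over the circle \<open>y = \<gamma> t\<close> the equation reads \<open>x' = x * slope t x\<close>, that is, \<open>slope\<close> is the derivative of
  \<open>ln x\<close>. Consequently \<open>expo\<close> below is the change of \<open>ln x\<close> in one turn.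
\<close>

definition slope :: "real \<Rightarrow> complex \<Rightarrow> complex" where
  "slope t x = - (2 * of_real pi * \<i>) / G x (\<gamma> t) (complex_vec \<mu>)"
definition holonomy_path :: "complex \<Rightarrow> (real \<Rightarrow> complex) \<Rightarrow> bool" where
  "holonomy_path z X \<longleftrightarrow> X 0 = z \<and> (\<forall>t\<in>{0..1}. norm (X t) < s \<and>
      (X has_vector_derivative X t * slope t (X t)) (at t within {0..1}))"
definition flow :: "complex \<Rightarrow> real \<Rightarrow> complex" where "flow z = (SOME X. holonomy_path z X)"
definition expo :: "complex \<Rightarrow> complex" where
  "expo z = integral {0..1} (\<lambda>t. slope t (flow z t))"
definition L :: "complex \<Rightarrow> complex" where "L \<zeta> = E \<zeta> (of_real (ln c1)) (complex_vec \<mu>)"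
definition holonomy_rel :: "(complex \<times> complex) set" where
  "holonomy_rel = {(X 0, X 1) | X. holonomy_path (X 0) X}"

lemma \<delta>: "0 < \<delta>" "\<delta> \<le> 1/64" "\<delta> * \<alpha>0 \<le> 1/64"
  using \<alpha>0 by (auto simp: \<delta>_def field_simps)

lemma hol_radius: "0 < hol_radius" "hol_radius < s"
  using s drift by (auto simp: hol_radius_def)

lemma norm_complex_vec: "norm (complex_vec \<mu>) < r"
  using \<mu> by (simp add: norm_complex_vec_eq)

lemma norm_\<gamma>: "norm (\<gamma> t) = c1" using c1 by (simp add: \<gamma>_def norm_mult)

lemma in_bidisc:
  fixes x :: complex
  assumes "norm x < s" shows "norm x < r" "norm (\<gamma> t) < r"
  using assms s c1 norm_\<gamma>[of t] by auto

lemma continuous_\<gamma>: "continuous_on S \<gamma>"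
  unfolding \<gamma>_def by (intro continuous_intros)

lemma G_nz: "norm x < r \<Longrightarrow> G x (\<gamma> t) (complex_vec \<mu>) \<noteq> 0"
  using norm_G_ge[of x "\<gamma> t" "complex_vec \<mu>"] \<alpha>0 norm_complex_vec norm_\<gamma>[of t] c1 s by auto

lemma norm_slope_le:
  assumes "norm x < r" shows "norm (slope t x) \<le> drift"
proof -
  have "norm (slope t x) \<le> (2 * pi) / (\<alpha>0 / 2)"
    unfolding slope_def norm_divide
    by (rule frac_le) (use norm_G_ge[of x "\<gamma> t" "complex_vec \<mu>"] \<alpha>0 norm_complex_vec norm_\<gamma>[of t] c1 s assms in \<open>auto simp: norm_mult\<close>)
  then show ?thesis by (simp add: drift_def)
qed

lemma norm_slope_near:
  assumes "norm x < r" shows "norm (slope t x + 2 * of_real pi * \<i> / of_real \<alpha>0) \<le> \<delta>"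
proof -
  define g where "g = G x (\<gamma> t) (complex_vec \<mu>)"
  have g: "norm (g - of_real \<alpha>0) \<le> \<eta>" "\<alpha>0 / 2 \<le> norm g" "g \<noteq> 0"
    unfolding g_def using near norm_G_ge G_nz norm_complex_vec norm_\<gamma>[of t] c1 s assms by auto
  have "slope t x + 2 * of_real pi * \<i> / of_real \<alpha>0 = 2 * of_real pi * \<i> * (g - of_real \<alpha>0) / (g * of_real \<alpha>0)"
    using g(3) \<alpha>0 unfolding slope_def g_def[symmetric] by (simp add: field_simps)
  also have "norm \<dots> = 2 * pi * norm (g - of_real \<alpha>0) / (norm g * \<alpha>0)"
    using \<alpha>0 by (simp add: norm_mult norm_divide)
  also have "\<dots> \<le> (2 * pi * \<eta>) / (\<alpha>0 / 2 * \<alpha>0)"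
    using g \<alpha>0 \<eta> by (intro frac_le mult_left_mono mult_right_mono) auto
  also have "\<dots> = 4 * pi * \<eta> / \<alpha>0\<^sup>2" by (simp add: power2_eq_square)
  also have "\<dots> \<le> 13 * \<eta> / \<alpha>0\<^sup>2"
    using pi_approx \<eta> by (intro divide_right_mono mult_right_mono) auto
  also have "\<dots> \<le> \<delta>" using \<eta>_small \<alpha>0 by (simp add: \<delta>_def field_simps)
  finally show ?thesis .
qed

lemma slope_holomorphic: "slope t holomorphic_on ball 0 r"
proof -
  have "(\<lambda>x. G x (\<gamma> t) (complex_vec \<mu>)) holomorphic_on ball 0 r"
    by (rule holomorphic_G) (use norm_complex_vec norm_\<gamma>[of t] c1 s in auto)
  then show ?thesis unfolding slope_def using G_nz by (intro holomorphic_intros) auto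
qed

lemma lipschitz_lift:
  assumes "norm x < s" "norm y < s"
  shows "norm (x * slope t x - y * slope t y) \<le> 4 * drift * norm (x - y)"
proof -
  have "norm (x * slope t x - y * slope t y) \<le> 4 * (r * drift) / r * norm (x - y)"
  proof (rule holomorphic_bounded_imp_lipschitz)
    show "(\<lambda>x. x * slope t x) holomorphic_on ball 0 r"
      by (intro holomorphic_intros slope_holomorphic)
    show "norm (z * slope t z) \<le> r * drift" if "z \<in> ball 0 r" for z
      unfolding norm_mult using norm_slope_le[of z t] that r drift by (intro mult_mono) auto
  qed (use r assms s in auto)
  then show ?thesis using r by simp
qed

lemma holonomy_path_unique:
  assumes "holonomy_path z X" "holonomy_path z X'" "t \<in> {0..1}" shows "X t = X' t"
  by (rule ode_unique[of X "\<lambda>t. X t * slope t (X t)" X' "\<lambda>t. X' t * slope t (X' t)" "4 * drift"])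
     (use assms lipschitz_lift in \<open>auto simp: holonomy_path_def\<close>)

lemma continuous_on_slope: "continuous_on ({0..1} \<times> ball 0 r) (\<lambda>(t, x). slope t x)"
proof -
  have "continuous_on ({0..1} \<times> ball 0 r) (\<lambda>p. (\<lambda>(x, y, m). G x y m) (snd p, \<gamma> (fst p), complex_vec \<mu>))"
    by (rule continuous_on_compose2[OF continuous_on_G])
       (use norm_complex_vec norm_\<gamma> c1 s in \<open>auto intro!: continuous_intros continuous_on_compose2[OF continuous_\<gamma>[of UNIV]]\<close>)
  then show ?thesis unfolding slope_def split_def using G_nz by (intro continuous_intros) auto
qed

text \<open>
  By the bound on \<open>slope\<close>, \<open>\<bar>x\<bar>\<close> grows at most like \<open>\<bar>z\<bar> exp (drift * t)\<close>. The discs of this radius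
  are the confining sets.
\<close>

lemma lift_exists:
  obtains X where "continuous_on (ball 0 hol_radius \<times> {0..1}) (\<lambda>(z, t). X z t)"
    "\<And>t. t \<in> {0..1} \<Longrightarrow> (\<lambda>z. X z t) holomorphic_on ball 0 hol_radius"
    "\<And>z. z \<in> ball 0 hol_radius \<Longrightarrow> holonomy_path z (X z)"
proof -
  define S where "S = (\<lambda>z t. cball (0::complex) (norm (z::complex) * exp (drift * t)))"
  define F where "F = (\<lambda>(z::complex) t x. x * slope t x)"
  have Ss: "norm x < s" if "z \<in> ball 0 hol_radius" "t \<in> {0..1}" "x \<in> S z t" for z t x
  proof -
    have "drift * t \<le> drift" using drift that by (simp add: mult_left_le)
    have "norm x \<le> norm z * exp (drift * t)" using that by (simp add: S_def)
    also have "\<dots> \<le> norm z * exp drift" using \<open>drift * t \<le> drift\<close> by (intro mult_left_mono) auto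
    also have "\<dots> < hol_radius * exp drift" using that by (intro mult_strict_right_mono) auto
    also have "\<dots> = s" by (simp add: hol_radius_def exp_minus)
    finally show ?thesis .
  qed
  have cF: "continuous_on {(z, t, v). z \<in> ball 0 hol_radius \<and> t \<in> {0..1} \<and> v \<in> S z t} (\<lambda>(z, t, v). F z t v)"
  proof -
    have "continuous_on {(z, t, v). z \<in> ball 0 hol_radius \<and> t \<in> {0..1} \<and> v \<in> S z t} (\<lambda>p. (\<lambda>(t, x). slope t x) (snd p))"
      by (rule continuous_on_compose2[OF continuous_on_slope]) (use Ss in_bidisc in \<open>fastforce intro!: continuous_intros\<close>)+
    then show ?thesis unfolding F_def split_def by (intro continuous_intros)
  qed
  obtain X where
      cX: "continuous_on (ball 0 hol_radius \<times> {0..1}) (\<lambda>(z, t). X z t)" and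
      hX: "\<And>t. t \<in> {0..1} \<Longrightarrow> (\<lambda>z. X z t) holomorphic_on ball 0 hol_radius" and
      XS: "\<And>z t. z \<in> ball 0 hol_radius \<Longrightarrow> t \<in> {0..1} \<Longrightarrow> X z t \<in> S z t" and
      X0: "\<And>z. z \<in> ball 0 hol_radius \<Longrightarrow> X z 0 = z" and
      Xd: "\<And>z t. z \<in> ball 0 hol_radius \<Longrightarrow> t \<in> {0..1} \<Longrightarrow> (X z has_vector_derivative F z t (X z t)) (at t within {0..1})"
  proof (rule picard_holomorphic[of "ball 0 hol_radius" "\<lambda>z. z" S F "s * drift" "4 * drift"])
    show "z \<in> S z t" if "z \<in> ball 0 hol_radius" "t \<in> {0..1}" for z t
      using that drift mult_left_mono[of 1 "exp (drift * t)" "norm z"] by (simp add: S_def)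
    show "closed (S z t)" for z t by (simp add: S_def)
    show "norm (F z t v) \<le> s * drift" if "z \<in> ball 0 hol_radius" "t \<in> {0..1}" "v \<in> S z t" for z t v
      unfolding F_def norm_mult using norm_slope_le[of v t] in_bidisc[OF Ss[OF that]] Ss[OF that] drift s
      by (intro mult_mono) auto
    show "norm (F z t v - F z t w) \<le> 4 * drift * norm (v - w)"
      if "z \<in> ball 0 hol_radius" "t \<in> {0..1}" "v \<in> S z t" "w \<in> S z t" for z t v w
      unfolding F_def by (rule lipschitz_lift) (use that Ss in auto)
    show "(\<lambda>z. F z t (u z)) holomorphic_on ball 0 hol_radius"
      if "t \<in> {0..1}" "u holomorphic_on ball 0 hol_radius" "\<And>z. z \<in> ball 0 hol_radius \<Longrightarrow> u z \<in> S z t" for t u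
    proof -
      have "(slope t \<circ> u) holomorphic_on ball 0 hol_radius"
      proof (rule holomorphic_on_compose_gen[OF that(2) slope_holomorphic])
        show "u ` ball 0 hol_radius \<subseteq> ball 0 r" using in_bidisc(1)[OF Ss[OF _ that(1) that(3)]] by auto
      qed
      then show ?thesis unfolding F_def using that(2) by (auto simp: o_def intro!: holomorphic_intros)
    qed
    show "z + integral {0..t} (\<lambda>\<tau>. F z \<tau> (u \<tau>)) \<in> S z t"
      if z: "z \<in> ball 0 hol_radius" and u: "continuous_on {0..1} u" "\<And>t. t \<in> {0..1} \<Longrightarrow> u t \<in> S z t" and t: "t \<in> {0..1}" for z u t
    proof -
      have cu: "continuous_on {0..1} (\<lambda>t. F z t (u t))"
      proof -
        have "continuous_on {0..1} (\<lambda>t. (\<lambda>(z, t, v). F z t v) (z, t, u t))"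
          by (rule continuous_on_compose2[OF cF]) (use z u in \<open>auto intro!: continuous_intros\<close>)
        then show ?thesis by simp
      qed
      have I: "((\<lambda>\<tau>. norm z * (drift * exp (drift * \<tau>))) has_integral (norm z * exp (drift * t) - norm z * exp (drift * 0))) {0..t}"
        by (rule fundamental_theorem_of_calculus)
           (use t in \<open>auto intro!: derivative_eq_intros simp: has_real_derivative_iff_has_vector_derivative[symmetric]\<close>)
      have "norm (integral {0..t} (\<lambda>\<tau>. F z \<tau> (u \<tau>))) \<le> integral {0..t} (\<lambda>\<tau>. norm z * (drift * exp (drift * \<tau>)))"
      proof (rule integral_norm_bound_integral)
        show "(\<lambda>\<tau>. F z \<tau> (u \<tau>)) integrable_on {0..t}"
          by (rule integrable_continuous_real[OF continuous_on_subset[OF cu]]) (use t in auto)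
        show "(\<lambda>\<tau>. norm z * (drift * exp (drift * \<tau>))) integrable_on {0..t}" using I by blast
        fix \<tau> assume "\<tau> \<in> {0..t}"
        then have \<tau>: "\<tau> \<in> {0..1}" using t by auto
        have "norm (F z \<tau> (u \<tau>)) \<le> (norm z * exp (drift * \<tau>)) * drift"
          unfolding F_def norm_mult using norm_slope_le[of "u \<tau>" \<tau>] in_bidisc[OF Ss[OF z \<tau> u(2)[OF \<tau>]]] u(2)[OF \<tau>]
          by (intro mult_mono) (auto simp: S_def)
        then show "norm (F z \<tau> (u \<tau>)) \<le> norm z * (drift * exp (drift * \<tau>))" by (simp add: mult_ac)
      qed
      also have "\<dots> = norm z * exp (drift * t) - norm z" using I by (simp add: has_integral_iff)
      finally show ?thesis
        using norm_triangle_ineq[of z "integral {0..t} (\<lambda>\<tau>. F z \<tau> (u \<tau>))"] by (simp add: S_def)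
    qed
  qed (use cF in auto)
  show ?thesis
    by (rule that[OF cX hX]) (use X0 Xd Ss[OF _ _ XS] in \<open>auto simp: holonomy_path_def F_def\<close>)
qed

lemma holonomy_path_flow:
  assumes "norm z < hol_radius" shows "holonomy_path z (flow z)"
proof -
  obtain X where "\<And>z. z \<in> ball 0 hol_radius \<Longrightarrow> holonomy_path z (X z)" by (rule lift_exists) (rule that)
  then have "holonomy_path z (X z)" using assms by simp
  then show ?thesis unfolding flow_def by (rule someI[of "holonomy_path z"])
qed

lemma slope_along_lift:
  assumes "holonomy_path z X"
  shows "continuous_on {0..1} (\<lambda>t. slope t (X t))" "\<And>t. t \<in> {0..1} \<Longrightarrow> norm (X t) < r"
proof -
  show n: "norm (X t) < r" if "t \<in> {0..1}" for t using assms that by (intro in_bidisc) (auto simp: holonomy_path_def)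
  have "continuous_on {0..1} X"
    unfolding continuous_on_eq_continuous_within
    using assms has_vector_derivative_continuous unfolding holonomy_path_def by blast
  then have "continuous_on {0..1} (\<lambda>t. (\<lambda>(t, x). slope t x) (t, X t))"
    by (intro continuous_on_compose2[OF continuous_on_slope]) (use n in \<open>auto intro!: continuous_intros\<close>)
  then show "continuous_on {0..1} (\<lambda>t. slope t (X t))" by simp
qed

lemma expo_holomorphic: "expo holomorphic_on ball 0 hol_radius"
proof -
  obtain X where X: "continuous_on (ball 0 hol_radius \<times> {0..1}) (\<lambda>(z, t). X z t)"
    "\<And>t. t \<in> {0..1} \<Longrightarrow> (\<lambda>z. X z t) holomorphic_on ball 0 hol_radius"
    "\<And>z. z \<in> ball 0 hol_radius \<Longrightarrow> holonomy_path z (X z)"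
    by (rule lift_exists) (rule that)
  have r: "norm (X z t) < r" if "z \<in> ball (0::complex) hol_radius" "t \<in> {0..1}" for z t
    using slope_along_lift(2)[OF X(3)[OF that(1)] that(2)] .
  have "(\<lambda>z. integral {0..1} (\<lambda>t. slope t (X z t))) holomorphic_on ball 0 hol_radius"
  proof (rule holomorphic_on_integral[OF open_ball])
    have "continuous_on (ball 0 hol_radius \<times> {0..1}) (\<lambda>p. (\<lambda>(t, x). slope t x) (snd p, (\<lambda>(z, t). X z t) p))"
      by (intro continuous_on_compose2[OF continuous_on_slope]) (use X(1) r in \<open>auto intro!: continuous_intros\<close>)
    then show "continuous_on (ball 0 hol_radius \<times> {0..1}) (\<lambda>(z, t). slope t (X z t))" by (simp add: split_def)
    fix t :: real assume t: "t \<in> {0..1}"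
    have "(slope t \<circ> (\<lambda>z. X z t)) holomorphic_on ball 0 hol_radius"
      by (rule holomorphic_on_compose_gen[OF X(2)[OF t] slope_holomorphic]) (use r t in auto)
    then show "(\<lambda>z. slope t (X z t)) holomorphic_on ball 0 hol_radius" by (simp add: o_def)
  qed
  then show ?thesis
  proof (rule holomorphic_transform)
    fix z :: complex assume z: "z \<in> ball 0 hol_radius"
    have "flow z t = X z t" if "t \<in> {0..1}" for t
      using holonomy_path_unique[OF holonomy_path_flow X(3)[OF z] that] z by simp
    then show "integral {0..1} (\<lambda>t. slope t (X z t)) = expo z"
      unfolding expo_def by (intro integral_cong) auto
  qed
qed

lemma expo_near:
  assumes "norm z < hol_radius" shows "norm (expo z + 2 * of_real pi * \<i> / of_real \<alpha>0) \<le> \<delta>"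
proof -
  note l = slope_along_lift[OF holonomy_path_flow[OF assms]]
  define k where "k = 2 * of_real pi * \<i> / of_real \<alpha>0"
  have "expo z + k = integral {0..1} (\<lambda>t. slope t (flow z t) + k)"
    unfolding expo_def using integrable_continuous_real[OF l(1)] by (subst integral_add) auto
  also have "norm \<dots> \<le> \<delta> * (1 - 0)"
    by (rule integral_bound) (use norm_slope_near l in \<open>auto simp: k_def intro!: continuous_intros\<close>)
  finally show ?thesis by (simp add: k_def)
qed

text \<open>
  On the separatrix the slope is a function of \<open>y\<close> alone, so its mean over the circle is its value at the
  centre. This is where the multiplier \<open>e\<^sup>-\<^sup>2\<^sup>\<pi>\<^sup>i\<^sup>/\<^sup>\<alpha>\<close> of the holonomy comes from.
\<close>

lemma expo_0: "expo 0 = - (2 * of_real pi * \<i>) / G 0 0 (complex_vec \<mu>)"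
proof -
  have "holonomy_path 0 (\<lambda>_. 0)" using s by (simp add: holonomy_path_def)
  then have "flow 0 t = 0" if "t \<in> {0..1}" for t
    using holonomy_path_unique[OF holonomy_path_flow _ that, of 0 "\<lambda>_. 0"] hol_radius by simp
  then have e: "expo 0 = integral {0..1} (\<lambda>t. slope t 0)"
    unfolding expo_def by (intro integral_cong) auto
  define f where "f = (\<lambda>y. - 1 / G 0 y (complex_vec \<mu>))"
  have hG: "(\<lambda>y. G 0 y (complex_vec \<mu>)) holomorphic_on ball 0 r"
    by (rule holomorphic_G) (use norm_complex_vec r in auto)
  have nz: "G 0 y (complex_vec \<mu>) \<noteq> 0" if "y \<in> ball 0 r" for y
    using norm_G_ge[of 0 y "complex_vec \<mu>"] norm_complex_vec r \<alpha>0 that by auto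
  have hf: "f holomorphic_on ball 0 r" unfolding f_def using hG nz by (intro holomorphic_intros) auto
  have cr: "cball 0 c1 \<subseteq> ball 0 r" using c1 s by auto
  have "((\<lambda>u. f u / (u - 0) ^ Suc 0) has_contour_integral ((2 * pi * \<i>) / (fact 0) * (deriv ^^ 0) f 0)) (circlepath 0 c1)"
  proof (rule Cauchy_has_contour_integral_higher_derivative_circlepath)
    show "continuous_on (cball 0 c1) f"
      by (rule continuous_on_subset[OF holomorphic_on_imp_continuous_on[OF hf] cr])
    show "f holomorphic_on ball 0 c1"
      by (rule holomorphic_on_subset[OF hf]) (use cr ball_subset_cball in blast)
  qed (use c1 in auto)
  then have "((\<lambda>t. slope t 0) has_integral (2 * pi * \<i> * f 0)) {0..1}"
    unfolding has_contour_integral_def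
  proof (elim has_integral_eq_rhs[OF has_integral_eq, rotated 1])
    fix t :: real assume t: "t \<in> {0..1}"
    have "circlepath 0 c1 t = \<gamma> t" by (simp add: circlepath \<gamma>_def cis_conv_exp mult_ac)
    moreover have "vector_derivative (circlepath 0 c1) (at t within {0..1}) = 2 * of_real pi * \<i> * \<gamma> t"
      using t by (simp add: vector_derivative_circlepath01 \<gamma>_def cis_conv_exp mult_ac)
    moreover have "\<gamma> t \<noteq> 0" using norm_\<gamma>[of t] c1 by auto
    ultimately show "f (circlepath 0 c1 t) / (circlepath 0 c1 t - 0) ^ Suc 0 * vector_derivative (circlepath 0 c1) (at t within {0..1}) = slope t 0"
      by (simp add: f_def slope_def)
  qed simp
  then show ?thesis by (simp add: e integral_unique f_def)
qed

text \<open>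
  The logarithm of the path is defined by integrating \<open>slope\<close>; both its exponential and the path itself solve
  the same linear equation.
\<close>

lemma lifted_path:
  assumes "Re \<zeta> < ln hol_radius"
  obtains w where "w 0 = \<zeta>" "w 1 = \<zeta> + expo (exp \<zeta>)"
    "\<And>t. t \<in> {0..1} \<Longrightarrow> exp (w t) = flow (exp \<zeta>) t"
    "\<And>t. t \<in> {0..1} \<Longrightarrow> (w has_vector_derivative slope t (exp (w t))) (at t within {0..1})"
    "\<And>t. t \<in> {0..1} \<Longrightarrow> norm (w t - \<zeta>) \<le> drift"
proof -
  define z where "z = exp \<zeta>"
  have "norm z < hol_radius" using assms hol_radius by (simp add: z_def norm_exp_eq_Re) (metis exp_less_cancel_iff exp_ln)
  then have X: "holonomy_path z (flow z)" by (rule holonomy_path_flow)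
  note l = slope_along_lift[OF X]
  define w where "w = (\<lambda>t. \<zeta> + integral {0..t} (\<lambda>\<tau>. slope \<tau> (flow z \<tau>)))"
  have dw: "(w has_vector_derivative slope t (flow z t)) (at t within {0..1})" if "t \<in> {0..1}" for t
    unfolding w_def using integral_has_vector_derivative[OF l(1) that] by (auto intro!: derivative_eq_intros)
  have e: "exp (w t) = flow z t" if t: "t \<in> {0..1}" for t
  proof (rule ode_unique[of "\<lambda>t. exp (w t)" "\<lambda>t. exp (w t) * slope t (flow z t)" "flow z" "\<lambda>t. flow z t * slope t (flow z t)" drift])
    fix t :: real assume t: "t \<in> {0..1}"
    show "((\<lambda>t. exp (w t)) has_vector_derivative exp (w t) * slope t (flow z t)) (at t within {0..1})"
      using field_vector_diff_chain_within[OF dw[OF t], of exp "exp (w t)"]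
      by (simp add: o_def mult.commute DERIV_exp has_field_derivative_at_within)
    show "(flow z has_vector_derivative flow z t * slope t (flow z t)) (at t within {0..1})"
      using X t by (simp add: holonomy_path_def)
    have "exp (w t) * slope t (flow z t) - flow z t * slope t (flow z t) = slope t (flow z t) * (exp (w t) - flow z t)"
      by (simp add: algebra_simps)
    then show "norm (exp (w t) * slope t (flow z t) - flow z t * slope t (flow z t)) \<le> drift * norm (exp (w t) - flow z t)"
      using norm_slope_le[OF l(2)[OF t], of t] by (simp only: norm_mult) (intro mult_right_mono; simp)
  next
    show "exp (w 0) = flow z 0" using X by (simp add: w_def holonomy_path_def z_def)
  qed (use t in auto)
  show ?thesis
  proof (rule that[of w])
    show "w 1 = \<zeta> + expo (exp \<zeta>)" by (simp add: w_def expo_def z_def)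
    show "norm (w t - \<zeta>) \<le> drift" if t: "t \<in> {0..1}" for t
    proof -
      have "norm (integral {0..t} (\<lambda>\<tau>. slope \<tau> (flow z \<tau>))) \<le> drift * (t - 0)"
        by (rule integral_bound) (use t l norm_slope_le in \<open>auto intro: continuous_on_subset\<close>)
      also have "\<dots> \<le> drift" using t drift by (simp add: mult_left_le)
      finally show ?thesis by (simp add: w_def)
    qed
  qed (use e dw in \<open>auto simp: w_def z_def\<close>)
qed

text \<open>
  The lift of the path of the holonomy runs in a leaf from \<open>(\<zeta>, ln c1)\<close> to
  \<open>(\<zeta> + expo (exp \<zeta>), ln c1 + 2\<pi>\<i>)\<close>, on which \<open>E\<close> is constant; \<open>E_shift\<close> removes the \<open>2\<pi>\<i>\<close>.
\<close>

lemma L_lift: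
  assumes "\<zeta> \<in> cone 2" "4 * drift < ln c2 - Re \<zeta>" "Re \<zeta> < ln hol_radius"
  shows "L (\<zeta> + expo (exp \<zeta>)) = L \<zeta> - 2 * of_real pi * \<i>"
proof -
  obtain w where w: "w 0 = \<zeta>" "w 1 = \<zeta> + expo (exp \<zeta>)"
    "\<And>t. t \<in> {0..1} \<Longrightarrow> exp (w t) = flow (exp \<zeta>) t"
    "\<And>t. t \<in> {0..1} \<Longrightarrow> (w has_vector_derivative slope t (exp (w t))) (at t within {0..1})"
    "\<And>t. t \<in> {0..1} \<Longrightarrow> norm (w t - \<zeta>) \<le> drift"
    by (rule lifted_path[OF assms(3)]) (rule that)
  have "norm (exp \<zeta>) < hol_radius" using assms(3) hol_radius by (simp add: norm_exp_eq_Re) (metis exp_less_cancel_iff exp_ln)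
  note l = slope_along_lift[OF holonomy_path_flow[OF this]]
  define v where "v = (\<lambda>t::real. of_real (ln c1) + 2 * of_real pi * \<i> * of_real t)"
  have ev: "exp (v t) = \<gamma> t" for t
    using c1 by (simp add: v_def \<gamma>_def exp_add cis_conv_exp mult_ac exp_of_real)
  have "Re (v t) < ln s" for t using c1 by (simp add: v_def)
  have dom: "w t \<in> cone 1" if t: "t \<in> {0..1}" for t
  proof -
    have "\<bar>Re (w t) - Re \<zeta>\<bar> \<le> drift" "\<bar>Im (w t) - Im \<zeta>\<bar> \<le> drift"
      using w(5)[OF t] abs_Re_le_cmod[of "w t - \<zeta>"] abs_Im_le_cmod[of "w t - \<zeta>"] by auto
    moreover have "2 * \<bar>Im \<zeta>\<bar> < ln c2 - Re \<zeta>" using assms(1) by (simp add: cone_def)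
    ultimately show ?thesis using assms(2) abs_triangle_ineq[of "Im (w t) - Im \<zeta>" "Im \<zeta>"]
      unfolding cone_def by simp
  qed
  have "E (w 1) (v 1) (complex_vec \<mu>) = E (w 0) (v 0) (complex_vec \<mu>)"
  proof (rule E_constant_on_leaf[OF norm_complex_vec dom _ w(4)])
    fix t :: real assume t: "t \<in> {0..1}"
    show "Re (v t) < ln s" by fact
    have "norm (exp (w t)) < r" using w(3) l(2) t by simp
    then have "- G (exp (w t)) (exp (v t)) (complex_vec \<mu>) * slope t (exp (w t)) = 2 * of_real pi * \<i>"
      using G_nz by (simp add: slope_def ev)
    moreover have "(v has_vector_derivative 2 * of_real pi * \<i>) (at t within {0..1})"
      unfolding v_def by (auto intro!: derivative_eq_intros)
    ultimately show "(v has_vector_derivative - G (exp (w t)) (exp (v t)) (complex_vec \<mu>) * slope t (exp (w t))) (at t within {0..1})"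
      by simp
  qed
  moreover have "v 1 = of_real (ln c1) + 2 * of_real pi * \<i>" "v 0 = of_real (ln c1)" by (simp_all add: v_def)
  moreover have "w 1 \<in> cone 1" by (rule dom) simp
  moreover have "Re (complex_of_real (ln c1)) < ln s" using c1 by simp
  ultimately show ?thesis
    using E_shift[of "w 1" "of_real (ln c1)" "complex_vec \<mu>"] norm_complex_vec w(1,2) by (simp add: L_def)
qed

lemma holonomy_rel_iff:
  assumes "norm z < hol_radius" shows "(z, z') \<in> holonomy_rel \<longleftrightarrow> z' = z * exp (expo z)"
proof -
  have f: "flow z 1 = z * exp (expo z)"
  proof (cases "z = 0")
    case True
    have "holonomy_path 0 (\<lambda>_. 0)" using s by (simp add: holonomy_path_def)
    then show ?thesis using holonomy_path_unique[OF holonomy_path_flow, of 0 "\<lambda>_. 0" 1] hol_radius True by simp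
  next
    case False
    have "Re (Ln z) < ln hol_radius" using False assms hol_radius by simp
    then obtain w where "w 1 = Ln z + expo (exp (Ln z))" "\<And>t. t \<in> {0..1} \<Longrightarrow> exp (w t) = flow (exp (Ln z)) t"
      by (rule lifted_path) (rule that)
    then show ?thesis using False by (metis atLeastAtMost_iff exp_Ln exp_add order_refl zero_le_one)
  qed
  have l: "holonomy_path z (flow z)" by (rule holonomy_path_flow[OF assms])
  show ?thesis
  proof
    assume "(z, z') \<in> holonomy_rel"
    then obtain X where "z = X 0" "z' = X 1" "holonomy_path z X" by (auto simp: holonomy_rel_def)
    then show "z' = z * exp (expo z)" using holonomy_path_unique[OF _ l, of X 1] f by simp
  next
    assume "z' = z * exp (expo z)"
    then show "(z, z') \<in> holonomy_rel"
      using l f unfolding holonomy_rel_def by (auto simp: holonomy_path_def intro!: exI[of _ "flow z"])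
  qed
qed

text \<open>
  Conjugation reverses the orientation of the circle, so the conjugate of a path of the
  holonomy, run backwards, is again such a path: \<open>cnj \<circ> h \<circ> cnj = h\<inverse>\<close>.
\<close>

lemma holonomy_rel_cnj:
  assumes "(a, b) \<in> holonomy_rel" shows "(cnj b, cnj a) \<in> holonomy_rel"
proof -
  obtain X where X: "a = X 0" "b = X 1" "holonomy_path (X 0) X" using assms by (auto simp: holonomy_rel_def)
  define Z where "Z = (\<lambda>t. cnj (X (1 - t)))"
  have "holonomy_path (Z 0) Z"
    unfolding holonomy_path_def
  proof (intro conjI ballI refl)
    fix t :: real assume t: "t \<in> {0..1}"
    define u where "u = 1 - t"
    have u: "u \<in> {0..1}" using t by (auto simp: u_def)
    have x: "norm (X u) < s" and dX: "(X has_vector_derivative X u * slope u (X u)) (at u within {0..1})"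
      using X(3) u by (auto simp: holonomy_path_def)
    show "norm (Z t) < s" using x by (simp add: Z_def u_def)
    have "((\<lambda>t. 1 - t) ` {0..1}) = {0..1::real}"
      by (auto simp: image_iff intro!: bexI[of _ "1 - x" for x])
    then have "((X \<circ> (\<lambda>t. 1 - t)) has_vector_derivative (-1) *\<^sub>R (X u * slope u (X u))) (at t within {0..1})"
      using dX by (intro vector_diff_chain_within) (auto simp: u_def intro!: derivative_eq_intros)
    then have "(Z has_vector_derivative cnj (- (X u * slope u (X u)))) (at t within {0..1})"
      unfolding Z_def by (intro has_vector_derivative_cnj) (simp add: o_def)
    moreover have "cnj (- (X u * slope u (X u))) = Z t * slope t (Z t)"
    proof -
      have "cnj (\<gamma> u) = \<gamma> t"
        by (simp add: \<gamma>_def u_def complex_eq_iff right_diff_distrib cos_2pi_minus sin_2pi_minus)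
      then have "G (Z t) (\<gamma> t) (complex_vec \<mu>) = cnj (G (X u) (\<gamma> u) (complex_vec \<mu>))"
        using cnj_G[OF in_bidisc(1)[OF x] in_bidisc(2)[OF x, of u] \<mu>] by (simp add: Z_def u_def)
      then show ?thesis by (simp add: slope_def Z_def u_def)
    qed
    ultimately show "(Z has_vector_derivative Z t * slope t (Z t)) (at t within {0..1})" by simp
  qed
  then show ?thesis unfolding holonomy_rel_def using X by (auto simp: Z_def intro!: exI[of _ Z])
qed

end

section \<open>Fixed curves of antiholomorphic involutions\<close>

lemma norm_exp_diff_le:
  fixes x y :: complex
  assumes "Re x \<le> c" "Re y \<le> c"
  shows "norm (exp x - exp y) \<le> exp c * norm (x - y)"
  by (rule field_differentiable_bound[of "{z. Re z \<le> c}" exp exp])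
     (use assms in \<open>auto simp: convex_halfspace_Re_le norm_exp_eq_Re intro: DERIV_exp has_field_derivative_at_within\<close>)

lemma norm_cis_diff_le: "norm (cis a - cis b) \<le> \<bar>a - b\<bar>"
proof -
  have "norm (exp (\<i> * of_real a) - exp (\<i> * of_real b)) \<le> exp 0 * norm (\<i> * of_real a - \<i> * of_real b)"
    by (rule norm_exp_diff_le) auto
  moreover have "norm (\<i> * of_real a - \<i> * of_real b) = \<bar>a - b\<bar>"
    by (simp add: norm_mult flip: right_diff_distrib of_real_diff)
  ultimately show ?thesis by (simp add: cis_conv_exp)
qed

lemma cos_diff_le: "\<bar>cos a - cos b\<bar> \<le> \<bar>a - b\<bar>" for a b :: real
  using norm_cis_diff_le[of a b] abs_Re_le_cmod[of "cis a - cis b"] by simp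

lemma open_lower_set_eq_interval:
  fixes P :: "real set"
  assumes "P \<noteq> {}" "open P" "bdd_above P" "\<And>x. x \<in> P \<Longrightarrow> 0 < x"
    and down: "\<And>x y. x \<in> P \<Longrightarrow> 0 < y \<Longrightarrow> y < x \<Longrightarrow> y \<in> P"
  shows "P = {0<..<Sup P}"
proof (intro equalityI subsetI)
  fix x assume x: "x \<in> P"
  then obtain e where e: "e > 0" "ball x e \<subseteq> P" using assms(2) open_contains_ball by blast
  then have "x + e/2 \<in> P" by (auto simp: dist_norm)
  then have "x + e/2 \<le> Sup P" using assms(3) by (rule cSup_upper)
  then show "x \<in> {0<..<Sup P}" using e assms(4)[OF x] by auto
next
  fix x assume x: "x \<in> {0<..<Sup P}"
  then obtain y where "y \<in> P" "x < y" using less_cSupE[of x P] assms(1) by auto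
  then show "x \<in> P" using down[of y x] x by auto
qed

lemma open_sublevel:
  fixes f :: "'a::topological_space \<Rightarrow> real"
  assumes "open S" "continuous_on S f" shows "open {x \<in> S. f x < c}"
proof -
  have "open (S \<inter> f -` {..<c})" by (rule continuous_open_preimage[OF assms(2,1)]) simp
  moreover have "S \<inter> f -` {..<c} = {x \<in> S. f x < c}" by auto
  ultimately show ?thesis by simp
qed

text \<open>
  The geometry of one curve \<open>C\<close>, for a germ \<open>F z = z exp (- 2\<i>\<theta> + e z)\<close> that is close to the rotation by \<open>- 2\<theta>\<close>
  on a disc of radius \<open>R\<close>. In the application \<open>F\<close> is an iterate of the holonomy, and \<open>inv\<close> says that \<open>cnj \<circ> F\<close> is an
  involution. The numbers \<open>K\<close> and \<open>m\<close> describe the region \<open>\<Omega>\<close>, which \<open>small\<close> puts over a small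
  disc on the sheet near \<open>\<theta>\<close>.
\<close>

locale reflection_arc =
  fixes e F :: "complex \<Rightarrow> complex" and R \<theta> \<delta> K m :: real and C :: "complex set"
  assumes R: "0 < R" and \<delta>: "0 < \<delta>" "\<delta> \<le> 1/64" and K: "0 \<le> K" "K * \<delta> \<le> 1"
    and e_hol: "e holomorphic_on ball 0 R"
    and e_le: "\<And>z. norm z < R \<Longrightarrow> norm (e z) \<le> \<delta> * norm z / R"
    and F: "\<And>z. F z = z * exp (- 2 * \<i> * of_real \<theta> + e z)"
    and inv: "\<And>z. norm z < R/2 \<Longrightarrow> norm (F z) < R/2 \<Longrightarrow> F (cnj (F z)) = cnj z"
    and C: "\<And>z. norm z < R \<Longrightarrow> z \<in> C \<longleftrightarrow> F z = cnj z"
    and small: "\<And>\<zeta>. Re \<zeta> + K * \<bar>Im \<zeta>\<bar> < m \<Longrightarrow> \<bar>Im \<zeta> - \<theta>\<bar> < 1 \<Longrightarrow> norm (exp \<zeta>) < R / 16"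
begin

text \<open>
  \<open>\<Psi>\<close> is the average \<open>(z / \<omega> + \<omega> F z) / 2\<close>, \<open>\<omega> = cis \<theta>\<close>, that straightens \<open>C\<close>. The set \<open>Z\<close> lifts the equation
  \<open>F z = cnj z\<close> to the sheet of the logarithm near \<open>\<theta>\<close>, without an additive multiple of \<open>2\<pi>\<i>\<close>.
\<close>

definition \<Psi> :: "complex \<Rightarrow> complex" where "\<Psi> z = z * (1 + exp (e z)) / (2 * cis \<theta>)"
definition Z :: "complex set" where
  "Z = {\<zeta>. Re \<zeta> + K * \<bar>Im \<zeta>\<bar> < m \<and> \<bar>Im \<zeta> - \<theta>\<bar> < 1 \<and> \<zeta> - 2 * \<i> * of_real \<theta> + e (exp \<zeta>) = cnj \<zeta>}"

lemma e_le_\<delta>: "norm z < R \<Longrightarrow> norm (e z) \<le> \<delta>"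
proof -
  assume z: "norm z < R"
  have "\<delta> * norm z / R \<le> \<delta> * R / R" using z R \<delta> by (intro divide_right_mono mult_left_mono) auto
  then show ?thesis using e_le[OF z] R by simp
qed

lemma exp_\<delta>: "exp \<delta> \<le> 2"
proof -
  have "\<delta>\<^sup>2 \<le> 1 * \<delta>" unfolding power2_eq_square using \<delta> by (intro mult_right_mono) auto
  then show ?thesis using exp_bound[of \<delta>] \<delta> by simp
qed

lemma exp_e_minus_1: "norm z < R \<Longrightarrow> norm (exp (e z) - 1) \<le> 2 * norm (e z)"
proof -
  assume z: "norm z < R"
  have "norm (exp (e z) - exp 0) \<le> exp \<delta> * norm (e z - 0)"
    using e_le_\<delta>[OF z] complex_Re_le_cmod[of "e z"] \<delta> by (intro norm_exp_diff_le) auto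
  also have "\<dots> \<le> 2 * norm (e z)" using exp_\<delta> by (simp add: mult_right_mono)
  finally show ?thesis by simp
qed

lemma e_lipschitz:
  assumes "norm a < R/2" "norm b < R/2" shows "norm (e a - e b) \<le> 4 * \<delta> / R * norm (a - b)"
  by (rule holomorphic_bounded_imp_lipschitz[OF e_hol R]) (use e_le_\<delta> assms in auto)

lemma e_0: "e 0 = 0" using e_le[of 0] R by simp

lemma \<Psi>_0: "\<Psi> 0 = 0" by (simp add: \<Psi>_def)

lemma \<Psi>_holomorphic: "\<Psi> holomorphic_on ball 0 R"
  unfolding \<Psi>_def by (intro holomorphic_intros e_hol) auto

lemma \<Psi>_F: "\<Psi> z = (z / cis \<theta> + cis \<theta> * F z) / 2"
proof -
  have "exp (- 2 * \<i> * of_real \<theta> + e z) = exp (e z) / (cis \<theta> * cis \<theta>)"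
    by (simp add: exp_add cis_conv_exp exp_minus field_simps flip: exp_add exp_double)
  then show ?thesis by (simp add: \<Psi>_def F field_simps)
qed

text \<open>
  \<open>\<Psi>\<close> differs from the rotation \<open>z / cis \<theta>\<close> by a small Lipschitz function. This gives injectivity,
  control of norms, and surjectivity by a fixed point argument on discs of explicit size, where a bare inverse
  function theorem would give neither the size nor the uniformity.
\<close>

lemma \<Psi>_nearly_isometric:
  assumes "norm a < R/2" "norm b < R/2"
  shows "norm (cis \<theta> * (\<Psi> a - \<Psi> b) - (a - b)) \<le> norm (a - b) / 8"
proof -
  define f where "f = (\<lambda>z. z * (exp (e z) - 1) / 2)"
  have "norm (f a - f b) \<le> 4 * (R * \<delta>) / R * norm (a - b)"
  proof (rule holomorphic_bounded_imp_lipschitz)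
    show "f holomorphic_on ball 0 R" unfolding f_def by (intro holomorphic_intros e_hol) auto
    fix z :: complex assume "z \<in> ball 0 R"
    then have z: "norm z < R" by simp
    have "norm (f z) = norm z * (norm (exp (e z) - 1) / 2)" by (simp add: f_def norm_mult norm_divide)
    also have "\<dots> \<le> R * \<delta>"
      using exp_e_minus_1[OF z] e_le_\<delta>[OF z] z R by (intro mult_mono) auto
    finally show "norm (f z) \<le> R * \<delta>" .
  qed (use R assms in auto)
  also have "\<dots> \<le> norm (a - b) / 8"
    using R \<delta> mult_right_mono[of "4 * \<delta>" "1/8" "norm (a - b)"] by simp
  also have "f a - f b = cis \<theta> * (\<Psi> a - \<Psi> b) - (a - b)"
    by (simp add: f_def \<Psi>_def field_simps)
  finally show ?thesis .
qed

lemma \<Psi>_inj: "inj_on \<Psi> (ball 0 (R/2))"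
proof (rule inj_onI)
  fix a b assume "a \<in> ball 0 (R/2)" "b \<in> ball 0 (R/2)" "\<Psi> a = \<Psi> b"
  then show "a = b" using \<Psi>_nearly_isometric[of a b] norm_minus_commute[of a b] by simp
qed

lemma \<Psi>_norm:
  assumes "norm z < R/2" shows "norm (\<Psi> z) \<le> 9/8 * norm z" "7/8 * norm z \<le> norm (\<Psi> z)"
proof -
  have "norm (cis \<theta> * \<Psi> z - z) \<le> norm z / 8"
    using \<Psi>_nearly_isometric[of z 0] assms R by (simp add: \<Psi>_0)
  moreover have "norm (cis \<theta> * \<Psi> z) = norm (\<Psi> z)" by (simp add: norm_mult)
  ultimately show "norm (\<Psi> z) \<le> 9/8 * norm z" "7/8 * norm z \<le> norm (\<Psi> z)"
    using norm_triangle_ineq2[of "cis \<theta> * \<Psi> z" z] norm_triangle_ineq3[of "cis \<theta> * \<Psi> z" z] by auto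
qed

lemma \<Psi>_surj:
  assumes p: "norm p < R/8" obtains z where "norm z < R/4" "\<Psi> z = p"
proof -
  define T where "T = (\<lambda>z. z + cis \<theta> * (p - \<Psi> z))"
  have lip: "norm (T a - T b) \<le> 1/8 * norm (a - b)" if "norm a < R/2" "norm b < R/2" for a b
  proof -
    have "T a - T b = - (cis \<theta> * (\<Psi> a - \<Psi> b) - (a - b))" by (simp add: T_def algebra_simps)
    then show ?thesis using \<Psi>_nearly_isometric[OF that] by (simp only: norm_minus_cancel)
  qed
  have "\<exists>!x\<in>cball 0 (R/5). T x = x"
  proof (rule Banach_fix[where c = "1/8"])
    show "T ` cball 0 (R/5) \<subseteq> cball 0 (R/5)"
    proof clarify
      fix z :: complex assume "z \<in> cball 0 (R/5)"
      then have z: "norm z \<le> R/5" by simp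
      have "norm (T z) \<le> norm (T z - T 0) + norm (T 0)" using norm_triangle_ineq[of "T z - T 0" "T 0"] by simp
      also have "norm (T 0) = norm p" by (simp add: T_def \<Psi>_0 norm_mult)
      also have "norm (T z - T 0) \<le> 1/8 * norm (z - 0)" by (rule lip) (use z R in auto)
      finally show "T z \<in> cball 0 (R/5)" using z p R by simp
    qed
    show "\<And>x y. x \<in> cball 0 (R/5) \<Longrightarrow> y \<in> cball 0 (R/5) \<Longrightarrow> dist (T x) (T y) \<le> 1/8 * dist x y"
      unfolding dist_norm by (rule lip) (use R in auto)
  qed (use R in \<open>auto intro: compact_imp_complete\<close>)
  then obtain z where "norm z \<le> R/5" "T z = z" by auto
  then show ?thesis using that[of z] R by (auto simp: T_def)
qed

lemma norm_F_le: "norm z < R \<Longrightarrow> norm (F z) \<le> 2 * norm z"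
proof -
  assume z: "norm z < R"
  have "exp (Re (e z)) \<le> exp \<delta>" using e_le_\<delta>[OF z] complex_Re_le_cmod[of "e z"] by simp
  also note exp_\<delta>
  finally have "norm z * exp (Re (e z)) \<le> norm z * 2" by (intro mult_left_mono) auto
  then show ?thesis by (simp add: F norm_mult norm_exp_eq_Re mult.commute)
qed

lemma divide_cis: "z / cis \<theta> = z * cis (- \<theta>)"
  by (simp add: divide_inverse cis_inverse)

lemma cnj_cis: "cnj (cis \<theta>) = cis (- \<theta>)" "cnj (cis (- \<theta>)) = cis \<theta>"
  by (simp_all add: complex_eq_iff)

lemma \<Psi>_on_C:
  assumes "norm z < R" "z \<in> C" shows "\<Psi> z = of_real (Re (z / cis \<theta>))"
proof -
  have "F z = cnj z" using C assms by blast
  then have "\<Psi> z = (z / cis \<theta> + cnj (z / cis \<theta>)) / 2"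
    unfolding \<Psi>_F divide_cis complex_cnj_mult cnj_cis by (simp add: mult.commute)
  then show ?thesis unfolding complex_add_cnj by simp
qed

text \<open>
  By \<open>inv\<close>, \<open>\<Psi>\<close> maps \<open>cnj (F z)\<close> to \<open>cnj (\<Psi> z)\<close>. If \<open>\<Psi> z\<close> is real, then \<open>\<Psi>\<close> takes the same value at \<open>z\<close> and
  \<open>cnj (F z)\<close>, and injectivity makes these equal.
\<close>

lemma C_iff:
  assumes z: "norm z < R/4" shows "z \<in> C \<longleftrightarrow> Im (\<Psi> z) = 0"
proof
  assume "z \<in> C" then show "Im (\<Psi> z) = 0" using \<Psi>_on_C[of z] z R by simp
next
  assume re: "Im (\<Psi> z) = 0"
  define z' where "z' = cnj (F z)"
  have zR: "norm z < R" "norm z < R/2" using z R by auto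
  have z': "norm z' < R/2" using norm_F_le[OF zR(1)] z by (simp add: z'_def)
  have "F z' = cnj z" unfolding z'_def using inv[of z] zR z' by (simp add: z'_def)
  then have "\<Psi> z' = (z' * cis (- \<theta>) + cis \<theta> * cnj z) / 2"
    by (simp only: \<Psi>_F[of z'] divide_cis)
  also have "\<dots> = cnj (\<Psi> z)"
    unfolding \<Psi>_F[of z] divide_cis complex_cnj_divide complex_cnj_add complex_cnj_mult cnj_cis z'_def
    by (simp add: add.commute mult.commute)
  also have "\<dots> = \<Psi> z" using re by (simp add: complex_eq_iff)
  finally have "z' = z" using \<Psi>_inj zR z' by (auto simp: inj_on_def)
  then have "F z = cnj z" unfolding z'_def by (metis complex_cnj_cnj)
  then show "z \<in> C" using C zR by blast
qed

lemma Z_norm: "\<zeta> \<in> Z \<Longrightarrow> norm (exp \<zeta>) < R/16"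
  using small by (simp add: Z_def)

lemma Z_in_C: assumes "\<zeta> \<in> Z" shows "exp \<zeta> \<in> C"
proof -
  have "F (exp \<zeta>) = exp (\<zeta> - 2 * \<i> * of_real \<theta> + e (exp \<zeta>))"
    by (simp add: F algebra_simps flip: exp_add)
  also have "\<dots> = cnj (exp \<zeta>)" using assms by (simp add: Z_def exp_cnj)
  finally show ?thesis using C[of "exp \<zeta>"] Z_norm[OF assms] R by simp
qed

text \<open>
  The branch of the logarithm with imaginary part near \<open>\<theta>\<close>. It lifts the half of the curve on the side of
  \<open>cis \<theta>\<close> back to \<open>Z\<close>.
\<close>

definition \<xi> :: "complex \<Rightarrow> complex" where "\<xi> z = Ln (z / cis \<theta>) + \<i> * of_real \<theta>"

text \<open>
  Taking logarithms in \<open>F z = cnj z\<close> leaves a multiple of \<open>2\<pi>\<i>\<close> undetermined. It is \<open>0\<close> because the point lies in the half plane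
  around \<open>cis \<theta>\<close> and \<open>e z\<close> is small. The imaginary part of the lifted equation then shows
  \<open>2 \<bar>Im (\<xi> z) - \<theta>\<bar> = \<bar>e z\<bar>\<close>, which is the tangency to \<open>cis \<theta>\<close>.
\<close>

lemma \<xi>_props:
  assumes z: "norm z < R/4" "z \<in> C" "0 < Re (\<Psi> z)"
  shows "exp (\<xi> z) = z" "\<xi> z - 2 * \<i> * of_real \<theta> + e z = cnj (\<xi> z)"
    "\<bar>Im (\<xi> z) - \<theta>\<bar> \<le> \<delta> * norm z / R" "Re (\<xi> z) = ln (norm z)" "0 < Re (z / cis \<theta>)"
proof -
  show pos: "0 < Re (z / cis \<theta>)" using \<Psi>_on_C[of z] z R by simp
  then have nz: "z \<noteq> 0" by auto
  show ex: "exp (\<xi> z) = z" using nz by (simp add: \<xi>_def exp_add cis_conv_exp)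
  have zR: "norm z < R" using z R by simp
  have im: "\<bar>Im (\<xi> z) - \<theta>\<bar> < pi/2"
    using pos Re_Ln_pos_lt[of "z / cis \<theta>"] nz by (auto simp: \<xi>_def)
  define D where "D = \<xi> z - 2 * \<i> * of_real \<theta> + e z - cnj (\<xi> z)"
  have D: "D = 2 * \<i> * of_real (Im (\<xi> z) - \<theta>) + e z"
    by (simp add: D_def complex_eq_iff)
  have "exp (\<xi> z - 2 * \<i> * of_real \<theta> + e z) = z * exp (- 2 * \<i> * of_real \<theta> + e z)"
  proof -
    have "exp (\<xi> z - 2 * \<i> * of_real \<theta> + e z) = exp (\<xi> z) * exp (- 2 * \<i> * of_real \<theta> + e z)"
      by (simp add: algebra_simps flip: exp_add)
    then show ?thesis by (simp only: ex)
  qed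
  also have "\<dots> = cnj z" using C[OF zR] z by (simp add: F)
  also have "\<dots> = exp (cnj (\<xi> z))" by (simp add: ex flip: exp_cnj)
  finally have "exp D = 1" by (simp add: D_def exp_diff)
  then obtain n :: int where n: "Re D = 0" "Im D = of_int (2 * n) * pi"
    unfolding exp_eq_1 by auto
  have "norm D \<le> norm (2 * \<i> * of_real (Im (\<xi> z) - \<theta>)) + norm (e z)"
    unfolding D by (rule norm_triangle_ineq)
  also have "\<dots> < pi + 1" using im e_le_\<delta>[OF zR] \<delta> by (simp add: norm_mult del: of_real_diff)
  also have "\<dots> < 2 * pi" using pi_gt3 by simp
  finally have "\<bar>of_int (2 * n) * pi\<bar> < 2 * pi" using abs_Im_le_cmod[of D] n by simp
  then have "\<bar>of_int n\<bar> < (1::real)" by (simp add: abs_mult)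
  then have "n = 0" by linarith
  then have "D = 0" using n by (simp add: complex_eq_iff)
  then show eq: "\<xi> z - 2 * \<i> * of_real \<theta> + e z = cnj (\<xi> z)" by (simp add: D_def)
  have half: "x \<le> c" if "2 * x = y" "y \<le> c" "0 \<le> x" for x y c :: real using that by linarith
  have "2 * \<bar>Im (\<xi> z) - \<theta>\<bar> = norm (2 * \<i> * of_real (Im (\<xi> z) - \<theta>))" by (simp add: norm_mult del: of_real_diff)
  also have "\<dots> = norm (e z)" using \<open>D = 0\<close> D by (metis add_eq_0_iff norm_minus_cancel)
  finally show "\<bar>Im (\<xi> z) - \<theta>\<bar> \<le> \<delta> * norm z / R"
    by (rule half[OF _ e_le[OF zR] abs_ge_zero])
  show "Re (\<xi> z) = ln (norm z)" using nz by (simp add: \<xi>_def norm_divide)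
qed

text \<open>
  In logarithmic coordinates the curve is the graph of a function of \<open>Re \<xi>\<close> with Lipschitz constant \<open>\<delta>\<close>. This is
  stronger than smoothness at the origin, as it holds on all of the curve uniformly.
\<close>

lemma \<xi>_Im_lipschitz:
  assumes "norm a < R/4" "a \<in> C" "0 < Re (\<Psi> a)" "norm b < R/4" "b \<in> C" "0 < Re (\<Psi> b)"
  shows "\<bar>Im (\<xi> a) - Im (\<xi> b)\<bar> \<le> \<delta> * \<bar>Re (\<xi> a) - Re (\<xi> b)\<bar>"
proof -
  note A = \<xi>_props[OF assms(1-3)] and B = \<xi>_props[OF assms(4-6)]
  define d where "d = \<bar>Im (\<xi> a) - Im (\<xi> b)\<bar>"
  have im: "e z = - 2 * \<i> * of_real (Im (\<xi> z) - \<theta>)" if "\<xi> z - 2 * \<i> * of_real \<theta> + e z = cnj (\<xi> z)" for z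
    using that by (simp add: complex_eq_iff)
  have "e a - e b = - 2 * \<i> * of_real (Im (\<xi> a) - Im (\<xi> b))"
    unfolding im[OF A(2)] im[OF B(2)] by (simp add: algebra_simps)
  then have "2 * d = norm (e a - e b)" by (simp add: d_def norm_mult flip: of_real_diff)
  also have "\<dots> \<le> 4 * \<delta> / R * norm (a - b)" by (rule e_lipschitz) (use assms R in auto)
  also have "norm (a - b) \<le> R/4 * norm (\<xi> a - \<xi> b)"
  proof -
    have pos: "0 < norm a" "0 < norm b" using A(5) B(5) by auto
    have "Re (\<xi> a) \<le> ln (R/4)" "Re (\<xi> b) \<le> ln (R/4)" using A(4) B(4) assms pos R by auto
    then show ?thesis using norm_exp_diff_le[of "\<xi> a" "ln (R/4)" "\<xi> b"] A(1) B(1) R by simp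
  qed
  finally have "2 * d \<le> \<delta> * norm (\<xi> a - \<xi> b)" using R \<delta> by (simp add: field_simps)
  also have "\<dots> \<le> \<delta> * (\<bar>Re (\<xi> a) - Re (\<xi> b)\<bar> + d)"
    using cmod_le[of "\<xi> a - \<xi> b"] \<delta> by (intro mult_left_mono) (auto simp: d_def)
  also have "\<dots> \<le> \<delta> * \<bar>Re (\<xi> a) - Re (\<xi> b)\<bar> + 1 * d"
    using \<delta> mult_right_mono[of \<delta> 1 d] by (simp add: distrib_left d_def)
  finally show ?thesis by (simp add: d_def)
qed

text \<open>
  The real parameter \<open>\<Psi>\<close> of the curve and \<open>Re \<xi>\<close>, the logarithm of the distance to the origin, increase together.
\<close>

lemma \<Psi>_mono:
  assumes a: "norm a < R/4" "a \<in> C" "0 < Re (\<Psi> a)" and b: "norm b < R/4" "b \<in> C" "0 < Re (\<Psi> b)"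
    and le: "Re (\<xi> a) \<le> Re (\<xi> b)"
  shows "Re (\<Psi> a) \<le> Re (\<Psi> b)"
proof -
  have val: "Re (\<Psi> z) = exp (Re (\<xi> z)) * cos (Im (\<xi> z) - \<theta>)" if "norm z < R/4" "z \<in> C" "0 < Re (\<Psi> z)" for z
  proof -
    have "z / cis \<theta> = exp (\<xi> z - \<i> * of_real \<theta>)"
      using \<xi>_props(1)[OF that] by (simp add: exp_diff cis_conv_exp)
    then show ?thesis using \<Psi>_on_C[of z] that R by (simp add: Re_exp)
  qed
  define u v x y where "u = Re (\<xi> a)" and "v = Re (\<xi> b)" and "x = Im (\<xi> a) - \<theta>" and "y = Im (\<xi> b) - \<theta>"
  have uv: "u \<le> v" using le by (simp add: u_def v_def)
  have xy: "\<bar>y - x\<bar> \<le> \<delta> * (v - u)" using \<xi>_Im_lipschitz[OF b a] le by (simp add: u_def v_def x_def y_def)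
  have "\<bar>y\<bar> \<le> \<delta> * norm b / R" using \<xi>_props(3)[OF b] by (simp add: y_def)
  also have "\<dots> \<le> \<delta> * R / R" using b R \<delta> by (intro divide_right_mono mult_left_mono) auto
  finally have "\<bar>y\<bar> \<le> 1/64" using R \<delta> by simp
  then have cy: "1/2 \<le> cos y" using cos_diff_le[of y 0] by simp
  have "exp u * (v - u) \<le> exp v - exp u"
  proof -
    have "exp u * (1 + (v - u)) \<le> exp u * exp (v - u)" by (intro mult_left_mono exp_ge_add_one_self) auto
    then show ?thesis by (simp add: algebra_simps flip: exp_add)
  qed
  then have "exp u * (v - u) * (1/2) \<le> (exp v - exp u) * cos y"
    using cy uv by (intro mult_mono) auto
  moreover have "exp u * (cos x - cos y) \<le> exp u * (\<delta> * (v - u))"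
    using xy cos_diff_le[of x y] by (intro mult_left_mono) auto
  moreover have "exp u * (\<delta> * (v - u)) \<le> exp u * ((1/2) * (v - u))"
    using \<delta> uv by (intro mult_left_mono mult_right_mono) auto
  ultimately have "exp u * cos x \<le> exp v * cos y" by (simp add: algebra_simps)
  then show ?thesis using val[OF a] val[OF b] by (simp add: u_def v_def x_def y_def)
qed

lemma Z_\<xi>:
  assumes "\<zeta> \<in> Z" shows "\<xi> (exp \<zeta>) = \<zeta>" "0 < Re (\<Psi> (exp \<zeta>))"
proof -
  have im: "\<bar>Im \<zeta> - \<theta>\<bar> < 1" using assms by (simp add: Z_def)
  have q: "exp \<zeta> / cis \<theta> = exp (\<zeta> - \<i> * of_real \<theta>)" by (simp add: exp_diff cis_conv_exp)
  have "Ln (exp (\<zeta> - \<i> * of_real \<theta>)) = \<zeta> - \<i> * of_real \<theta>"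
    by (rule Ln_exp) (use im pi_gt3 in auto)
  then show "\<xi> (exp \<zeta>) = \<zeta>" by (simp add: \<xi>_def q)
  have "0 < cos (Im \<zeta> - \<theta>)" using im pi_gt3 by (intro cos_gt_zero_pi) auto
  then have "0 < Re (exp \<zeta> / cis \<theta>)" unfolding q by (simp add: Re_exp)
  then show "0 < Re (\<Psi> (exp \<zeta>))"
    using \<Psi>_on_C[OF _ Z_in_C[OF assms]] Z_norm[OF assms] R by simp
qed

text \<open>
  The inverse \<open>g\<close> of \<open>\<Psi>\<close> parametrises \<open>C\<close> by a real interval. The set \<open>P\<close> of parameters \<open>p > 0\<close> whose point
  lifts into \<open>Z\<close> is an interval starting at \<open>0\<close>: moving towards the origin, \<open>Re \<xi>\<close> decreases and \<open>\<bar>Im \<xi>\<bar>\<close> grows by at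
  most \<open>\<delta>\<close> times that amount, so \<open>K \<delta> \<le> 1\<close> keeps \<open>Re \<xi> + K \<bar>Im \<xi>\<bar>\<close> below \<open>m\<close>. The neighbourhood \<open>U\<close> is cut off
  at the end of this interval, so that the image of \<open>Z\<close> is exactly the positive half of \<open>C \<inter> U\<close>.
\<close>

lemma arc:
  obtains U where "open U" "0 \<in> U" "smooth_analytic_arc (C \<inter> U) \<theta>"
    "exp ` Z \<in> components (C \<inter> U - {0})" "tangent_to_half_line (exp ` Z) \<theta>" "connected Z" "Z \<noteq> {}"
proof -
  have sub: "ball 0 (R/4) \<subseteq> ball 0 R" "ball 0 (R/4) \<subseteq> ball 0 (R/2)" using R by auto
  have hol4: "\<Psi> holomorphic_on ball 0 (R/4)" by (rule holomorphic_on_subset[OF \<Psi>_holomorphic sub(1)])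
  obtain g where ghol: "g holomorphic_on \<Psi> ` ball 0 (R/4)"
    and gder: "\<And>z. z \<in> ball 0 (R/4) \<Longrightarrow> deriv \<Psi> z * deriv g (\<Psi> z) = 1"
    and g\<Psi>: "\<And>z. z \<in> ball 0 (R/4) \<Longrightarrow> g (\<Psi> z) = z"
    by (rule holomorphic_has_inverse[OF hol4 open_ball inj_on_subset[OF \<Psi>_inj sub(2)]]) (rule that)
  have img: "ball 0 (R/8) \<subseteq> \<Psi> ` ball 0 (R/4)"
  proof
    fix p :: complex assume "p \<in> ball 0 (R/8)"
    then have "norm p < R/8" by simp
    then show "p \<in> \<Psi> ` ball 0 (R/4)" by (rule \<Psi>_surj) auto
  qed
  have g: "norm (g p) < R/4" "\<Psi> (g p) = p" if p: "norm p < R/8" for p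
  proof -
    obtain z where "norm z < R/4" "\<Psi> z = p" by (rule \<Psi>_surj[OF p]) (rule that)
    then show "norm (g p) < R/4" "\<Psi> (g p) = p" using g\<Psi>[of z] by auto
  qed
  have gnorm: "norm (g p) \<le> 2 * norm p" if p: "norm p < R/8" for p
  proof -
    have "7/8 * norm (g p) \<le> norm p" using \<Psi>_norm(2)[of "g p"] g[OF p] R by simp
    then show ?thesis using norm_ge_zero[of p] by linarith
  qed
  have ghol8: "g holomorphic_on ball 0 (R/8)" by (rule holomorphic_on_subset[OF ghol img])
  have g0: "g 0 = 0" using gnorm[of 0] R by simp
  have gC: "g (of_real t) \<in> C" if "\<bar>t\<bar> < R/8" for t :: real
    using C_iff[of "g (of_real t)"] g[of "of_real t"] that by simp
  have dg: "deriv g 0 = cis \<theta>"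
  proof -
    have "(e has_field_derivative deriv e 0) (at 0)" using holomorphic_derivI[OF e_hol open_ball] R by simp
    then have "(\<Psi> has_field_derivative (1 / cis \<theta>)) (at 0)"
      unfolding \<Psi>_def by (auto intro!: derivative_eq_intros simp: e_0)
    then have "deriv \<Psi> 0 = 1 / cis \<theta>" by (rule DERIV_imp_deriv)
    then show ?thesis using gder[of 0] R by (simp add: \<Psi>_0)
  qed
  define P where "P = {p. 0 < p \<and> p < R/8 \<and> Re (\<xi> (g (of_real p))) + K * \<bar>Im (\<xi> (g (of_real p)))\<bar> < m}"
  have gp: "norm (g (of_real p)) < R/4" "g (of_real p) \<in> C" "0 < Re (\<Psi> (g (of_real p)))"
    if "0 < p" "p < R/8" for p
    using g[of "of_real p"] gC[of p] that by auto
  have \<xi>Z: "\<xi> (g (of_real p)) \<in> Z" if "p \<in> P" for p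
  proof -
    have p: "0 < p" "p < R/8" using that by (auto simp: P_def)
    note x = \<xi>_props[OF gp[OF p]]
    have "\<delta> * norm (g (of_real p)) / R \<le> \<delta> * R / R"
      using gp(1)[OF p] R \<delta> by (intro divide_right_mono mult_left_mono) auto
    then have "\<bar>Im (\<xi> (g (of_real p))) - \<theta>\<bar> < 1" using x(3) R \<delta> by simp
    then show ?thesis using that x(1,2) by (simp add: Z_def P_def)
  qed
  have ZP: "\<exists>p\<in>P. \<zeta> = \<xi> (g (of_real p))" if "\<zeta> \<in> Z" for \<zeta>
  proof -
    define p where "p = Re (\<Psi> (exp \<zeta>))"
    have n: "norm (exp \<zeta>) < R/16" by (rule Z_norm[OF that])
    then have p: "\<Psi> (exp \<zeta>) = of_real p"
      using \<Psi>_on_C[OF _ Z_in_C[OF that]] R by (simp add: p_def)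
    have "norm (\<Psi> (exp \<zeta>)) \<le> 9/8 * norm (exp \<zeta>)" by (rule \<Psi>_norm) (use n R in simp)
    then have "p < R/8" using n p R by simp
    moreover have "0 < p" using Z_\<xi>(2)[OF that] by (simp add: p_def)
    moreover have gz: "g (of_real p) = exp \<zeta>" using g\<Psi>[of "exp \<zeta>"] p n R by simp
    ultimately have "p \<in> P" using Z_\<xi>(1)[OF that] that by (simp add: P_def Z_def)
    then show ?thesis using gz Z_\<xi>(1)[OF that] by (intro bexI[of _ p]) auto
  qed
  have contg: "continuous_on {0<..<R/8} (\<lambda>p::real. g (of_real p))"
    by (intro continuous_on_compose2[OF holomorphic_on_imp_continuous_on[OF ghol8]] continuous_intros) auto
  have cont\<xi>: "continuous_on {0<..<R/8} (\<lambda>p::real. \<xi> (g (of_real p)))"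
    unfolding \<xi>_def
  proof (intro continuous_intros contg)
    fix p :: real assume p: "p \<in> {0<..<R/8}"
    show "g (of_real p) / cis \<theta> \<notin> \<real>\<^sub>\<le>\<^sub>0"
      using \<xi>_props(5)[OF gp[of p]] p by (auto simp: complex_nonpos_Reals_iff)
  qed auto
  have Popen: "open P"
  proof -
    have "open {p \<in> {0<..<R/8}. Re (\<xi> (g (of_real p))) + K * \<bar>Im (\<xi> (g (of_real p)))\<bar> < m}"
      by (rule open_sublevel) (auto intro!: continuous_intros cont\<xi>)
    then show ?thesis by (simp add: P_def conj_assoc)
  qed
  have Pdown: "y \<in> P" if x: "x \<in> P" and y: "0 < y" "y < x" for x y
  proof -
    have xr: "0 < x" "x < R/8" and yr: "0 < y" "y < R/8" using x y by (auto simp: P_def)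
    define a b where "a = \<xi> (g (of_real x))" and "b = \<xi> (g (of_real y))"
    have "\<not> Re a \<le> Re b"
      using \<Psi>_mono[OF gp[OF xr] gp[OF yr]] g(2)[of "of_real x"] g(2)[of "of_real y"] xr yr y by (auto simp: a_def b_def)
    then have ab: "Re b < Re a" by simp
    have "\<bar>Im b - Im a\<bar> \<le> \<delta> * \<bar>Re b - Re a\<bar>"
      unfolding a_def b_def by (rule \<xi>_Im_lipschitz[OF gp[OF yr] gp[OF xr]])
    then have "\<bar>Im b\<bar> \<le> \<bar>Im a\<bar> + \<delta> * (Re a - Re b)" using ab by simp
    then have "K * \<bar>Im b\<bar> \<le> K * (\<bar>Im a\<bar> + \<delta> * (Re a - Re b))" using K by (intro mult_left_mono) auto
    also have "\<dots> = K * \<bar>Im a\<bar> + K * \<delta> * (Re a - Re b)" by (simp add: algebra_simps)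
    also have "K * \<delta> * (Re a - Re b) \<le> 1 * (Re a - Re b)" using K ab by (intro mult_right_mono) auto
    finally show ?thesis using x yr by (simp add: P_def a_def b_def)
  qed
  have Pne: "P \<noteq> {}"
  proof -
    \<comment> \<open>A parameter so small that its point lies in \<open>Z\<close>, whatever its argument between \<open>\<theta> - 1\<close> and \<open>\<theta> + 1\<close>.\<close>
    define p where "p = min (R/16) (exp (m - K * (\<bar>\<theta>\<bar> + 1) - 1) / 2)"
    have p: "0 < p" "p < R/8" "2 * p \<le> exp (m - K * (\<bar>\<theta>\<bar> + 1) - 1)" using R by (auto simp: p_def)
    note x = \<xi>_props[OF gp[OF p(1,2)]]
    have pos: "0 < norm (g (of_real p))" using x(5) by auto
    have "norm (g (of_real p)) \<le> 2 * p" using gnorm[of "of_real p"] p by simp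
    then have "norm (g (of_real p)) \<le> exp (m - K * (\<bar>\<theta>\<bar> + 1) - 1)" using p by simp
    then have "ln (norm (g (of_real p))) \<le> m - K * (\<bar>\<theta>\<bar> + 1) - 1" using pos by (metis ln_exp ln_mono)
    moreover have "\<delta> * norm (g (of_real p)) / R \<le> \<delta> * R / R"
      using gp(1)[OF p(1,2)] R \<delta> by (intro divide_right_mono mult_left_mono) auto
    then have "\<bar>Im (\<xi> (g (of_real p)))\<bar> \<le> \<bar>\<theta>\<bar> + 1" using x(3) R \<delta> by simp
    then have "K * \<bar>Im (\<xi> (g (of_real p)))\<bar> \<le> K * (\<bar>\<theta>\<bar> + 1)" using K by (intro mult_left_mono) auto
    ultimately have "p \<in> P" using p x(4) by (simp add: P_def)
    then show ?thesis by auto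
  qed
  define b where "b = Sup P"
  have bdd: "bdd_above P" by (rule bdd_aboveI[of _ "R/8"]) (auto simp: P_def)
  have Pb: "P = {0<..<b}" unfolding b_def
    by (rule open_lower_set_eq_interval[OF Pne Popen bdd _ Pdown]) (auto simp: P_def)
  have b: "0 < b" "b \<le> R/8"
  proof -
    obtain x where "x \<in> P" using Pne by auto
    then show "0 < b" using Pb by auto
    show "b \<le> R/8" unfolding b_def by (rule cSup_least[OF Pne]) (auto simp: P_def)
  qed
  define U where "U = {z \<in> ball 0 (R/4). norm (\<Psi> z) < b}"
  have U0: "0 \<in> U" using R b by (simp add: U_def \<Psi>_0)
  have cont\<Psi>: "continuous_on (ball 0 (R/4)) \<Psi>" by (rule holomorphic_on_imp_continuous_on[OF hol4])
  have openU: "open U" unfolding U_def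
    by (rule open_sublevel) (auto intro!: continuous_intros cont\<Psi>)
  have CU: "z \<in> C \<inter> U \<longleftrightarrow> (\<exists>t\<in>{-b<..<b}. z = g (of_real t))" for z
  proof
    assume z: "z \<in> C \<inter> U"
    then have nz: "norm z < R/4" "norm (\<Psi> z) < b" by (auto simp: U_def)
    have "Im (\<Psi> z) = 0" using C_iff[OF nz(1)] z by simp
    then have "\<Psi> z = of_real (Re (\<Psi> z))" by (simp add: complex_eq_iff)
    moreover have "\<bar>Re (\<Psi> z)\<bar> < b" using abs_Re_le_cmod[of "\<Psi> z"] nz by simp
    ultimately show "\<exists>t\<in>{-b<..<b}. z = g (of_real t)"
      using g\<Psi>[of z] nz by (intro bexI[of _ "Re (\<Psi> z)"]) auto
  next
    assume "\<exists>t\<in>{-b<..<b}. z = g (of_real t)"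
    then obtain t where "t \<in> {-b<..<b}" and zt: "z = g (of_real t)" by blast
    then have "\<bar>t\<bar> < b" by auto
    note t = this zt
    then show "z \<in> C \<inter> U" using gC[of t] g[of "of_real t"] b by (auto simp: U_def)
  qed
  have arc: "smooth_analytic_arc (C \<inter> U) \<theta>"
    unfolding smooth_analytic_arc_def
  proof (rule exI[of _ b], intro conjI exI[of _ g] exI[of _ "\<lambda>z. Re (\<Psi> z)"])
    show "\<exists>s::real. s \<noteq> 0 \<and> deriv g 0 = of_real s * cis \<theta>" using dg by (intro exI[of _ 1]) simp
    show "g holomorphic_on ball 0 b" by (rule holomorphic_on_subset[OF ghol8]) (use b in auto)
    show "homeomorphism {- b<..<b} (C \<inter> U) (\<lambda>t. g (of_real t)) (\<lambda>z. Re (\<Psi> z))"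
    proof (rule homeomorphismI)
      show "continuous_on {-b<..<b} (\<lambda>t. g (complex_of_real t))"
        by (intro continuous_on_compose2[OF holomorphic_on_imp_continuous_on[OF ghol8]] continuous_intros) (use b in auto)
      show "continuous_on (C \<inter> U) (\<lambda>z. Re (\<Psi> z))"
        by (intro continuous_intros continuous_on_subset[OF cont\<Psi>]) (auto simp: U_def)
      show "(\<lambda>t. g (of_real t)) ` {-b<..<b} \<subseteq> C \<inter> U" using CU by blast
      show "(\<lambda>z. Re (\<Psi> z)) ` (C \<inter> U) \<subseteq> {-b<..<b}"
      proof clarify
        fix z assume "z \<in> C" "z \<in> U"
        then have "\<bar>Re (\<Psi> z)\<bar> < b" using abs_Re_le_cmod[of "\<Psi> z"] by (simp add: U_def)
        then show "Re (\<Psi> z) \<in> {-b<..<b}" by (auto simp: abs_less_iff)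
      qed
      show "Re (\<Psi> (g (of_real t))) = t" if "t \<in> {-b<..<b}" for t
        using g(2)[of "of_real t"] that b by auto
      show "g (of_real (Re (\<Psi> z))) = z" if z: "z \<in> C \<inter> U" for z
      proof -
        obtain t where t: "t \<in> {-b<..<b}" "z = g (of_real t)" using z CU by blast
        then show ?thesis using g(2)[of "of_real t"] b by auto
      qed
    qed
  qed (use b g0 dg in auto)
  have expZ: "exp ` Z = (\<lambda>t. g (of_real t)) ` {0<..<b}"
  proof (intro equalityI subsetI)
    fix z assume "z \<in> exp ` Z"
    then obtain p where "p \<in> P" "z = exp (\<xi> (g (of_real p)))" using ZP by auto
    then show "z \<in> (\<lambda>t. g (of_real t)) ` {0<..<b}"
      using \<xi>_props(1)[OF gp] Pb by (auto simp: P_def)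
  next
    fix z assume "z \<in> (\<lambda>t. g (of_real t)) ` {0<..<b}"
    then obtain p where p: "p \<in> P" "z = g (of_real p)" using Pb by auto
    then have "z = exp (\<xi> (g (of_real p)))" using \<xi>_props(1)[OF gp] by (auto simp: P_def)
    then show "z \<in> exp ` Z" using \<xi>Z[OF p(1)] by auto
  qed
  have Zeq: "Z = (\<lambda>p. \<xi> (g (of_real p))) ` {0<..<b}" using ZP \<xi>Z Pb by auto
  have connZ: "connected Z" unfolding Zeq
    by (rule connected_continuous_image[OF continuous_on_subset[OF cont\<xi>]]) (use b in auto)
  have Zne: "Z \<noteq> {}" using Zeq b by auto
  have comp: "exp ` Z \<in> components (C \<inter> U - {0})"
    unfolding in_components_maximal
  proof (intro conjI allI impI)
    show "exp ` Z \<noteq> {}" using Zne by simp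
    show "exp ` Z \<subseteq> C \<inter> U - {0}" using expZ CU b by fastforce
    show "connected (exp ` Z)" by (intro connected_continuous_image continuous_intros connZ)
    fix D assume D: "D \<noteq> {} \<and> exp ` Z \<subseteq> D \<and> D \<subseteq> C \<inter> U - {0} \<and> connected D"
    have "continuous_on D (\<lambda>z. Re (\<Psi> z))"
      by (intro continuous_intros continuous_on_subset[OF cont\<Psi>]) (use D in \<open>auto simp: U_def\<close>)
    then have con: "connected ((\<lambda>z. Re (\<Psi> z)) ` D)" using D by (intro connected_continuous_image) auto
    have "0 \<notin> (\<lambda>z. Re (\<Psi> z)) ` D"
    proof
      assume "0 \<in> (\<lambda>z. Re (\<Psi> z)) ` D"
      then obtain z where z: "z \<in> D" "Re (\<Psi> z) = 0" by auto
      then obtain t where t: "t \<in> {-b<..<b}" "z = g (of_real t)" using D CU by blast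
      then have "t = 0" using z g(2)[of "of_real t"] b by auto
      then show False using t z D g0 by auto
    qed
    moreover obtain \<zeta> where \<zeta>: "\<zeta> \<in> Z" using Zne by auto
    have "Re (\<Psi> (exp \<zeta>)) \<in> (\<lambda>z. Re (\<Psi> z)) ` D" using D \<zeta> by auto
    ultimately have pos: "0 < x" if "x \<in> (\<lambda>z. Re (\<Psi> z)) ` D" for x
      using connected_contains_Icc[OF con that, of "Re (\<Psi> (exp \<zeta>))"] Z_\<xi>(2)[OF \<zeta>]
      by (metis atLeastAtMost_iff less_imp_le not_le_imp_less subsetD)
    have "D \<subseteq> exp ` Z"
    proof
      fix z assume z: "z \<in> D"
      then obtain t where t: "t \<in> {-b<..<b}" "z = g (of_real t)" using D CU by blast
      have "0 < t" using pos[of "Re (\<Psi> z)"] z t g(2)[of "of_real t"] b by auto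
      then show "z \<in> exp ` Z" unfolding expZ using t by auto
    qed
    then show "D = exp ` Z" using D by auto
  qed
  have tang: "tangent_to_half_line (exp ` Z) \<theta>"
    unfolding tangent_to_half_line_def
  proof (intro conjI)
    show "0 \<in> closure (exp ` Z)"
      unfolding closure_approachable
    proof (intro allI impI)
      fix \<epsilon> :: real assume "\<epsilon> > 0"
      define p where "p = min (b/2) (\<epsilon>/3)"
      have p: "0 < p" "p < b" "2 * p < \<epsilon>" using \<open>\<epsilon> > 0\<close> b by (auto simp: p_def)
      then have "norm (g (of_real p)) < \<epsilon>" using gnorm[of "of_real p"] b by simp
      then show "\<exists>y\<in>exp ` Z. dist y 0 < \<epsilon>" unfolding expZ using p by auto
    qed
    show "0 \<notin> exp ` Z" by auto
    have "((\<lambda>z. \<delta> * norm z / R) \<longlongrightarrow> \<delta> * norm (0::complex) / R) (at 0 within exp ` Z)"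
      by (intro tendsto_intros) (use R in auto)
    then have lim: "((\<lambda>z. \<delta> * norm (z::complex) / R) \<longlongrightarrow> 0) (at 0 within exp ` Z)" by simp
    have "((\<lambda>z. sgn z - cis \<theta>) \<longlongrightarrow> 0) (at 0 within exp ` Z)"
    proof (rule Lim_null_comparison[OF _ lim])
      have "norm (sgn z - cis \<theta>) \<le> \<delta> * norm z / R" if z: "z \<in> exp ` Z" for z
      proof -
        obtain \<zeta> where \<zeta>: "\<zeta> \<in> Z" "z = exp \<zeta>" using z by auto
        have n: "norm z < R/4" using Z_norm[OF \<zeta>(1)] \<zeta>(2) R by simp
        have "sgn z = cis (Im \<zeta>)"
          unfolding \<zeta>(2) sgn_eq norm_exp_eq_Re by (subst exp_eq_polar) simp
        then have "norm (sgn z - cis \<theta>) \<le> \<bar>Im \<zeta> - \<theta>\<bar>" using norm_cis_diff_le by simp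
        then show ?thesis
          using \<xi>_props(3)[OF n] Z_\<xi>[OF \<zeta>(1)] Z_in_C[OF \<zeta>(1)] \<zeta>(2) by simp
      qed
      then show "\<forall>\<^sub>F z in at 0 within exp ` Z. norm (sgn z - cis \<theta>) \<le> \<delta> * norm z / R"
        by (simp add: eventually_at_filter)
    qed
    then show "(sgn \<longlongrightarrow> cis \<theta>) (at 0 within exp ` Z)" by (rule Lim_null[THEN iffD2])
  qed
  show ?thesis by (rule that[OF openU U0 arc comp tang connZ Zne])
qed

end

section \<open>Iterated holonomy and the levels of the Dulac map\<close>

lemma of_nat_le_exp_half: "real n \<le> exp (real n / 2)"
proof -
  have "0 \<le> (real n - 2)\<^sup>2" by simp
  then have "real n \<le> 1 + real n / 2 + (real n / 2)\<^sup>2 / 2"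
    by (simp add: power2_eq_square field_simps)
  also have "\<dots> \<le> exp (real n / 2)" by (rule exp_lower_Taylor_quadratic) simp
  finally show ?thesis .
qed

lemma holomorphic_on_cnj_cnj:
  assumes "f holomorphic_on ball 0 R" shows "(\<lambda>z. cnj (f (cnj z))) holomorphic_on ball 0 R"
proof -
  have "((\<lambda>z. cnj (f (cnj z))) has_field_derivative cnj (deriv f (cnj z))) (at z)" if "z \<in> ball 0 R" for z
  proof (rule has_field_derivative_cnj_cnj[of f "deriv f (cnj z)" z, unfolded o_def])
    show "(f has_field_derivative deriv f (cnj z)) (at (cnj z))"
      by (rule holomorphic_derivI[OF assms open_ball]) (use that in auto)
  qed
  then show ?thesis unfolding holomorphic_on_open[OF open_ball] by blast
qed

context saddle_at
begin

lemma base_radius: "0 < base_radius" "base_radius < hol_radius" using hol_radius by (auto simp: base_radius_def)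

lemma expo_lipschitz_0:
  assumes "norm z < base_radius" shows "norm (expo z - expo 0) \<le> \<delta> * norm z / base_radius"
proof -
  define f where "f = (\<lambda>z. expo z + 2 * of_real pi * \<i> / of_real \<alpha>0)"
  have "norm (f z - f 0) \<le> 4 * \<delta> / hol_radius * norm (z - 0)"
  proof (rule holomorphic_bounded_imp_lipschitz)
    show "f holomorphic_on ball 0 hol_radius" unfolding f_def by (intro holomorphic_intros expo_holomorphic)
    show "norm (f z) \<le> \<delta>" if "z \<in> ball 0 hol_radius" for z
      unfolding f_def using expo_near that by simp
  qed (use hol_radius assms in \<open>auto simp: base_radius_def\<close>)
  then show ?thesis by (simp add: f_def base_radius_def mult_ac)
qed

end

text \<open>
  \<open>\<alpha>\<mu>\<close> is the hyperbolic ratio at the parameter \<open>\<mu>\<close>; then \<open>e\<^sup>-\<^sup>q\<close> is the multiplier of the holonomy.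
\<close>

locale saddle_ratio = saddle_at +
  fixes \<alpha>\<mu> :: real
  assumes \<alpha>\<mu>: "G 0 0 (complex_vec \<mu>) = of_real \<alpha>\<mu>"
begin

lemma \<alpha>\<mu>_near: "\<bar>\<alpha>\<mu> - \<alpha>0\<bar> \<le> \<eta>" "\<alpha>0 * (199/200) \<le> \<alpha>\<mu>" "\<alpha>\<mu> \<le> \<alpha>0 * (201/200)" "0 < \<alpha>\<mu>"
proof -
  have "norm (of_real \<alpha>\<mu> - complex_of_real \<alpha>0) \<le> \<eta>"
    using near[of 0 0 "complex_vec \<mu>"] norm_complex_vec r by (simp add: \<alpha>\<mu>)
  then show n: "\<bar>\<alpha>\<mu> - \<alpha>0\<bar> \<le> \<eta>" by (metis norm_of_real of_real_diff)
  then show "\<alpha>0 * (199/200) \<le> \<alpha>\<mu>" "\<alpha>\<mu> \<le> \<alpha>0 * (201/200)" "0 < \<alpha>\<mu>"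
    using \<eta> \<alpha>0 by (auto simp: abs_le_iff)
qed

definition q :: complex where "q = 2 * of_real pi * \<i> / of_real \<alpha>\<mu>"

lemma expo_0_eq: "expo 0 = - q" by (simp add: expo_0 \<alpha>\<mu> q_def)

lemma Re_q [simp]: "Re q = 0" by (simp add: q_def)

lemma expo_near_q: "norm z < base_radius \<Longrightarrow> norm (expo z + q) \<le> \<delta> * norm z / base_radius"
  using expo_lipschitz_0[of z] by (simp add: expo_0_eq)

text \<open>
  Logarithm of the nonlinear factor of the \<open>k\<close>-th iterate: \<open>h\<^sup>k z = z exp (- k q + iter_log k z)\<close>. Working with it
  instead of the iterate keeps track of the sheet of the covering.
\<close>

primrec iter_log :: "nat \<Rightarrow> complex \<Rightarrow> complex" where
  "iter_log 0 z = 0"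
| "iter_log (Suc k) z = iter_log k z + q + expo (z * exp (- of_nat k * q + iter_log k z))"

definition hol_iter :: "nat \<Rightarrow> complex \<Rightarrow> complex" where "hol_iter k z = z * exp (- of_nat k * q + iter_log k z)"
text \<open>
  Each turn can multiply \<open>\<bar>z\<bar>\<close> by \<open>e\<^sup>\<delta>\<close>, so a radius decaying exponentially in \<open>k\<close> suffices for \<open>k\<close>
  iterations. The faster rate \<open>e\<^sup>-\<^sup>k\<close> also makes the nonlinear part small, see \<open>iter_log_le\<close>.
\<close>

definition iter_radius :: "nat \<Rightarrow> real" where "iter_radius k = base_radius * exp (- real k)"

lemma iter_radius: "0 < iter_radius k" "iter_radius k \<le> base_radius" "j \<le> k \<Longrightarrow> iter_radius k \<le> iter_radius j"
  using base_radius by (auto simp: iter_radius_def mult_left_le)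

lemma norm_hol_iter: "norm (hol_iter k z) = norm z * exp (Re (iter_log k z))"
  by (simp add: hol_iter_def norm_mult norm_exp_eq_Re)

text \<open>
  The \<open>j\<close>-th iterate has modulus at most \<open>\<bar>z\<bar> e\<^sup>j\<^sup>\<delta>\<close>, so the \<open>k\<close> increments of \<open>iter_log\<close> are each at most
  \<open>\<delta> e\<^sup>k\<^sup>\<delta> \<bar>z\<bar> / base_radius\<close>.
\<close>

lemma iter_log_bound:
  assumes "norm z < iter_radius k"
  shows "norm (iter_log k z) \<le> k * \<delta>" "norm (iter_log k z) \<le> k * \<delta> * exp (k * \<delta>) * norm z / base_radius" "norm (hol_iter k z) < base_radius"
proof -
  have "norm (iter_log k z) \<le> k * \<delta> \<and> norm (iter_log k z) \<le> k * \<delta> * exp (k * \<delta>) * norm z / base_radius \<and> norm (hol_iter k z) < base_radius"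
    using assms
  proof (induction k)
    case 0
    then show ?case by (simp add: hol_iter_def iter_radius_def)
  next
    case (Suc k)
    have zk: "norm z < iter_radius k" using Suc.prems iter_radius(3)[of k "Suc k"] by simp
    note IH = Suc.IH[OF zk]
    have Re: "Re (iter_log k z) \<le> k * \<delta>" using IH complex_Re_le_cmod[of "iter_log k z"] by linarith
    have F: "norm (hol_iter k z) \<le> norm z * exp (k * \<delta>)"
      unfolding norm_hol_iter using Re by (intro mult_left_mono) auto
    have ex: "norm (expo (hol_iter k z) + q) \<le> \<delta> * norm (hol_iter k z) / base_radius" by (rule expo_near_q) (use IH in simp)
    have eS: "iter_log (Suc k) z = iter_log k z + (expo (hol_iter k z) + q)" by (simp add: hol_iter_def)
    have n: "norm (iter_log (Suc k) z) \<le> norm (iter_log k z) + \<delta> * norm (hol_iter k z) / base_radius"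
      unfolding eS using norm_triangle_ineq[of "iter_log k z" "expo (hol_iter k z) + q"] ex by linarith
    have "\<delta> * norm (hol_iter k z) / base_radius \<le> \<delta> * base_radius / base_radius"
      using IH \<delta> base_radius by (intro divide_right_mono mult_left_mono) auto
    then have 1: "norm (iter_log (Suc k) z) \<le> Suc k * \<delta>" using n IH base_radius by (simp add: algebra_simps)
    have "\<delta> * norm (hol_iter k z) / base_radius \<le> \<delta> * (norm z * exp (k * \<delta>)) / base_radius"
      using F \<delta> base_radius by (intro divide_right_mono mult_left_mono) auto
    then have "norm (iter_log (Suc k) z) \<le> k * \<delta> * exp (k * \<delta>) * norm z / base_radius + \<delta> * exp (k * \<delta>) * norm z / base_radius"
      using n IH by (simp add: mult_ac)
    also have "\<dots> = Suc k * \<delta> * exp (k * \<delta>) * norm z / base_radius"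
      by (simp add: algebra_simps flip: add_divide_distrib)
    also have "\<dots> \<le> Suc k * \<delta> * exp (Suc k * \<delta>) * norm z / base_radius"
      using \<delta> base_radius by (intro divide_right_mono mult_right_mono mult_left_mono) (auto simp: algebra_simps)
    finally have 2: "norm (iter_log (Suc k) z) \<le> Suc k * \<delta> * exp (Suc k * \<delta>) * norm z / base_radius" .
    have "Re (iter_log (Suc k) z) \<le> Suc k * 1"
      using 1 complex_Re_le_cmod[of "iter_log (Suc k) z"] mult_left_mono[of \<delta> 1 "real (Suc k)"] \<delta> by linarith
    then have "norm (hol_iter (Suc k) z) \<le> norm z * exp (Suc k)" unfolding norm_hol_iter by (intro mult_left_mono) auto
    also have "\<dots> < iter_radius (Suc k) * exp (Suc k)" using Suc.prems by (intro mult_strict_right_mono) auto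
    also have "\<dots> = base_radius" by (simp add: iter_radius_def mult.assoc flip: exp_add)
    finally show ?case using 1 2 by simp
  qed
  then show "norm (iter_log k z) \<le> k * \<delta>" "norm (iter_log k z) \<le> k * \<delta> * exp (k * \<delta>) * norm z / base_radius" "norm (hol_iter k z) < base_radius"
    by auto
qed

text \<open>
  The factor \<open>k e\<^sup>k\<^sup>\<delta>\<close> of \<open>iter_log_bound\<close> is at most \<open>e\<^sup>k\<close>. Relative to the disc of radius \<open>iter_radius k\<close> the
  \<open>k\<close>-th iterate is therefore as close to its linear part as the holonomy itself is on its own disc.
\<close>

lemma iter_log_le:
  assumes "norm z < iter_radius k" shows "norm (iter_log k z) \<le> \<delta> * norm z / iter_radius k"
proof -
  have "k * exp (k * \<delta>) \<le> exp (k / 2) * exp (k / 2)"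
    using of_nat_le_exp_half[of k] mult_left_mono[of \<delta> "1/2" "real k"] \<delta> by (intro mult_mono) auto
  also have "\<dots> = exp k" by (simp flip: exp_add)
  finally have "\<delta> * norm z * (k * exp (k * \<delta>)) / base_radius \<le> \<delta> * norm z * exp k / base_radius"
    using \<delta> base_radius by (intro divide_right_mono mult_left_mono) auto
  also have "\<dots> = \<delta> * norm z / iter_radius k" by (simp add: iter_radius_def exp_minus field_simps)
  finally show ?thesis using iter_log_bound(2)[OF assms] by (simp add: mult_ac)
qed

lemma iter_log_holomorphic: "iter_log k holomorphic_on ball 0 (iter_radius k)"
proof (induction k)
  case 0 then show ?case by simp
next
  case (Suc k)
  have sub: "ball 0 (iter_radius (Suc k)) \<subseteq> ball 0 (iter_radius k)" using iter_radius(3)[of k "Suc k"] by auto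
  have h: "iter_log k holomorphic_on ball 0 (iter_radius (Suc k))" by (rule holomorphic_on_subset[OF Suc sub])
  have "(expo \<circ> (\<lambda>z. z * exp (- of_nat k * q + iter_log k z))) holomorphic_on ball 0 (iter_radius (Suc k))"
  proof (rule holomorphic_on_compose_gen[OF _ expo_holomorphic])
    show "(\<lambda>z. z * exp (- of_nat k * q + iter_log k z)) holomorphic_on ball 0 (iter_radius (Suc k))"
      by (intro holomorphic_intros h)
    show "(\<lambda>z. z * exp (- of_nat k * q + iter_log k z)) ` ball 0 (iter_radius (Suc k)) \<subseteq> ball 0 hol_radius"
      using iter_log_bound(3)[of _ k] sub base_radius unfolding hol_iter_def by (fastforce simp: subset_iff)
  qed
  then show ?case using h by (auto simp: o_def intro!: holomorphic_intros)
qed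

lemma relpow_holonomy_rel_iff:
  assumes "norm z < iter_radius k" shows "(z, z') \<in> holonomy_rel ^^ k \<longleftrightarrow> z' = hol_iter k z"
  using assms
proof (induction k arbitrary: z')
  case 0 then show ?case by (auto simp: hol_iter_def)
next
  case (Suc k)
  have zk: "norm z < iter_radius k" using Suc.prems iter_radius(3)[of k "Suc k"] by simp
  have F: "norm (hol_iter k z) < hol_radius" using iter_log_bound(3)[OF zk] base_radius by simp
  have "(z, z') \<in> holonomy_rel ^^ Suc k \<longleftrightarrow> (hol_iter k z, z') \<in> holonomy_rel"
    using Suc.IH[OF zk] by auto
  also have "\<dots> \<longleftrightarrow> z' = hol_iter k z * exp (expo (hol_iter k z))" by (rule holonomy_rel_iff[OF F])
  also have "hol_iter k z * exp (expo (hol_iter k z)) = hol_iter (Suc k) z"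
    by (simp add: hol_iter_def algebra_simps flip: exp_add)
  finally show ?case .
qed

lemma relpow_holonomy_rel_cnj: "(a, b) \<in> holonomy_rel ^^ k \<Longrightarrow> (cnj b, cnj a) \<in> holonomy_rel ^^ k"
proof (induction k arbitrary: b)
  case 0 then show ?case by simp
next
  case (Suc k)
  then obtain y where y: "(a, y) \<in> holonomy_rel ^^ k" "(y, b) \<in> holonomy_rel" by auto
  show ?case using holonomy_rel_cnj[OF y(2)] Suc.IH[OF y(1)] relpow_Suc_I2 by metis
qed

lemma hol_iter_inv:
  assumes "norm z < iter_radius k" "norm (hol_iter k z) < iter_radius k" shows "hol_iter k (cnj (hol_iter k z)) = cnj z"
proof -
  have "(z, hol_iter k z) \<in> holonomy_rel ^^ k" using relpow_holonomy_rel_iff[OF assms(1)] by simp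
  then have "(cnj (hol_iter k z), cnj z) \<in> holonomy_rel ^^ k" by (rule relpow_holonomy_rel_cnj)
  then show ?thesis using relpow_holonomy_rel_iff[of "cnj (hol_iter k z)" k] assms(2) by simp
qed

definition dulac_level :: "int \<Rightarrow> complex set" where "dulac_level k = {\<zeta> \<in> \<Omega>. Im (L \<zeta>) = of_int k * pi}"
definition tangent_angle :: "nat \<Rightarrow> real" where "tangent_angle n = n * pi / \<alpha>\<mu>"

lemma K: "0 \<le> K" "K * \<delta> \<le> 1" using \<alpha>0 by (auto simp: K_def \<delta>_def field_simps)

lemma q_tangent_angle: "of_nat n * q = 2 * \<i> * of_real (tangent_angle n)"
  by (simp add: q_def tangent_angle_def)

lemma lc1: "Re (complex_of_real (ln c1)) < ln s" using c1 by simp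

lemma L_nearly_affine:
  assumes "a \<in> cone 2" "b \<in> cone 2" shows "norm (L a - L b - of_real \<alpha>0 * (a - b)) \<le> \<alpha>0 / 5 * norm (a - b)"
  unfolding L_def by (rule E_nearly_affine[OF lc1 norm_complex_vec assms])

lemma L_inj: assumes "a \<in> cone 2" "b \<in> cone 2" "L a = L b" shows "a = b"
proof (rule ccontr)
  assume "a \<noteq> b"
  then have n: "0 < norm (a - b)" by simp
  have "\<alpha>0 * norm (a - b) \<le> \<alpha>0 / 5 * norm (a - b)"
    using L_nearly_affine[OF assms(1,2)] assms(3) \<alpha>0 by (simp add: norm_mult)
  then show False using n \<alpha>0 by simp
qed

lemma L_cnj: "\<zeta> \<in> cone 2 \<Longrightarrow> L (cnj \<zeta>) = cnj (L \<zeta>)"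
  unfolding L_def using E_cnj[of \<zeta> "of_real (ln c1)" \<mu>] cone_antimono[of 1 2] lc1 \<mu> by auto

lemma Im_L_near: assumes "\<zeta> \<in> cone 2" shows "\<bar>Im (L \<zeta>) - \<alpha>0 * Im \<zeta>\<bar> \<le> \<alpha>0 / 5 * \<bar>Im \<zeta>\<bar>"
proof -
  have "L \<zeta> - cnj (L \<zeta>) - of_real \<alpha>0 * (\<zeta> - cnj \<zeta>) = 2 * \<i> * of_real (Im (L \<zeta>) - \<alpha>0 * Im \<zeta>)"
    "\<zeta> - cnj \<zeta> = 2 * \<i> * of_real (Im \<zeta>)"
    by (simp_all add: complex_eq_iff)
  then have "norm (2 * \<i> * complex_of_real (Im (L \<zeta>) - \<alpha>0 * Im \<zeta>)) \<le> \<alpha>0 / 5 * norm (2 * \<i> * complex_of_real (Im \<zeta>))"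
    using L_nearly_affine[of \<zeta> "cnj \<zeta>"] assms L_cnj[OF assms] by simp
  then show ?thesis by (simp add: norm_mult del: of_real_diff)
qed

text \<open>
  In \<open>\<Omega>\<close> all intermediate points of the first \<open>n\<close> lifted iterates stay where \<open>L_lift\<close> applies, provided that \<open>n\<close> is not
  much larger than \<open>\<alpha>0 \<bar>Im \<zeta>\<bar> / \<pi>\<close>. The condition on \<open>n\<close> holds for points of level \<open>n\<close> and for points with
  \<open>Im \<zeta>\<close> close to the tangent angle of \<open>C\<^sub>n\<close>, the two sets that have to be compared.
\<close>

lemma iterates_in_range:
  assumes \<zeta>: "\<zeta> \<in> \<Omega>" and n: "n * pi / \<alpha>0 \<le> 6/5 * (\<bar>Im \<zeta>\<bar> + 1)"
  shows "norm (exp \<zeta>) < iter_radius n / 16"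
    and "j \<le> n \<Longrightarrow> \<zeta> - of_nat j * q + iter_log j (exp \<zeta>) \<in> cone 2"
    and "j \<le> n \<Longrightarrow> L (\<zeta> - of_nat j * q + iter_log j (exp \<zeta>)) = L \<zeta> - of_nat j * (2 * of_real pi * \<i>)"
proof -
  define p where "p = \<bar>Im \<zeta>\<bar>"
  have p: "0 \<le> p" by (simp add: p_def)
  have Re: "Re \<zeta> < ln c2 - M - K * p" using \<zeta> by (simp add: \<Omega>_def p_def)
  have npi: "n * pi \<le> 6/5 * (p + 1) * \<alpha>0" using n \<alpha>0 by (simp add: p_def field_simps)
  have "real n * 3 \<le> n * pi" using pi_gt3 by (intro mult_left_mono) auto
  then have n1: "real n \<le> \<alpha>0 / 2 * (p + 1)" using npi p \<alpha>0 by (simp add: algebra_simps)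
  have "real n * \<delta> \<le> \<alpha>0 / 2 * (p + 1) * \<delta>" using n1 \<delta> by (intro mult_right_mono) auto
  also have "\<dots> = (\<delta> * \<alpha>0) * ((p + 1) / 2)" by simp
  also have "\<dots> \<le> 1/64 * ((p + 1) / 2)" using \<delta>(3) p by (intro mult_right_mono) auto
  finally have n\<delta>: "real n * \<delta> \<le> (p + 1) / 128" by simp
  have nRe: "Re \<zeta> + n \<le> ln base_radius - 4"
  proof -
    have "\<alpha>0 / 2 * (p + 1) \<le> K * p + \<alpha>0" using p \<alpha>0 by (simp add: K_def algebra_simps)
    moreover have "M \<ge> ln c2 - ln base_radius + \<alpha>0 + 20" using drift by (simp add: M_def)
    ultimately show ?thesis using n1 Re by linarith
  qed
  have "exp (Re \<zeta>) \<le> exp (ln base_radius - 4 - n)" using nRe by simp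
  also have "\<dots> = iter_radius n * exp (- 4)"
  proof -
    have "ln base_radius - 4 - n = ln base_radius + (- real n) + (- 4)" by simp
    then show ?thesis using base_radius by (simp only: exp_add iter_radius_def exp_ln)
  qed
  also have "\<dots> < iter_radius n * (1/16)"
  proof (intro mult_strict_left_mono iter_radius)
    have "(2::real) < exp 1" using exp_lower_Taylor_quadratic[of "1::real"] by simp
    then have "(2::real) ^ 4 < exp 1 ^ 4" by (intro power_strict_mono) auto
    then have "16 < exp (4::real)" by (simp flip: exp_of_nat_mult)
    then show "exp (- 4) < (1/16 :: real)" by (simp add: exp_minus field_simps)
  qed
  finally show zR: "norm (exp \<zeta>) < iter_radius n / 16" by (simp add: norm_exp_eq_Re)
  have zj: "norm (exp \<zeta>) < iter_radius j" if "j \<le> n" for j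
    using zR iter_radius(1)[of n] iter_radius(3)[OF that] by simp
  have jb: "norm (iter_log j (exp \<zeta>)) \<le> (p + 1) / 128" if "j \<le> n" for j
  proof -
    have "real j * \<delta> \<le> real n * \<delta>" using that \<delta> by (intro mult_right_mono) auto
    then show ?thesis using iter_log_bound(1)[OF zj[OF that]] n\<delta> by linarith
  qed
  have qb: "\<bar>Im (of_nat j * q)\<bar> \<le> 5/2 * (p + 1)" if "j \<le> n" for j
  proof -
    have "\<bar>Im (of_nat j * q)\<bar> = 2 * (j * pi) / \<alpha>\<mu>" using \<alpha>\<mu>_near by (simp add: q_def abs_mult)
    also have "\<dots> \<le> 2 * (6/5 * (p + 1) * \<alpha>0) / \<alpha>\<mu>"
    proof (intro divide_right_mono mult_left_mono)
      have "j * pi \<le> n * pi" using that by simp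
      then show "real j * pi \<le> 6/5 * (p + 1) * \<alpha>0" using npi by linarith
    qed (use \<alpha>\<mu>_near in auto)
    also have "\<dots> \<le> 5/2 * (p + 1)"
    proof -
      have "12/5 * \<alpha>0 \<le> 5/2 * \<alpha>\<mu>" using \<alpha>\<mu>_near \<alpha>0 by linarith
      then have "(p + 1) * (12/5 * \<alpha>0) \<le> (p + 1) * (5/2 * \<alpha>\<mu>)" using p by (intro mult_left_mono) auto
      then show ?thesis using \<alpha>\<mu>_near(4) by (simp add: field_simps)
    qed
    finally show ?thesis .
  qed
  define Zj where "Zj = (\<lambda>j. \<zeta> - of_nat j * q + iter_log j (exp \<zeta>))"
  have est: "Re (Zj j) \<le> Re \<zeta> + (p + 1) / 128" "\<bar>Im (Zj j)\<bar> \<le> 4 * (p + 1)" if "j \<le> n" for j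
  proof -
    have sum: "x \<le> 4 * (p + 1)" if "x \<le> p + y + z" "y \<le> 5/2 * (p + 1)" "z \<le> (p + 1) / 128" for x y z
      using that p by simp
    have e: "Re (iter_log j (exp \<zeta>)) \<le> (p + 1) / 128" "\<bar>Im (iter_log j (exp \<zeta>))\<bar> \<le> (p + 1) / 128"
      using jb[OF that] complex_Re_le_cmod[of "iter_log j (exp \<zeta>)"] abs_Im_le_cmod[of "iter_log j (exp \<zeta>)"] by linarith+
    then show "Re (Zj j) \<le> Re \<zeta> + (p + 1) / 128" by (simp add: Zj_def)
    have "\<bar>Im (Zj j)\<bar> \<le> p + \<bar>Im (of_nat j * q)\<bar> + \<bar>Im (iter_log j (exp \<zeta>))\<bar>"
      unfolding Zj_def p_def by simp
    then show "\<bar>Im (Zj j)\<bar> \<le> 4 * (p + 1)" by (rule sum[OF _ qb[OF that] e(2)])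
  qed
  have Kp: "9 * p \<le> K * p" using p \<alpha>0 by (intro mult_right_mono) (auto simp: K_def)
  have M': "20 \<le> M" "4 * drift + 20 \<le> M" "ln c2 - ln hol_radius + 20 \<le> M" using drift \<alpha>0 by (auto simp: M_def)
  have cone: "Zj j \<in> cone 2" if "j \<le> n" for j
  proof -
    have sum: "2 * y < c - x" if "x \<le> a + (p + 1) / 128" "y \<le> 4 * (p + 1)" "a < c - M - K * p" for x y a c
      using that Kp M'(1) p by argo
    show ?thesis unfolding cone_def mem_Collect_eq by (rule sum[OF est[OF that] Re])
  qed
  then show "\<zeta> - of_nat j * q + iter_log j (exp \<zeta>) \<in> cone 2" if "j \<le> n"
    using that by (simp add: Zj_def)
  have "L (Zj j) = L \<zeta> - of_nat j * (2 * of_real pi * \<i>)" if "j \<le> n"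
    using that
  proof (induction j)
    case 0 then show ?case by (simp add: Zj_def)
  next
    case (Suc j)
    have j: "j \<le> n" using Suc by simp
    have ex: "exp (Zj j) = hol_iter j (exp \<zeta>)" by (simp add: Zj_def hol_iter_def algebra_simps flip: exp_add)
    have "Zj (Suc j) = Zj j + expo (exp (Zj j))"
      unfolding ex by (simp add: Zj_def hol_iter_def algebra_simps)
    moreover have "4 * drift < ln c2 - Re (Zj j)" using est(1)[OF j] Re Kp M'(2) p by argo
    moreover have "Re (Zj j) < ln hol_radius" using est(1)[OF j] Re Kp M'(3) p by argo
    ultimately have "L (Zj (Suc j)) = L (Zj j) - 2 * of_real pi * \<i>"
      using L_lift[OF cone[OF j]] by simp
    then show ?case using Suc.IH[OF j] by (simp add: algebra_simps)
  qed
  then show "j \<le> n \<Longrightarrow> L (\<zeta> - of_nat j * q + iter_log j (exp \<zeta>)) = L \<zeta> - of_nat j * (2 * of_real pi * \<i>)"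
    by (simp add: Zj_def)
qed

lemma near_tangent_angle_bound:
  assumes "\<bar>Im \<zeta> - tangent_angle n\<bar> < 1" shows "n * pi / \<alpha>0 \<le> 6/5 * (\<bar>Im \<zeta>\<bar> + 1)"
proof -
  have "tangent_angle n \<le> \<bar>Im \<zeta>\<bar> + 1" using assms by linarith
  then have "tangent_angle n * \<alpha>\<mu> \<le> (\<bar>Im \<zeta>\<bar> + 1) * \<alpha>\<mu>" using \<alpha>\<mu>_near by (intro mult_right_mono) auto
  also have "\<dots> \<le> (\<bar>Im \<zeta>\<bar> + 1) * (6/5 * \<alpha>0)" using \<alpha>\<mu>_near \<alpha>0 by (intro mult_left_mono) auto
  also have "tangent_angle n * \<alpha>\<mu> = n * pi" using \<alpha>\<mu>_near by (simp add: tangent_angle_def)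
  finally show ?thesis using \<alpha>0 by (simp add: field_simps)
qed

text \<open>
  The heart of the matter. On the level \<open>n\<close>, \<open>L\<close> takes the value \<open>L \<zeta> - 2n\<pi>\<i> = cnj (L \<zeta>) = L (cnj \<zeta>)\<close> at the \<open>n\<close>-th lifted
  iterate of \<open>\<zeta>\<close>, and \<open>L\<close> is injective on \<open>cone 2\<close>. The bound on \<open>Im \<zeta>\<close> selects the right sheet; it follows from the equation.
\<close>

lemma dulac_level_of_nat_iff:
  "\<zeta> \<in> dulac_level (int n) \<longleftrightarrow> \<zeta> \<in> \<Omega> \<and> \<bar>Im \<zeta> - tangent_angle n\<bar> < 1 \<and> \<zeta> - 2 * \<i> * of_real (tangent_angle n) + iter_log n (exp \<zeta>) = cnj \<zeta>"
proof
  assume "\<zeta> \<in> dulac_level (int n)"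
  then have \<zeta>: "\<zeta> \<in> \<Omega>" and im: "Im (L \<zeta>) = n * pi" by (auto simp: dulac_level_def)
  note c = \<Omega>_cone[OF \<zeta>]
  have "\<bar>n * pi - \<alpha>0 * Im \<zeta>\<bar> \<le> \<alpha>0 / 5 * \<bar>Im \<zeta>\<bar>" using Im_L_near[OF c] im by simp
  moreover have "\<alpha>0 * Im \<zeta> \<le> \<alpha>0 * \<bar>Im \<zeta>\<bar>" using \<alpha>0 by (intro mult_left_mono) auto
  moreover have "n * pi - \<alpha>0 * Im \<zeta> \<le> \<bar>n * pi - \<alpha>0 * Im \<zeta>\<bar>" by (rule abs_ge_self)
  ultimately have "n * pi \<le> \<alpha>0 * \<bar>Im \<zeta>\<bar> + \<alpha>0 / 5 * \<bar>Im \<zeta>\<bar>" by linarith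
  then have "n * pi \<le> 6/5 * \<bar>Im \<zeta>\<bar> * \<alpha>0" by (simp add: algebra_simps)
  then have "n * pi / \<alpha>0 \<le> 6/5 * \<bar>Im \<zeta>\<bar>" using \<alpha>0 by (simp add: field_simps)
  then have n: "n * pi / \<alpha>0 \<le> 6/5 * (\<bar>Im \<zeta>\<bar> + 1)" by simp
  note it = iterates_in_range[OF \<zeta> n]
  have "L (\<zeta> - of_nat n * q + iter_log n (exp \<zeta>)) = cnj (L \<zeta>)"
    using it(3)[of n] im by (simp add: complex_eq_iff)
  also have "\<dots> = L (cnj \<zeta>)" using L_cnj[OF c] by simp
  finally have eq: "\<zeta> - of_nat n * q + iter_log n (exp \<zeta>) = cnj \<zeta>"
    using L_inj[OF it(2)[of n]] c by simp
  have R: "norm (exp \<zeta>) < iter_radius n" using it(1) iter_radius(1)[of n] by simp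
  have "2 * \<i> * of_real (Im \<zeta> - tangent_angle n) = - iter_log n (exp \<zeta>)"
    using eq unfolding q_tangent_angle by (simp add: complex_eq_iff)
  then have "2 * \<bar>Im \<zeta> - tangent_angle n\<bar> = norm (iter_log n (exp \<zeta>))"
    by (metis norm_minus_cancel norm_mult norm_ii norm_numeral norm_of_real mult.right_neutral)
  also have "\<dots> \<le> \<delta> * norm (exp \<zeta>) / iter_radius n" by (rule iter_log_le[OF R])
  also have "\<dots> \<le> \<delta> * iter_radius n / iter_radius n" using R iter_radius(1)[of n] \<delta> by (intro divide_right_mono mult_left_mono) auto
  finally have "\<bar>Im \<zeta> - tangent_angle n\<bar> < 1" using \<delta> iter_radius(1)[of n] by simp
  then show "\<zeta> \<in> \<Omega> \<and> \<bar>Im \<zeta> - tangent_angle n\<bar> < 1 \<and> \<zeta> - 2 * \<i> * of_real (tangent_angle n) + iter_log n (exp \<zeta>) = cnj \<zeta>"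
    using \<zeta> eq by (simp only: q_tangent_angle)
next
  assume "\<zeta> \<in> \<Omega> \<and> \<bar>Im \<zeta> - tangent_angle n\<bar> < 1 \<and> \<zeta> - 2 * \<i> * of_real (tangent_angle n) + iter_log n (exp \<zeta>) = cnj \<zeta>"
  then have \<zeta>: "\<zeta> \<in> \<Omega>" and near: "\<bar>Im \<zeta> - tangent_angle n\<bar> < 1"
    and eq: "\<zeta> - of_nat n * q + iter_log n (exp \<zeta>) = cnj \<zeta>" by (auto simp only: q_tangent_angle)
  have "cnj (L \<zeta>) = L (cnj \<zeta>)" using L_cnj[OF \<Omega>_cone[OF \<zeta>]] by simp
  also have "\<dots> = L \<zeta> - of_nat n * (2 * of_real pi * \<i>)"
    using iterates_in_range(3)[OF \<zeta> near_tangent_angle_bound[OF near], of n] eq by simp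
  finally show "\<zeta> \<in> dulac_level (int n)" using \<zeta> by (simp add: dulac_level_def complex_eq_iff)
qed

lemma cnj_dulac_level: "cnj \<zeta> \<in> dulac_level k \<longleftrightarrow> \<zeta> \<in> dulac_level (- k)"
  using L_cnj[OF \<Omega>_cone, of \<zeta>] by (auto simp: dulac_level_def)

definition reflected_curve :: "int \<Rightarrow> complex set" where
  "reflected_curve k = {z. (z, cnj z) \<in> int_relpow holonomy_rel k}"

lemma reflected_curve_of_nat: "norm z < iter_radius n \<Longrightarrow> z \<in> reflected_curve (int n) \<longleftrightarrow> hol_iter n z = cnj z"
  using relpow_holonomy_rel_iff[of z n "cnj z"] by (auto simp: reflected_curve_def int_relpow_def)

lemma relpow_converse:
  fixes S :: "('b \<times> 'b) set"
  shows "(a, b) \<in> (S\<inverse>) ^^ n \<longleftrightarrow> (b, a) \<in> S ^^ n"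
proof (induction n arbitrary: b)
  case 0 then show ?case by auto
next
  case (Suc n)
  have "(a, b) \<in> (S\<inverse>) ^^ Suc n \<longleftrightarrow> (\<exists>y. (y, a) \<in> S ^^ n \<and> (b, y) \<in> S)"
    using Suc.IH by auto
  also have "\<dots> \<longleftrightarrow> (b, a) \<in> S O S ^^ n" by auto
  finally show ?case by (simp add: relpow_commute)
qed

lemma reflected_curve_uminus: "z \<in> reflected_curve (- int n) \<longleftrightarrow> cnj z \<in> reflected_curve (int n)"
  by (cases "n = 0") (auto simp: reflected_curve_def int_relpow_def relpow_converse)

text \<open>
  For \<open>k \<ge> 0\<close> the facts about iterates are those required by \<open>reflection_arc\<close>. The case \<open>k < 0\<close> is the mirror image of \<open>- k\<close> under
  conjugation, which exchanges the levels \<open>k\<close> and \<open>- k\<close> as well as the curves \<open>C\<^sub>k\<close> and \<open>C\<^sub>-\<^sub>k\<close>.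
\<close>

lemma arc_of_index:
  obtains U where "open U" "0 \<in> U" "smooth_analytic_arc (reflected_curve k \<inter> U) (of_int k * pi / \<alpha>\<mu>)"
    "exp ` dulac_level k \<in> components (reflected_curve k \<inter> U - {0})" "tangent_to_half_line (exp ` dulac_level k) (of_int k * pi / \<alpha>\<mu>)"
    "connected (dulac_level k)" "dulac_level k \<noteq> {}"
proof (cases "0 \<le> k")
  case True
  then obtain n where k: "k = int n" by (metis nonneg_int_cases)
  interpret A: reflection_arc "iter_log n" "hol_iter n" "iter_radius n" "tangent_angle n" \<delta> K "ln c2 - M" "reflected_curve (int n)"
  proof
    show "norm (iter_log n z) \<le> \<delta> * norm z / iter_radius n" if "norm z < iter_radius n" for z using iter_log_le[OF that] .
    show "hol_iter n z = z * exp (- 2 * \<i> * of_real (tangent_angle n) + iter_log n z)" for z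
      by (simp add: hol_iter_def q_tangent_angle)
    show "hol_iter n (cnj (hol_iter n z)) = cnj z" if "norm z < iter_radius n / 2" "norm (hol_iter n z) < iter_radius n / 2" for z
      using hol_iter_inv[of z n] that iter_radius(1)[of n] by simp
    show "norm (exp \<zeta>) < iter_radius n / 16" if "Re \<zeta> + K * \<bar>Im \<zeta>\<bar> < ln c2 - M" "\<bar>Im \<zeta> - tangent_angle n\<bar> < 1" for \<zeta>
      by (rule iterates_in_range(1)[OF _ near_tangent_angle_bound[OF that(2)]]) (use that in \<open>simp add: \<Omega>_def\<close>)
  qed (use iter_radius \<delta> K iter_log_holomorphic reflected_curve_of_nat in auto)
  have Z: "A.Z = dulac_level k" unfolding A.Z_def k using dulac_level_of_nat_iff by (auto simp: \<Omega>_def)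
  have \<theta>: "tangent_angle n = of_int k * pi / \<alpha>\<mu>" by (simp add: tangent_angle_def k)
  show ?thesis by (rule A.arc[unfolded Z, unfolded \<theta> k[symmetric]]) (rule that)
next
  case False
  define n where "n = nat (- k)"
  have k: "k = - int n" using False by (simp add: n_def)
  define e where "e = (\<lambda>z. cnj (iter_log n (cnj z)))"
  define F where "F = (\<lambda>z. cnj (hol_iter n (cnj z)))"
  interpret A: reflection_arc e F "iter_radius n" "- tangent_angle n" \<delta> K "ln c2 - M" "reflected_curve k"
  proof
    show "norm (e z) \<le> \<delta> * norm z / iter_radius n" if "norm z < iter_radius n" for z
      using iter_log_le[of "cnj z" n] that by (simp add: e_def)
    show "F z = z * exp (- 2 * \<i> * of_real (- tangent_angle n) + e z)" for z
      by (simp add: F_def e_def hol_iter_def q_tangent_angle exp_cnj add.commute)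
    show "F (cnj (F z)) = cnj z" if "norm z < iter_radius n / 2" "norm (F z) < iter_radius n / 2" for z
      using hol_iter_inv[of "cnj z" n] that iter_radius(1)[of n] by (simp add: F_def)
    show "norm (exp \<zeta>) < iter_radius n / 16" if "Re \<zeta> + K * \<bar>Im \<zeta>\<bar> < ln c2 - M" "\<bar>Im \<zeta> - - tangent_angle n\<bar> < 1" for \<zeta>
    proof -
      have "\<bar>Im (cnj \<zeta>) - tangent_angle n\<bar> < 1" using that(2) by simp
      then show ?thesis
        using iterates_in_range(1)[OF _ near_tangent_angle_bound, of "cnj \<zeta>" n] that by (simp add: \<Omega>_def norm_exp_eq_Re)
    qed
    show "z \<in> reflected_curve k \<longleftrightarrow> F z = cnj z" if "norm z < iter_radius n" for z
      using reflected_curve_of_nat[of "cnj z" n] that unfolding k reflected_curve_uminus F_def by (metis complex_cnj_cnj complex_mod_cnj)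
    show "e holomorphic_on ball 0 (iter_radius n)"
      unfolding e_def by (rule holomorphic_on_cnj_cnj[OF iter_log_holomorphic])
  qed (use iter_radius \<delta> K in auto)
  have "\<zeta> \<in> A.Z \<longleftrightarrow> \<zeta> \<in> dulac_level k" for \<zeta>
  proof -
    have "\<zeta> \<in> dulac_level k \<longleftrightarrow> cnj \<zeta> \<in> dulac_level (int n)" by (simp add: cnj_dulac_level k)
    also have "\<dots> \<longleftrightarrow> \<zeta> \<in> \<Omega> \<and> \<bar>Im \<zeta> - - tangent_angle n\<bar> < 1 \<and> cnj \<zeta> - 2 * \<i> * of_real (tangent_angle n) + iter_log n (exp (cnj \<zeta>)) = \<zeta>"
    proof -
      have "\<bar>Im (cnj \<zeta>) - tangent_angle n\<bar> = \<bar>Im \<zeta> - - tangent_angle n\<bar>"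
        using abs_minus_cancel[of "Im \<zeta> + tangent_angle n"] by simp
      then show ?thesis unfolding dulac_level_of_nat_iff by simp
    qed
    also have "cnj \<zeta> - 2 * \<i> * of_real (tangent_angle n) + iter_log n (exp (cnj \<zeta>)) = \<zeta> \<longleftrightarrow>
      cnj (cnj \<zeta> - 2 * \<i> * of_real (tangent_angle n) + iter_log n (exp (cnj \<zeta>))) = cnj \<zeta>" by (simp only: complex_cnj_cancel_iff)
    also have "cnj (cnj \<zeta> - 2 * \<i> * of_real (tangent_angle n) + iter_log n (exp (cnj \<zeta>))) = \<zeta> - 2 * \<i> * of_real (- tangent_angle n) + e (exp \<zeta>)"
      by (simp add: e_def exp_cnj)
    finally show ?thesis unfolding A.Z_def by (simp add: \<Omega>_def)
  qed
  then have Z: "A.Z = dulac_level k" by blast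
  have \<theta>: "- tangent_angle n = of_int k * pi / \<alpha>\<mu>" by (simp add: tangent_angle_def k)
  show ?thesis by (rule A.arc[unfolded Z, unfolded \<theta>]) (rule that)
qed

end

section \<open>The Dulac extension and the zero locus\<close>

text \<open>
  A continuous function with values in the discrete set \<open>\<pi> \<int>\<close> is constant on connected sets, so its connected
  level sets are the components.
\<close>

lemma components_of_levels:
  fixes f :: "'a::topological_space \<Rightarrow> real"
  assumes f: "continuous_on S f" and lev: "\<And>x. x \<in> S \<Longrightarrow> \<exists>k::int. f x = of_int k * pi"
    and con: "\<And>k::int. connected {x \<in> S. f x = of_int k * pi}" and ne: "\<And>k::int. {x \<in> S. f x = of_int k * pi} \<noteq> {}"
  shows "bij_betw (\<lambda>k::int. {x \<in> S. f x = of_int k * pi}) UNIV (components S)"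
proof -
  define H where "H = (\<lambda>k::int. {x \<in> S. f x = of_int k * pi})"
  have single: "f x = f y" if D: "connected D" "D \<subseteq> S" and xy: "x \<in> D" "y \<in> D" for D x y
  proof -
    have "f constant_on D"
    proof (rule continuous_discrete_range_constant[OF D(1) continuous_on_subset[OF f D(2)]])
      fix x assume "x \<in> D"
      show "\<exists>e>0. \<forall>y. y \<in> D \<and> f y \<noteq> f x \<longrightarrow> e \<le> norm (f y - f x)"
      proof (intro exI[of _ pi] conjI allI impI)
        fix y assume y: "y \<in> D \<and> f y \<noteq> f x"
        obtain j k :: int where jk: "f x = of_int j * pi" "f y = of_int k * pi"
          using lev D(2) \<open>x \<in> D\<close> y by (meson subsetD)
        have "j \<noteq> k" using y jk by auto
        then have "1 \<le> \<bar>of_int k - of_int j :: real\<bar>" by linarith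
        then have "1 * pi \<le> \<bar>of_int k - of_int j\<bar> * pi" by (intro mult_right_mono) auto
        then show "pi \<le> norm (f y - f x)" by (simp add: jk abs_mult flip: left_diff_distrib)
      qed simp
    qed
    then show ?thesis using xy by (auto simp: constant_on_def)
  qed
  have comp: "H k \<in> components S" for k
    unfolding in_components_maximal
  proof (intro conjI allI impI)
    show "H k \<noteq> {}" "H k \<subseteq> S" "connected (H k)" using ne con by (auto simp: H_def)
    fix D assume D: "D \<noteq> {} \<and> H k \<subseteq> D \<and> D \<subseteq> S \<and> connected D"
    obtain x where x: "x \<in> H k" using ne[of k] by (auto simp: H_def)
    have "y \<in> H k" if "y \<in> D" for y
      using single[of D y x] D that x by (auto simp: H_def)
    then show "D = H k" using D by auto
  qed
  have "inj H"
  proof (rule injI)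
    fix j k assume jk: "H j = H k"
    obtain x where x: "x \<in> H j" using ne[of j] by (auto simp: H_def)
    then have "x \<in> H k" using jk by simp
    then have "of_int j * pi = of_int k * pi" using x by (simp add: H_def)
    then show "j = k" by simp
  qed
  moreover have "C \<in> range H" if C: "C \<in> components S" for C
  proof -
    obtain x where x: "x \<in> C" "x \<in> S" using in_components_nonempty[OF C] in_components_subset[OF C] by auto
    obtain k :: int where "f x = of_int k * pi" using lev[OF x(2)] by auto
    then have "x \<in> H k" using x by (simp add: H_def)
    then have "C \<inter> H k \<noteq> {}" using x by auto
    then have "C = H k" using components_nonoverlap[OF C comp[of k]] by blast
    then show ?thesis by auto
  qed
  ultimately show ?thesis using comp unfolding H_def[symmetric] by (auto simp: bij_betw_def)
qed

context saddle_sections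
begin

definition dulac :: "complex^'a \<Rightarrow> real \<times> real \<Rightarrow> complex" where
  "dulac m z = exp (E (Complex (ln (fst z)) (snd z)) (of_real (ln c1)) m)"

definition dulac_radius :: "real \<Rightarrow> real" where "dulac_radius \<phi> = exp (ln c2 - M - K * \<bar>\<phi>\<bar>)"

lemma dulac_cover_point: "dulac m (cover_point \<zeta>) = exp (E \<zeta> (of_real (ln c1)) m)"
  by (simp add: dulac_def cover_point_def)

lemma cover_domain_iff: "z \<in> cover_domain dulac_radius \<longleftrightarrow> 0 < fst z \<and> Complex (ln (fst z)) (snd z) \<in> \<Omega>"
  by (auto simp: cover_domain_def dulac_radius_def \<Omega>_def algebra_simps)
     (metis add.commute exp_less_cancel_iff exp_ln less_diff_eq ln_less_cancel_iff exp_gt_zero ln_exp)+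

lemma cover_point_in_domain: "cover_point \<zeta> \<in> cover_domain dulac_radius \<longleftrightarrow> \<zeta> \<in> \<Omega>"
  unfolding cover_domain_iff by (simp add: cover_point_def)

text \<open>
  \<open>E\<close> is holomorphic along all curves in \<open>cone 1\<close> and in the parameters, and \<open>\<bar>exp E\<bar> \<le> s\<close>.
\<close>

lemma dulac_analytic: "analytic_on_cover r dulac_radius dulac"
  unfolding analytic_on_cover_def
proof (intro allI impI)
  fix \<mu>0 :: "complex^'a" and \<zeta>0 assume h: "norm \<mu>0 < r \<and> cover_point \<zeta>0 \<in> cover_domain dulac_radius"
  then have "\<zeta>0 \<in> cone 1" using cover_point_in_domain \<Omega>_cone cone_antimono[of 1 2] by auto
  then obtain R1 where R1: "R1 > 0" "ball \<zeta>0 R1 \<subseteq> cone 1" using open_cone open_contains_ball by blast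
  \<comment> \<open>Dividing by \<open>CARD('a)\<close>, the whole polydisc of radius \<open>R\<close> around \<open>\<mu>0\<close> lies in the ball of radius \<open>r\<close>.\<close>
  define R where "R = min R1 ((r - norm \<mu>0) / CARD('a))"
  have R: "R > 0" "R \<le> R1" "R \<le> (r - norm \<mu>0) / CARD('a)" using R1 h by (auto simp: R_def)
  have dom: "norm m < r \<and> \<zeta> \<in> cone 1" if m: "\<forall>i. norm (m $ i - \<mu>0 $ i) < R" and z: "norm (\<zeta> - \<zeta>0) < R"
    for m :: "complex^'a" and \<zeta>
  proof
    have "norm (m - \<mu>0) \<le> (\<Sum>i\<in>UNIV. norm ((m - \<mu>0) $ i))"
      unfolding norm_vec_def by (rule L2_set_le_sum) auto
    also have "\<dots> < (\<Sum>i\<in>(UNIV::'a set). R)" by (rule sum_strict_mono) (use m in auto)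
    also have "\<dots> \<le> r - norm \<mu>0" using R(3) by (simp add: field_simps)
    finally show "norm m < r" using norm_triangle_ineq2[of m \<mu>0] by linarith
    show "\<zeta> \<in> cone 1" using R1(2) z R(2) by (auto simp: dist_norm norm_minus_commute)
  qed
  have v0: "Re (complex_of_real (ln c1)) < ln s" using c1 by simp
  show "\<exists>e>0. \<exists>a. \<forall>\<mu> \<zeta>. norm (\<mu> - \<mu>0) < e \<and> norm (\<zeta> - \<zeta>0) < e \<longrightarrow>
     ((\<lambda>(i, \<nu>). a i \<nu> * (\<zeta> - \<zeta>0) ^ i * monomial (\<mu> - \<mu>0) \<nu>) has_sum dulac \<mu> (cover_point \<zeta>)) UNIV"
    unfolding dulac_cover_point
  proof (rule analytic_expansion[OF R(1), of _ _ "\<lambda>\<mu> \<zeta>. exp (E \<zeta> (of_real (ln c1)) \<mu>)" s])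
    show "(\<lambda>z. exp (E (\<zeta> z) (of_real (ln c1)) (m z))) holomorphic_on U"
      if "open U" "\<And>i. (\<lambda>z. m z $ i) holomorphic_on U" "\<zeta> holomorphic_on U"
        "\<And>z. z \<in> U \<Longrightarrow> (\<forall>i. norm (m z $ i - \<mu>0 $ i) < R) \<and> norm (\<zeta> z - \<zeta>0) < R"
      for U \<zeta> and m :: "complex \<Rightarrow> complex^'a"
    proof -
      have d: "norm (m z) < r \<and> \<zeta> z \<in> cone 1" if "z \<in> U" for z
        by (rule dom) (use \<open>\<And>z. z \<in> U \<Longrightarrow> _\<close>[OF that] in auto)
      have "(\<lambda>z. E (\<zeta> z) (of_real (ln c1)) (m z)) holomorphic_on U"
        by (rule holomorphic_E) (use that d v0 in auto)
      then show ?thesis by (intro holomorphic_intros)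
    qed
    show "norm (exp (E \<zeta> (of_real (ln c1)) m)) \<le> s" if "\<forall>i. norm (m $ i - \<mu>0 $ i) < R" "norm (\<zeta> - \<zeta>0) < R" for m \<zeta>
    proof -
      have "Re (sol \<zeta> (of_real (ln c1)) m 1) \<le> Re (complex_of_real (ln c1))"
        by (rule Re_sol_le) (use dom[OF that] v0 in auto)
      then have "Re (E \<zeta> (of_real (ln c1)) m) < ln s" using v0 unfolding E_def by linarith
      then show ?thesis using norm_exp_less less_imp_le by blast
    qed
  qed
qed

end

text \<open>
  The link between \<open>G\<close> and the foliation \<open>x A dy + \<alpha> y B dx = 0\<close>.
\<close>

locale saddle_foliation = saddle_sections G for G :: "complex \<Rightarrow> complex \<Rightarrow> complex^'n::finite \<Rightarrow> complex" +
  fixes \<alpha> :: "real^'n \<Rightarrow> real" and A B :: "complex \<Rightarrow> complex \<Rightarrow> real^'n \<Rightarrow> complex"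
  assumes A_nz: "\<And>x y \<mu>. norm x < r \<Longrightarrow> norm y < r \<Longrightarrow> norm \<mu> < r \<Longrightarrow> A x y \<mu> \<noteq> 0"
    and G_AB: "\<And>x y \<mu>. norm x < r \<Longrightarrow> norm y < r \<Longrightarrow> norm \<mu> < r \<Longrightarrow>
        of_real (\<alpha> \<mu>) * B x y \<mu> = G x y (complex_vec \<mu>) * A x y \<mu>"
    and G_00: "\<And>\<mu>. norm \<mu> < r \<Longrightarrow> G 0 0 (complex_vec \<mu>) = of_real (\<alpha> \<mu>)"
    and \<eta>_small: "832 * \<eta> * (1 + \<alpha>0) \<le> \<alpha>0\<^sup>2"
begin

text \<open>
  For real \<open>x\<close> the segment from \<open>ln x\<close> to \<open>ln c2\<close> and the solution over it are real; exponentiating yields a leaf in the open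
  first quadrant.
\<close>

lemma dulac_rel_dulac:
  assumes \<mu>: "norm \<mu> < r" and x: "0 < x" "x < dulac_radius 0"
  obtains y where "dulac_rel s \<alpha> A B c1 c2 \<mu> x y" "dulac (complex_vec \<mu>) (x, 0) = of_real y"
proof -
  define \<zeta> where "\<zeta> = complex_of_real (ln x)"
  have "(x, 0) \<in> cover_domain dulac_radius" using x by (simp add: cover_domain_def)
  then have "\<zeta> \<in> \<Omega>" unfolding cover_domain_iff by (simp add: \<zeta>_def complex_of_real_def)
  then have \<zeta>: "\<zeta> \<in> cone 1" using \<Omega>_cone cone_antimono[of 1 2] by auto
  have n: "norm (complex_vec \<mu>) < r" using \<mu> by (simp add: norm_complex_vec_eq)
  define y where "y = sol \<zeta> (of_real (ln c1)) (complex_vec \<mu>)"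
  have lc: "Re (complex_of_real (ln c1)) < ln s" using c1 by simp
  have y: "is_sol \<zeta> (of_real (ln c1)) (complex_vec \<mu>) y" unfolding y_def by (rule is_sol_sol[OF \<zeta> lc n])
  have yle: "Re (y t) \<le> ln c1" if "t \<in> {0..1}" for t
    using Re_sol_le[OF \<zeta> lc n that] by (simp add: y_def)
  have yre: "Im (y t) = 0" if "t \<in> {0..1}" for t
    unfolding y_def \<zeta>_def by (rule sol_real) (use \<zeta> c1 \<mu> that in \<open>auto simp: \<zeta>_def\<close>)
  define u v where "u = (\<lambda>t. exp (ln x + t * (ln c2 - ln x)))" and "v = (\<lambda>t. exp (Re (y t)))"
  have u: "of_real (u t) = exp (\<zeta> + of_real t * (of_real (ln c2) - \<zeta>))" for t
    by (simp add: u_def \<zeta>_def flip: exp_of_real)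
  have v: "of_real (v t) = exp (y t)" if "t \<in> {0..1}" for t
  proof -
    have "y t = of_real (Re (y t))" using yre[OF that] by (simp add: complex_eq_iff)
    then show ?thesis unfolding v_def by (metis exp_of_real)
  qed
  have leaf: "leaf_path s \<alpha> A B \<mu> (\<lambda>t. of_real (u t)) (\<lambda>t. of_real (v t))"
    unfolding leaf_path_def
  proof (intro ballI conjI exI)
    fix t :: real assume t: "t \<in> {0..1}"
    have Ret: "Re (y t) < ln s" using y t by (simp add: is_sol_def)
    define X where "X = exp (\<zeta> + of_real t * (of_real (ln c2) - \<zeta>))"
    note R = in_range[OF \<zeta> t Ret]
    show "norm (complex_of_real (u t)) < s" unfolding u by (rule norm_exp_path_less[OF \<zeta> t])
    show "norm (complex_of_real (v t)) < s" unfolding v[OF t] by (rule norm_exp_less[OF Ret])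
    show "((\<lambda>t. complex_of_real (u t)) has_vector_derivative (of_real (ln c2) - \<zeta>) * X) (at t within {0..1})"
    proof -
      have "((\<lambda>t. \<zeta> + of_real t * (of_real (ln c2) - \<zeta>)) has_vector_derivative (of_real (ln c2) - \<zeta>)) (at t within {0..1})"
        by (auto intro!: derivative_eq_intros)
      from field_vector_diff_chain_within[OF this, of exp X]
      show ?thesis unfolding u by (simp add: o_def X_def DERIV_exp has_field_derivative_at_within)
    qed
    have dy: "(y has_vector_derivative field \<zeta> (complex_vec \<mu>) t (y t)) (at t within {0..1})"
      using y t by (simp add: is_sol_def)
    have "((\<lambda>t. exp (y t)) has_vector_derivative field \<zeta> (complex_vec \<mu>) t (y t) * exp (y t)) (at t within {0..1})"
      using field_vector_diff_chain_within[OF dy, of exp "exp (y t)"]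
      by (simp add: o_def DERIV_exp has_field_derivative_at_within)
    then show "((\<lambda>t. complex_of_real (v t)) has_vector_derivative field \<zeta> (complex_vec \<mu>) t (y t) * exp (y t)) (at t within {0..1})"
      by (rule has_vector_derivative_transform[rotated 2]) (use t v in auto)
    have "of_real (\<alpha> \<mu>) * B X (exp (y t)) \<mu> = G X (exp (y t)) (complex_vec \<mu>) * A X (exp (y t)) \<mu>"
      by (rule G_AB) (use R \<mu> in \<open>auto simp: X_def\<close>)
    then have "X * A X (exp (y t)) \<mu> * (field \<zeta> (complex_vec \<mu>) t (y t) * exp (y t)) +
        exp (y t) * (of_real (\<alpha> \<mu>) * B X (exp (y t)) \<mu>) * ((of_real (ln c2) - \<zeta>) * X) = 0"
      by (simp add: field_def X_def algebra_simps)
    then show "of_real (u t) * A (of_real (u t)) (of_real (v t)) \<mu> * (field \<zeta> (complex_vec \<mu>) t (y t) * exp (y t)) +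
        of_real (\<alpha> \<mu>) * of_real (v t) * B (of_real (u t)) (of_real (v t)) \<mu> * ((of_real (ln c2) - \<zeta>) * X) = 0"
      unfolding u v[OF t] X_def by (simp add: mult_ac)
  qed
  have "y 0 = of_real (ln c1)" using y by (simp add: is_sol_def)
  then have "dulac_rel s \<alpha> A B c1 c2 \<mu> x (v 1)"
    unfolding dulac_rel_def
    by (intro exI[of _ u] exI[of _ v]) (use leaf c1 c2 x in \<open>auto simp: u_def v_def\<close>)
  moreover have "dulac (complex_vec \<mu>) (x, 0) = of_real (v 1)"
    using v[of 1] by (simp add: dulac_def E_def y_def \<zeta>_def complex_of_real_def)
  ultimately show ?thesis using that by blast
qed

lemma dulac_extension_dulac: "dulac_extension s \<alpha> A B c1 c2 r dulac_radius dulac"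
  unfolding dulac_extension_def
proof (intro conjI allI impI)
  show "continuous_on UNIV dulac_radius" unfolding dulac_radius_def by (intro continuous_intros)
  show "0 < dulac_radius \<phi>" for \<phi> by (simp add: dulac_radius_def)
  show "dulac_radius \<phi> \<le> s" for \<phi>
  proof -
    have "0 \<le> M" "0 \<le> K * \<bar>\<phi>\<bar>" using drift \<alpha>0 by (auto simp: M_def K_def)
    then have "dulac_radius \<phi> \<le> exp (ln c2)" unfolding dulac_radius_def by simp
    then show ?thesis using c2 by simp
  qed
  show "\<exists>y. dulac_rel s \<alpha> A B c1 c2 \<mu> x y \<and> dulac (complex_vec \<mu>) (x, 0) = of_real y"
    if h: "norm \<mu> < r \<and> 0 < x \<and> x < dulac_radius 0" for \<mu> x
  proof -
    obtain y where "dulac_rel s \<alpha> A B c1 c2 \<mu> x y" "dulac (complex_vec \<mu>) (x, 0) = of_real y"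
      by (rule dulac_rel_dulac[of \<mu> x]) (use h in auto)
    then show ?thesis by blast
  qed
qed (use r dulac_analytic in auto)

text \<open>
  Since \<open>Im (exp L) = exp (Re L) sin (Im L)\<close>, the zero locus is the disjoint union of the levels \<open>Im L = k \<pi>\<close>, and
  \<open>arc_of_index\<close> describes each of them. What remains is to identify the leaves over the circle \<open>\<bar>y\<bar> = c1\<close> with the
  solutions of \<open>x' = x * slope t x\<close>, so that the relation \<open>holonomy\<close> is \<open>holonomy_rel\<close>.
\<close>

lemma components_and_curves:
  assumes \<mu>: "norm \<mu> < r"
  shows "\<exists>H :: int \<Rightarrow> (real \<times> real) set.
          bij_betw H UNIV (components (zero_locus dulac_radius dulac \<mu>)) \<and>
          (\<forall>k. \<exists>U. open U \<and> 0 \<in> U \<and>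
            smooth_analytic_arc (curve_C s \<alpha> A B c1 \<mu> k \<inter> U) (of_int k * pi / \<alpha> \<mu>) \<and>
            cover_proj ` H k \<in> components (curve_C s \<alpha> A B c1 \<mu> k \<inter> U - {0}) \<and>
            tangent_to_half_line (cover_proj ` H k) (of_int k * pi / \<alpha> \<mu>))"
proof -
  interpret S: saddle_ratio G \<alpha>0 r \<eta> s c1 c2 \<mu> "\<alpha> \<mu>"
    by unfold_locales (use \<mu> \<eta>_small G_00 in auto)
  define H where "H = (\<lambda>k. cover_point ` S.dulac_level k)"
  define f where "f = (\<lambda>z. Im (S.L (Complex (ln (fst z)) (snd z))))"
  have arc: "\<exists>U. open U \<and> 0 \<in> U \<and> smooth_analytic_arc (S.reflected_curve k \<inter> U) (of_int k * pi / \<alpha> \<mu>) \<and>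
      exp ` S.dulac_level k \<in> components (S.reflected_curve k \<inter> U - {0}) \<and> tangent_to_half_line (exp ` S.dulac_level k) (of_int k * pi / \<alpha> \<mu>)"
    and dulac_level: "connected (S.dulac_level k) \<and> S.dulac_level k \<noteq> {}" for k
    by (rule S.arc_of_index[of k]; blast)+
  have rel: "holonomy s \<alpha> A B c1 \<mu> = S.holonomy_rel"
  proof -
    have "leaf_path s \<alpha> A B \<mu> X (\<lambda>t. of_real c1 * cis (2 * pi * t)) \<longleftrightarrow> S.holonomy_path (X 0) X" for X
    proof -
      have \<gamma>: "(S.\<gamma> has_vector_derivative 2 * of_real pi * \<i> * S.\<gamma> t) (at t within {0..1})" for t
      proof -
        have "((\<lambda>t. of_real (2 * pi * t) * \<i>) has_vector_derivative (2 * of_real pi * \<i>)) (at t within {0..1})"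
          by (auto intro!: derivative_eq_intros)
        then have "((\<lambda>t. exp (of_real (2 * pi * t) * \<i>)) has_vector_derivative (2 * of_real pi * \<i>) * exp (of_real (2 * pi * t) * \<i>)) (at t within {0..1})"
          using field_vector_diff_chain_within[of "\<lambda>t. of_real (2 * pi * t) * \<i>" "2 * of_real pi * \<i>" t "{0..1}" exp]
          by (simp add: o_def DERIV_exp has_field_derivative_at_within)
        then show ?thesis
          unfolding S.\<gamma>_def cis_conv_exp by (auto intro!: derivative_eq_intros simp: mult_ac)
      qed
      have pt: "(norm (X t) < s \<and> norm (S.\<gamma> t) < s \<and>
          (\<exists>X' Y'. (X has_vector_derivative X') (at t within {0..1}) \<and> (S.\<gamma> has_vector_derivative Y') (at t within {0..1}) \<and>
              X t * A (X t) (S.\<gamma> t) \<mu> * Y' + of_real (\<alpha> \<mu>) * S.\<gamma> t * B (X t) (S.\<gamma> t) \<mu> * X' = 0)) \<longleftrightarrow>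
          (norm (X t) < s \<and> (X has_vector_derivative X t * S.slope t (X t)) (at t within {0..1}))"
        if t: "t \<in> {0..1}" for t
      proof (cases "norm (X t) < s")
        case True
        note R = S.in_bidisc(1)[OF True] S.in_bidisc(2)[OF True, of t]
        define a g where "a = A (X t) (S.\<gamma> t) \<mu>" and "g = G (X t) (S.\<gamma> t) (complex_vec \<mu>)"
        have a: "a \<noteq> 0" unfolding a_def by (rule A_nz[OF R \<mu>])
        have g: "g \<noteq> 0" unfolding g_def by (rule S.G_nz[OF R(1)])
        have ag: "of_real (\<alpha> \<mu>) * B (X t) (S.\<gamma> t) \<mu> = g * a" unfolding a_def g_def by (rule G_AB[OF R \<mu>])
        have \<gamma>0: "S.\<gamma> t \<noteq> 0" using S.norm_\<gamma>[of t] c1 by auto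
        have eq: "X t * a * (2 * of_real pi * \<i> * S.\<gamma> t) + of_real (\<alpha> \<mu>) * S.\<gamma> t * B (X t) (S.\<gamma> t) \<mu> * X' = 0
            \<longleftrightarrow> X' = X t * S.slope t (X t)" for X'
        proof -
          have "X t * a * (2 * of_real pi * \<i> * S.\<gamma> t) + of_real (\<alpha> \<mu>) * S.\<gamma> t * B (X t) (S.\<gamma> t) \<mu> * X'
            = X t * a * (2 * of_real pi * \<i> * S.\<gamma> t) + S.\<gamma> t * (of_real (\<alpha> \<mu>) * B (X t) (S.\<gamma> t) \<mu>) * X'"
            by (simp add: mult_ac)
          also have "\<dots> = a * S.\<gamma> t * (X t * (2 * of_real pi * \<i>) + g * X')"
            unfolding ag by (simp add: algebra_simps)
          also have "\<dots> = 0 \<longleftrightarrow> X t * (2 * of_real pi * \<i>) + g * X' = 0" using a \<gamma>0 by simp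
          also have "\<dots> \<longleftrightarrow> X' = X t * S.slope t (X t)"
            using g unfolding S.slope_def g_def[symmetric] by (simp add: field_simps) (auto simp: add_eq_0_iff algebra_simps)
          finally show ?thesis .
        qed
        have uniq: "Y' = 2 * of_real pi * \<i> * S.\<gamma> t" if "(S.\<gamma> has_vector_derivative Y') (at t within {0..1})" for Y'
          using vector_derivative_within_closed_interval[of 0 1 t S.\<gamma>] that \<gamma>[of t] t by auto
        show ?thesis
        proof (intro iffI conjI)
          assume "norm (X t) < s \<and> norm (S.\<gamma> t) < s \<and>
            (\<exists>X' Y'. (X has_vector_derivative X') (at t within {0..1}) \<and> (S.\<gamma> has_vector_derivative Y') (at t within {0..1}) \<and>
              X t * A (X t) (S.\<gamma> t) \<mu> * Y' + of_real (\<alpha> \<mu>) * S.\<gamma> t * B (X t) (S.\<gamma> t) \<mu> * X' = 0)"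
          then obtain X' Y' where d: "(X has_vector_derivative X') (at t within {0..1})"
            "(S.\<gamma> has_vector_derivative Y') (at t within {0..1})"
            "X t * a * Y' + of_real (\<alpha> \<mu>) * S.\<gamma> t * B (X t) (S.\<gamma> t) \<mu> * X' = 0" unfolding a_def by blast
          have "X' = X t * S.slope t (X t)" using d(3) eq[of X'] unfolding uniq[OF d(2)] by blast
          then show "(X has_vector_derivative X t * S.slope t (X t)) (at t within {0..1})" using d(1) by simp
        next
          assume "norm (X t) < s \<and> (X has_vector_derivative X t * S.slope t (X t)) (at t within {0..1})"
          then show "\<exists>X' Y'. (X has_vector_derivative X') (at t within {0..1}) \<and> (S.\<gamma> has_vector_derivative Y') (at t within {0..1}) \<and>
              X t * A (X t) (S.\<gamma> t) \<mu> * Y' + of_real (\<alpha> \<mu>) * S.\<gamma> t * B (X t) (S.\<gamma> t) \<mu> * X' = 0"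
            using \<gamma>[of t] eq[of "X t * S.slope t (X t)"] unfolding a_def by blast
          show "norm (S.\<gamma> t) < s" using S.norm_\<gamma>[of t] c1 by simp
        qed (use True in auto)
      qed auto
      have \<gamma>_eq: "(\<lambda>t. of_real c1 * cis (2 * pi * t)) = S.\<gamma>" by (auto simp: S.\<gamma>_def)
      show ?thesis unfolding \<gamma>_eq leaf_path_def S.holonomy_path_def simp_thms by (rule ball_cong[OF refl pt])
    qed
    then show ?thesis unfolding holonomy_def S.holonomy_rel_def by auto
  qed
  have reflected_curve: "curve_C s \<alpha> A B c1 \<mu> k = S.reflected_curve k" for k unfolding curve_C_def S.reflected_curve_def rel ..
  have proj: "cover_proj ` H k = exp ` S.dulac_level k" for k
    unfolding H_def image_image by (simp add: cover_proj_def cover_point_def rcis_def exp_eq_polar)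
  have zl: "z \<in> zero_locus dulac_radius dulac \<mu> \<longleftrightarrow> z \<in> cover_domain dulac_radius \<and> (\<exists>k::int. f z = of_int k * pi)" for z
  proof -
    have "Im (dulac (complex_vec \<mu>) z) = exp (Re (S.L (Complex (ln (fst z)) (snd z)))) * sin (f z)"
      by (simp add: dulac_def S.L_def f_def Im_exp)
    then show ?thesis by (auto simp: zero_locus_def sin_zero_iff_int2)
  qed
  have Heq: "H k = {z \<in> zero_locus dulac_radius dulac \<mu>. f z = of_int k * pi}" for k
  proof (intro equalityI subsetI)
    fix z assume "z \<in> H k"
    then obtain \<zeta> where \<zeta>: "\<zeta> \<in> S.dulac_level k" "z = cover_point \<zeta>" by (auto simp: H_def)
    then have "\<zeta> \<in> \<Omega>" "f z = of_int k * pi" by (auto simp: S.dulac_level_def f_def cover_point_def)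
    then show "z \<in> {z \<in> zero_locus dulac_radius dulac \<mu>. f z = of_int k * pi}"
      using zl cover_point_in_domain \<zeta>(2) by auto
  next
    fix z assume "z \<in> {z \<in> zero_locus dulac_radius dulac \<mu>. f z = of_int k * pi}"
    then have z: "z \<in> cover_domain dulac_radius" "f z = of_int k * pi" using zl by auto
    define \<zeta> where "\<zeta> = Complex (ln (fst z)) (snd z)"
    have "0 < fst z" "\<zeta> \<in> \<Omega>" using z(1) unfolding cover_domain_iff by (auto simp: \<zeta>_def)
    then have "z = cover_point \<zeta>" "\<zeta> \<in> S.dulac_level k" using z(2) by (auto simp: cover_point_def \<zeta>_def f_def S.dulac_level_def)
    then show "z \<in> H k" by (auto simp: H_def)
  qed
  have bij: "bij_betw (\<lambda>k::int. {z \<in> zero_locus dulac_radius dulac \<mu>. f z = of_int k * pi}) UNIV (components (zero_locus dulac_radius dulac \<mu>))"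
  proof (rule components_of_levels)
    have "S.L holomorphic_on cone 1" unfolding S.L_def
      by (rule holomorphic_E) (use open_cone S.lc1 S.norm_complex_vec in auto)
    then have cL: "continuous_on (cone 1) S.L" by (rule holomorphic_on_imp_continuous_on)
    have dom: "0 < fst z" "Complex (ln (fst z)) (snd z) \<in> cone 1" if "z \<in> zero_locus dulac_radius dulac \<mu>" for z
      using that zl cover_domain_iff \<Omega>_cone cone_antimono[of 1 2] by auto
    show "continuous_on (zero_locus dulac_radius dulac \<mu>) f"
      unfolding f_def Complex_eq
      by (intro continuous_intros continuous_on_compose2[OF cL]) (use dom in \<open>auto simp: Complex_eq less_imp_neq[THEN not_sym]\<close>)
    show "\<exists>k::int. f x = of_int k * pi" if "x \<in> zero_locus dulac_radius dulac \<mu>" for x using that zl by auto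
    show "connected {x \<in> zero_locus dulac_radius dulac \<mu>. f x = real_of_int k * pi}" for k
      unfolding Heq[symmetric] H_def cover_point_def
      by (intro connected_continuous_image continuous_intros) (use dulac_level in auto)
    show "{x \<in> zero_locus dulac_radius dulac \<mu>. f x = real_of_int k * pi} \<noteq> {}" for k
      unfolding Heq[symmetric] H_def using dulac_level by auto
  qed
  then have "bij_betw H UNIV (components (zero_locus dulac_radius dulac \<mu>))" unfolding Heq[abs_def, symmetric] by (simp add: Heq[symmetric])
  then show ?thesis using arc unfolding reflected_curve proj[symmetric] by blast
qed

end

text \<open>
  \<open>\<eta>\<close> depends only on \<open>\<alpha> 0\<close>, and then \<open>r\<close> is chosen by continuity of \<open>\<alpha> B / A\<close> at the origin, where its value is \<open>\<alpha> 0\<close>. The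
  component \<open>\<alpha>\<close> is complexified as a germ in \<open>(x, y, \<mu>)\<close> too and then evaluated at \<open>x = y = 0\<close>, which makes
  it a holomorphic function of the complex parameter.
\<close>

lemma saddle_family_imp_saddle:
  fixes \<alpha> :: "real^'n::finite \<Rightarrow> real" and A B :: "complex \<Rightarrow> complex \<Rightarrow> real^'n \<Rightarrow> complex"
  assumes "saddle_family \<alpha> A B"
  obtains G \<alpha>0 r \<eta> where "saddle G \<alpha>0 r \<eta>"
    "\<And>x y \<mu>. norm x < r \<Longrightarrow> norm y < r \<Longrightarrow> norm \<mu> < r \<Longrightarrow> A x y \<mu> \<noteq> 0"
    "\<And>x y \<mu>. norm x < r \<Longrightarrow> norm y < r \<Longrightarrow> norm \<mu> < r \<Longrightarrow>
        of_real (\<alpha> \<mu>) * B x y \<mu> = G x y (complex_vec \<mu>) * A x y \<mu>"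
    "\<And>\<mu>. norm \<mu> < r \<Longrightarrow> G 0 0 (complex_vec \<mu>) = of_real (\<alpha> \<mu>)"
    "832 * \<eta> * (1 + \<alpha>0) \<le> \<alpha>0\<^sup>2"
proof -
  define \<alpha>0 where "\<alpha>0 = \<alpha> 0"
  have \<alpha>0: "0 < \<alpha>0" using assms by (simp add: saddle_family_def \<alpha>0_def)
  obtain ra \<alpha>c where a: "0 < ra" "holomorphic_on_polydisc ra \<alpha>c"
    "\<And>x y \<mu>. norm x < ra \<Longrightarrow> norm y < ra \<Longrightarrow> norm \<mu> < ra \<Longrightarrow> \<alpha>c x y (complex_vec \<mu>) = of_real (\<alpha> \<mu>)"
    by (rule real_analytic_germ_complexification[of "\<lambda>x y \<mu>. of_real (\<alpha> \<mu>)"])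
       (use assms in \<open>auto simp: saddle_family_def\<close>)
  have "real_analytic_germ A" "real_analytic_germ B" using assms by (auto simp: saddle_family_def)
  obtain rA Ac where A: "0 < rA" "holomorphic_on_polydisc rA Ac"
    "\<And>x y \<mu>. norm x < rA \<Longrightarrow> norm y < rA \<Longrightarrow> norm \<mu> < rA \<Longrightarrow> Ac x y (complex_vec \<mu>) = A x y \<mu>"
    "\<And>x y \<mu>. norm x < rA \<Longrightarrow> norm y < rA \<Longrightarrow> norm \<mu> < rA \<Longrightarrow> A (cnj x) (cnj y) \<mu> = cnj (A x y \<mu>)"
    by (rule real_analytic_germ_complexification[OF \<open>real_analytic_germ A\<close>]) (rule that)
  obtain rB Bc where B: "0 < rB" "holomorphic_on_polydisc rB Bc"
    "\<And>x y \<mu>. norm x < rB \<Longrightarrow> norm y < rB \<Longrightarrow> norm \<mu> < rB \<Longrightarrow> Bc x y (complex_vec \<mu>) = B x y \<mu>"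
    "\<And>x y \<mu>. norm x < rB \<Longrightarrow> norm y < rB \<Longrightarrow> norm \<mu> < rB \<Longrightarrow> B (cnj x) (cnj y) \<mu> = cnj (B x y \<mu>)"
    by (rule real_analytic_germ_complexification[OF \<open>real_analytic_germ B\<close>]) (rule that)
  define \<eta> where "\<eta> = min (\<alpha>0 / 200) (\<alpha>0\<^sup>2 / (832 * (1 + \<alpha>0)))"
  have \<eta>: "0 < \<eta>" "\<eta> \<le> \<alpha>0 / 200" "832 * \<eta> * (1 + \<alpha>0) \<le> \<alpha>0\<^sup>2"
  proof -
    show "\<eta> \<le> \<alpha>0 / 200" unfolding \<eta>_def by (rule min.cobounded1)
    have "\<eta> \<le> \<alpha>0\<^sup>2 / (832 * (1 + \<alpha>0))" by (simp add: \<eta>_def)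
    then have "\<eta> * (832 * (1 + \<alpha>0)) \<le> \<alpha>0\<^sup>2" using \<alpha>0 by (simp add: pos_le_divide_eq)
    then show "832 * \<eta> * (1 + \<alpha>0) \<le> \<alpha>0\<^sup>2" by (simp add: mult_ac)
  qed (use \<alpha>0 in \<open>auto simp: \<eta>_def\<close>)
  obtain r1 where r1: "r1 > 0" "\<And>\<mu>. norm \<mu> < r1 \<Longrightarrow> A 0 0 \<mu> = 1 \<and> B 0 0 \<mu> = 1"
    using assms unfolding saddle_family_def eventually_nhds_metric by (auto simp: dist_norm)
  define r0 where "r0 = min ra (min rA rB)"
  have r0: "0 < r0" "r0 \<le> ra" "r0 \<le> rA" "r0 \<le> rB" using a A B by (auto simp: r0_def)
  define P where "P = (\<lambda>r. {(x::complex, y::complex, m::complex^'n). norm x < r \<and> norm y < r \<and> norm m < r})"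
  define G where "G = (\<lambda>x y m. \<alpha>c 0 0 m * Bc x y m / Ac x y m)"
  have openP: "open (P r)" for r
  proof -
    have "P r = ball 0 r \<times> ball 0 r \<times> ball 0 r" by (auto simp: P_def)
    then show ?thesis by (simp add: open_Times)
  qed
  have cont: "continuous_on (P r) (\<lambda>p. F (fst p) (fst (snd p)) (snd (snd p)))"
    if "holomorphic_on_polydisc r' F" "r \<le> r'" for r r' F
    using that unfolding holomorphic_on_polydisc_def P_def split_def
    by (auto elim!: continuous_on_subset)
  have ca: "continuous_on (P r) (\<lambda>p. \<alpha>c 0 0 (snd (snd p)))" if "r \<le> ra" for r
  proof -
    have "continuous_on (P r) (\<lambda>p. (\<lambda>p. \<alpha>c (fst p) (fst (snd p)) (snd (snd p))) (0, 0, snd (snd p)))"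
      by (rule continuous_on_compose2[OF cont[OF a(2) order_refl]]) (use that a(1) in \<open>auto simp: P_def intro!: continuous_intros\<close>)
    then show ?thesis by simp
  qed
  have 0: "(0, 0, 0) \<in> P r0" using r0 by (simp add: P_def)
  have cv0: "complex_vec (0 :: real^'n) = 0" by (simp add: complex_vec_def vec_eq_iff)
  have vals: "Ac 0 0 0 = 1" "Bc 0 0 0 = 1" "\<alpha>c 0 0 0 = of_real \<alpha>0"
    using A(1) A(3)[of 0 0 0] B(1) B(3)[of 0 0 0] a(1) a(3)[of 0 0 0] r1 by (auto simp: cv0 \<alpha>0_def)
  have isC: "isCont (\<lambda>p. Ac (fst p) (fst (snd p)) (snd (snd p))) (0, 0, 0)"
    "isCont (\<lambda>p. Bc (fst p) (fst (snd p)) (snd (snd p))) (0, 0, 0)"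
    "isCont (\<lambda>p :: complex \<times> complex \<times> (complex^'n). \<alpha>c 0 0 (snd (snd p))) (0, 0, 0)"
    using continuous_on_interior[OF cont[OF A(2) r0(3)]] continuous_on_interior[OF cont[OF B(2) r0(4)]]
      continuous_on_interior[OF ca[OF r0(2)]] 0 openP by (auto simp: interior_open)
  then have "isCont (\<lambda>p. G (fst p) (fst (snd p)) (snd (snd p))) (0, 0, 0)"
    unfolding G_def by (intro continuous_intros) (auto simp: vals)
  then have "\<forall>\<^sub>F p in nhds (0, 0, 0). dist (G (fst p) (fst (snd p)) (snd (snd p))) (G 0 0 0) < \<eta>"
    using \<eta>(1) by (simp add: continuous_at tendsto_nhds_iff tendstoD flip: tendsto_at_iff_tendsto_nhds)
  moreover have "\<forall>\<^sub>F p in nhds (0, 0, 0). Ac (fst p) (fst (snd p)) (snd (snd p)) \<noteq> 0"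
  proof -
    have "((\<lambda>p. Ac (fst p) (fst (snd p)) (snd (snd p))) \<longlongrightarrow> 1) (nhds (0, 0, 0))"
      using isC(1) tendsto_at_iff_tendsto_nhds[of "\<lambda>p. Ac (fst p) (fst (snd p)) (snd (snd p))" "(0, 0, 0)"]
      by (simp add: continuous_at vals)
    then show ?thesis by (rule tendsto_imp_eventually_ne) simp
  qed
  ultimately have "\<forall>\<^sub>F p in nhds (0, 0, 0). dist (G (fst p) (fst (snd p)) (snd (snd p))) (G 0 0 0) < \<eta> \<and>
      Ac (fst p) (fst (snd p)) (snd (snd p)) \<noteq> 0" by eventually_elim auto
  then obtain d where d: "d > 0" "\<And>p. dist p (0, 0, 0) < d \<Longrightarrow>
      dist (G (fst p) (fst (snd p)) (snd (snd p))) (G 0 0 0) < \<eta> \<and> Ac (fst p) (fst (snd p)) (snd (snd p)) \<noteq> 0"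
    unfolding eventually_nhds_metric by blast
  define r where "r = min (min r0 r1) (d / 3)"
  have r: "0 < r" "r \<le> r0" "r \<le> r1" "r \<le> d / 3" using r0 r1 d by (auto simp: r_def)
  have nearAc: "norm (G x y m - of_real \<alpha>0) \<le> \<eta> \<and> Ac x y m \<noteq> 0" if "norm x < r" "norm y < r" "norm m < r" for x y m
  proof -
    have "norm (x, y, m) \<le> norm x + (norm y + norm m)"
      using norm_Pair_le[of x "(y, m)"] norm_Pair_le[of y m] by linarith
    then have "dist (x, y, m) (0, 0, 0) < d" using that r(4) by (simp add: dist_norm)
    then show ?thesis using d(2)[of "(x, y, m)"] by (auto simp: dist_norm G_def vals)
  qed
  have eqs: "\<alpha>c 0 0 (complex_vec \<mu>) = of_real (\<alpha> \<mu>)" "Ac x y (complex_vec \<mu>) = A x y \<mu>" "Bc x y (complex_vec \<mu>) = B x y \<mu>"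
    if "norm x < r" "norm y < r" "norm \<mu> < r" for x y \<mu>
    using a(1,3) A(3) B(3) r r0 that by auto
  have ncv: "norm (complex_vec \<mu>) = norm \<mu>" for \<mu> :: "real^'n"
    by (simp add: complex_vec_def norm_vec_def L2_set_def)
  have hol: "(\<lambda>z. F (x z) (y z) (m z)) holomorphic_on U"
    if "holomorphic_on_polydisc r' F" "r \<le> r'" "open U" "x holomorphic_on U" "y holomorphic_on U" "\<And>i. (\<lambda>z. m z $ i) holomorphic_on U"
      "\<And>z. z \<in> U \<Longrightarrow> norm (x z) < r \<and> norm (y z) < r \<and> norm (m z) < r" for r' F U x y and m :: "complex \<Rightarrow> complex^'n"
    by (rule that(1)[unfolded holomorphic_on_polydisc_def, THEN conjunct2, rule_format]) (use that in fastforce)+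
  have "saddle G \<alpha>0 r \<eta>"
  proof
    show "holomorphic_on_polydisc r G"
      unfolding holomorphic_on_polydisc_def
    proof (intro conjI allI impI)
      have "continuous_on (P r) (\<lambda>p. G (fst p) (fst (snd p)) (snd (snd p)))"
        unfolding G_def
        by (intro continuous_intros ca cont[OF A(2)] cont[OF B(2)]) (use r r0 nearAc in \<open>auto simp: P_def\<close>)
      then show "continuous_on {(x, y, m). norm x < r \<and> norm y < r \<and> norm m < r} (\<lambda>(x, y, m). G x y m)"
        by (simp add: P_def split_def)
      fix U x y and m :: "complex \<Rightarrow> complex^'n"
      assume h: "open U" "x holomorphic_on U" "y holomorphic_on U" "\<forall>i. (\<lambda>z. m z $ i) holomorphic_on U"
        "\<forall>z\<in>U. norm (x z) < r \<and> norm (y z) < r \<and> norm (m z) < r"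
      show "(\<lambda>z. G (x z) (y z) (m z)) holomorphic_on U"
        unfolding G_def
      proof (intro holomorphic_intros)
        show "(\<lambda>z. \<alpha>c 0 0 (m z)) holomorphic_on U" by (rule hol[OF a(2)]) (use h r r0 in auto)
        show "(\<lambda>z. Bc (x z) (y z) (m z)) holomorphic_on U" by (rule hol[OF B(2)]) (use h r r0 in auto)
        show "(\<lambda>z. Ac (x z) (y z) (m z)) holomorphic_on U" by (rule hol[OF A(2)]) (use h r r0 in auto)
        show "Ac (x z) (y z) (m z) \<noteq> 0" if "z \<in> U" for z using nearAc h(5) that by blast
      qed
    qed
    fix x y :: complex and \<mu> :: "real^'n" assume h: "norm x < r" "norm y < r" "norm \<mu> < r"
    then have h': "norm (cnj x) < r" "norm (cnj y) < r" by auto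
    show "G (cnj x) (cnj y) (complex_vec \<mu>) = cnj (G x y (complex_vec \<mu>))"
      unfolding G_def eqs[OF h] eqs[OF h' h(3)] using A(4)[of x y \<mu>] B(4)[of x y \<mu>] h r r0 by simp
  qed (use \<alpha>0 r \<eta> nearAc in auto)
  moreover have "A x y \<mu> \<noteq> 0" "of_real (\<alpha> \<mu>) * B x y \<mu> = G x y (complex_vec \<mu>) * A x y \<mu>"
    if h: "norm x < r" "norm y < r" "norm \<mu> < r" for x y \<mu>
  proof -
    show nz: "A x y \<mu> \<noteq> 0" using nearAc[of x y "complex_vec \<mu>"] eqs[OF h] h by (simp add: ncv)
    show "of_real (\<alpha> \<mu>) * B x y \<mu> = G x y (complex_vec \<mu>) * A x y \<mu>" unfolding G_def eqs[OF h] using nz by simp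
  qed
  moreover have "G 0 0 (complex_vec \<mu>) = of_real (\<alpha> \<mu>)" if "norm \<mu> < r" for \<mu>
    using eqs[of 0 0 \<mu>] r1(2)[of \<mu>] that r by (simp add: G_def)
  ultimately show ?thesis using that \<eta>(3) by blast
qed

theorem lemma2:
  fixes \<alpha> :: "real^'n::finite \<Rightarrow> real"
    and A B :: "complex \<Rightarrow> complex \<Rightarrow> real^'n \<Rightarrow> complex"
  assumes "saddle_family \<alpha> A B"
  shows "\<exists>s0>0. \<forall>s c1 c2. 0 < s \<and> s \<le> s0 \<and> 0 < c1 \<and> c1 < s \<and> 0 < c2 \<and> c2 < s \<longrightarrow>
    (\<exists>\<epsilon>0 \<rho> D. dulac_extension s \<alpha> A B c1 c2 \<epsilon>0 \<rho> D \<and>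
      (\<forall>\<mu>. norm \<mu> < \<epsilon>0 \<longrightarrow>
        (\<exists>H :: int \<Rightarrow> (real \<times> real) set.
          bij_betw H UNIV (components (zero_locus \<rho> D \<mu>)) \<and>
          (\<forall>k. \<exists>U. open U \<and> 0 \<in> U \<and>
            smooth_analytic_arc (curve_C s \<alpha> A B c1 \<mu> k \<inter> U) (of_int k * pi / \<alpha> \<mu>) \<and>
            cover_proj ` H k \<in> components (curve_C s \<alpha> A B c1 \<mu> k \<inter> U - {0}) \<and>
            tangent_to_half_line (cover_proj ` H k) (of_int k * pi / \<alpha> \<mu>)))))"
proof -
  obtain G \<alpha>0 r \<eta> where G: "saddle G \<alpha>0 r \<eta>"
    and AB: "\<And>x y \<mu>. norm x < r \<Longrightarrow> norm y < r \<Longrightarrow> norm \<mu> < r \<Longrightarrow> A x y \<mu> \<noteq> 0"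
    "\<And>x y \<mu>. norm x < r \<Longrightarrow> norm y < r \<Longrightarrow> norm \<mu> < r \<Longrightarrow>
        of_real (\<alpha> \<mu>) * B x y \<mu> = G x y (complex_vec \<mu>) * A x y \<mu>"
    "\<And>\<mu>. norm \<mu> < r \<Longrightarrow> G 0 0 (complex_vec \<mu>) = of_real (\<alpha> \<mu>)"
    "832 * \<eta> * (1 + \<alpha>0) \<le> \<alpha>0\<^sup>2"
    by (rule saddle_family_imp_saddle[OF assms]) (rule that)
  interpret saddle G \<alpha>0 r \<eta> by (rule G)
  show ?thesis
  proof (rule exI[of _ "r/3"], intro conjI allI impI)
    show "0 < r/3" using r by simp
    fix s c1 c2 :: real
    assume h: "0 < s \<and> s \<le> r/3 \<and> 0 < c1 \<and> c1 < s \<and> 0 < c2 \<and> c2 < s"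
    interpret saddle_foliation \<alpha>0 r \<eta> s c1 c2 G \<alpha> A B
      by unfold_locales (use h AB in auto)
    show "\<exists>\<epsilon>0 \<rho> D. dulac_extension s \<alpha> A B c1 c2 \<epsilon>0 \<rho> D \<and>
      (\<forall>\<mu>. norm \<mu> < \<epsilon>0 \<longrightarrow>
        (\<exists>H :: int \<Rightarrow> (real \<times> real) set.
          bij_betw H UNIV (components (zero_locus \<rho> D \<mu>)) \<and>
          (\<forall>k. \<exists>U. open U \<and> 0 \<in> U \<and>
            smooth_analytic_arc (curve_C s \<alpha> A B c1 \<mu> k \<inter> U) (of_int k * pi / \<alpha> \<mu>) \<and>
            cover_proj ` H k \<in> components (curve_C s \<alpha> A B c1 \<mu> k \<inter> U - {0}) \<and>
            tangent_to_half_line (cover_proj ` H k) (of_int k * pi / \<alpha> \<mu>))))"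
      using dulac_extension_dulac components_and_curves by blast
  qed
qed

end
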